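(* Let $(\Omega,T)$ be minimal, $W\in C^0(\Omega,\mathbb R)$, and let $V\in C^\omega(\mathbb T,\mathbb R)$ be non-constant. For every $E\in\mathbb R$ there exist $\varepsilon_0=\varepsilon_0(E,V,W)>0$ and $\delta_1=\delta_1(E,V)>0$ such that the following holds. If $|\varepsilon|<\varepsilon_0$, then for every $\zeta\in I_{\delta_1}:=\{\zeta\in\mathbb C:|\zeta-E|<\delta_1\}$, $\zeta$ belongs to the spectrum of the infinite-range operator $\mathbf L_{V,\varepsilon W,T,\theta}$ if and only if the center cocycle $(T,C^\infty_\varepsilon(\zeta,\cdot))$ is not uniformly hyperbolic.
   Context: $\Omega$ is a compact metric space and $T:\Omega\to\Omega$ a homeomorphism (minimal: every orbit is dense). $V$ is identified via $z=e^{2\pi i x}$ with $V(z)=\sum_n\widehat v_nz^n$, analytic in $\{e^{-h}<|z|<e^h\}$ for a fixed $h>0$; fix $0<\xi<h$. The operator $(\mathbf L_{V,\varepsilon W,T,\theta}u)_n=\sum_{k\in\mathbb Z}\widehat v_ku_{n+k}+\varepsilon W(T^n\theta)u_n$ acts on $\ell^2(\mathbb Z)$; by minimality its spectrum does not depend on $\theta\in\Omega$. $\mathcal X_\xi=\{u=(u_n)_{n\in\mathbb Z}:\|u\|_\xi=\sum_n|u_n|e^{-\xi|n|}<\infty\}$ and $(Su)_n=u_{n+1}$. Center cocycle near $E$. Let $2m=2m(E)$ be the (even) number of zeros of $V(z)-E$ on $|z|=1$ counted with multiplicity, and choose $e^{-\xi}<r_-<1<r_+<e^\xi$ such that the only zeros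 of $V(z)-E$ in $r_-\le|z|\le r_+$ lie on $|z|=1$. Write $\oint_{\Gamma_c}=\oint_{|z|=r_+}-\oint_{|z|=r_-}$ (both counterclockwise). For $\zeta$ in a sufficiently small complex disc around $E$ and $|\varepsilon|$ sufficiently small, the operator $(D_{\zeta,\varepsilon}(z)f)(\theta)=\sum_j\widehat v_jz^jf(T^j\theta)-\zeta f(\theta)+\varepsilon W(\theta)f(\theta)$ on $C^0(\Omega,\mathbb C)$ is invertible for $|z|=r_\pm$; put $g_{\zeta,\varepsilon}(z,\cdot)=D_{\zeta,\varepsilon}(z)^{-1}\mathbf 1$ and $$u^{\infty,p}_{\varepsilon;k}(\zeta,\theta)=\frac1{2\pi i}\oint_{\Gamma_c}z^{k+p}g_{\zeta,\varepsilon}(z,T^k\theta)\,dz,\qquad k\in\mathbb Z,\ 0\le p\le 2m-1.$$ For each $\theta$, the sequences $u_\varepsilon^{\infty,p}(\zeta,\theta)$ form a basis of the center space, which consists of all $u\in\mathcal X_\xi$ with $\mathbf L_{V,\varepsilon W,T,\theta}u=\zeta u$, $\sup_{n\ge0}r_+^{-n}\|S^nu\|_\xi<\infty$ and $\sup_{n\ge0}r_-^n\|S^{-n}u\|_\xi<\infty$. With $U_\varepsilon^\infty=(u_\varepsilon^{\infty,0},\dots,u_\varepsilon^{\infty,2m-1})$, the center cocycle $C_\varepsilon^\infty(\zeta,\cdot):\Omega\to\mathrm{GL}(2m,\mathbb C)$ is defined by $SU^\infty_\varepsilon(\zeta,\theta)=U^\infty_\varepsilon(\zeta,T\theta)C^\infty_\varepsilon(\zeta,\theta)$.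 A cocycle $(T,A)$ with $A:\Omega\to\mathrm{GL}(q,\mathbb C)$ continuous is uniformly hyperbolic if there is a continuous invariant splitting $\mathbb C^q=E^s(\theta)\oplus E^u(\theta)$ on which the iterates $A(T^{n-1}\theta)\cdots A(\theta)$ contract $E^s$, and their inverses contract $E^u$, uniformly exponentially. A cocycle of dimension $q=0$ is regarded as uniformly hyperbolic. *)

theory Defs
  imports
    "HOL-Complex_Analysis.Complex_Analysis"
    "Jordan_Normal_Form.VS_Connect"
begin

section \<open>Minimal homeomorphisms\<close>

definition ziter :: "('a \<Rightarrow> 'a) \<Rightarrow> int \<Rightarrow> 'a \<Rightarrow> 'a" where
  "ziter T n = (if 0 \<le> n then T ^^ nat n else (inv_into UNIV T) ^^ nat (- n))"

definition minimal_homeo :: "('a::topological_space \<Rightarrow> 'a) \<Rightarrow> bool" where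
  "minimal_homeo T \<longleftrightarrow>
     homeomorphism UNIV UNIV T (inv_into UNIV T) \<and>
     (\<forall>\<theta>. closure (range (\<lambda>n. ziter T n \<theta>)) = UNIV)"

section \<open>The infinite-range operator and its spectrum\<close>

text \<open>
  A 1-periodic potential is represented by its expression \<open>V\<close> in the variable
  \<open>z = exp (2 \<pi> i x)\<close>, so that the Laurent coefficients of \<open>V\<close> on an annulus around the
  unit circle are the Fourier coefficients in \<open>x\<close>.
\<close>

definition fourier_coeff :: "(complex \<Rightarrow> complex) \<Rightarrow> int \<Rightarrow> complex" where
  "fourier_coeff V n = integral {0..1} (\<lambda>x. V (cis (2 * pi * x)) * cis (- (2 * pi * of_int n * x)))"

definition annulus :: "real \<Rightarrow> complex set" where
  "annulus h = {z. exp (- h) < cmod z \<and> cmod z < exp h}"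

text \<open>For \<open>u\<close> in \<open>\<ell>\<^sup>2(\<int>)\<close> the series over \<open>k\<close> converges absolutely.\<close>

definition L_op ::
  "(complex \<Rightarrow> complex) \<Rightarrow> ('a \<Rightarrow> 'a) \<Rightarrow> ('a \<Rightarrow> real) \<Rightarrow> real \<Rightarrow> 'a \<Rightarrow> (int \<Rightarrow> complex) \<Rightarrow> int \<Rightarrow> complex"
where
  "L_op V T W \<epsilon> \<theta> u n =
     (\<Sum>\<^sub>\<infinity>k. fourier_coeff V k * u (n + k)) + of_real (\<epsilon> * W (ziter T n \<theta>)) * u n"

definition l2 :: "(int \<Rightarrow> complex) set" where
  "l2 = {u. (\<lambda>n. (cmod (u n))\<^sup>2) summable_on UNIV}"

definition l2_norm :: "(int \<Rightarrow> complex) \<Rightarrow> real" where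
  "l2_norm u = sqrt (\<Sum>\<^sub>\<infinity>n. (cmod (u n))\<^sup>2)"

definition bounded_l2_op :: "((int \<Rightarrow> complex) \<Rightarrow> int \<Rightarrow> complex) \<Rightarrow> bool" where
  "bounded_l2_op B \<longleftrightarrow>
     (\<forall>u\<in>l2. B u \<in> l2) \<and>
     (\<forall>u\<in>l2. \<forall>v\<in>l2. B (\<lambda>n. u n + v n) = (\<lambda>n. B u n + B v n)) \<and>
     (\<forall>c. \<forall>u\<in>l2. B (\<lambda>n. c * u n) = (\<lambda>n. c * B u n)) \<and>
     (\<exists>K. \<forall>u\<in>l2. l2_norm (B u) \<le> K * l2_norm u)"

definition l2_spectrum :: "((int \<Rightarrow> complex) \<Rightarrow> int \<Rightarrow> complex) \<Rightarrow> complex set" where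
  "l2_spectrum A = {\<zeta>. \<not> (\<exists>R. bounded_l2_op R \<and>
     (\<forall>u\<in>l2. R (\<lambda>n. A u n - \<zeta> * u n) = u \<and> (\<lambda>n. A (R u) n - \<zeta> * R u n) = u))}"

section \<open>The center cocycle\<close>

text \<open>This is the number \<open>2 m(E)\<close>.\<close>

definition center_dim :: "(complex \<Rightarrow> complex) \<Rightarrow> complex \<Rightarrow> nat" where
  "center_dim V E = (\<Sum>z | cmod z = 1 \<and> V z = E. nat (zorder (\<lambda>w. V w - E) z))"

definition D_op ::
  "(complex \<Rightarrow> complex) \<Rightarrow> ('a \<Rightarrow> 'a) \<Rightarrow> ('a \<Rightarrow> real) \<Rightarrow> real \<Rightarrow> complex \<Rightarrow> complex \<Rightarrow> ('a \<Rightarrow> complex) \<Rightarrow> 'a \<Rightarrow> complex"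
where
  "D_op V T W \<epsilon> \<zeta> z f \<theta> =
     (\<Sum>\<^sub>\<infinity>j. fourier_coeff V j * z powi j * f (ziter T j \<theta>)) - \<zeta> * f \<theta> + of_real (\<epsilon> * W \<theta>) * f \<theta>"

definition g_fun ::
  "(complex \<Rightarrow> complex) \<Rightarrow> ('a::topological_space \<Rightarrow> 'a) \<Rightarrow> ('a \<Rightarrow> real) \<Rightarrow> real \<Rightarrow> complex \<Rightarrow> complex \<Rightarrow> 'a \<Rightarrow> complex"
where
  "g_fun V T W \<epsilon> \<zeta> z = inv_into {f. continuous_on UNIV f} (D_op V T W \<epsilon> \<zeta> z) (\<lambda>\<theta>. 1)"

definition u_center ::
  "(complex \<Rightarrow> complex) \<Rightarrow> ('a::topological_space \<Rightarrow> 'a) \<Rightarrow> ('a \<Rightarrow> real) \<Rightarrow> real \<Rightarrow> real \<Rightarrow> real \<Rightarrow> complex \<Rightarrow> 'a \<Rightarrow> nat \<Rightarrow> int \<Rightarrow> complex"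
where
  "u_center V T W rm rp \<epsilon> \<zeta> \<theta> p k =
     (let F = (\<lambda>z. z powi (k + int p) * g_fun V T W \<epsilon> \<zeta> z (ziter T k \<theta>))
      in (contour_integral (circlepath 0 rp) F - contour_integral (circlepath 0 rm) F)
           / (2 * of_real pi * \<i>))"

text \<open>
  The matrix identity \<open>S U(\<theta>) = U(T \<theta>) C(\<theta>)\<close>, read columnwise: the shift of the
  \<open>p\<close>-th sequence at \<open>\<theta>\<close> is the combination of the sequences at \<open>T \<theta>\<close> with the
  entries of the \<open>p\<close>-th column of \<open>C(\<theta>)\<close> as coefficients. It determines \<open>C(\<theta>)\<close>
  because the sequences at \<open>T \<theta>\<close> are linearly independent for small parameters.
\<close>

definition center_cocycle ::
  "(complex \<Rightarrow> complex) \<Rightarrow> complex \<Rightarrow> ('a::topological_space \<Rightarrow> 'a) \<Rightarrow> ('a \<Rightarrow> real) \<Rightarrow> real \<Rightarrow> real \<Rightarrow> real \<Rightarrow> complex \<Rightarrow> 'a \<Rightarrow> complex mat"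
where
  "center_cocycle V E T W rm rp \<epsilon> \<zeta> \<theta> =
     (THE C. C \<in> carrier_mat (center_dim V E) (center_dim V E) \<and>
        (\<forall>p < center_dim V E. \<forall>k.
           u_center V T W rm rp \<epsilon> \<zeta> \<theta> p (k + 1) =
           (\<Sum>i < center_dim V E. u_center V T W rm rp \<epsilon> \<zeta> (T \<theta>) i k * C $$ (i, p))))"

section \<open>Uniform hyperbolicity\<close>

definition continuous_mat :: "nat \<Rightarrow> ('a::topological_space \<Rightarrow> complex mat) \<Rightarrow> bool" where
  "continuous_mat q A \<longleftrightarrow>
     (\<forall>\<theta>. A \<theta> \<in> carrier_mat q q) \<and>
     (\<forall>i<q. \<forall>j<q. continuous_on UNIV (\<lambda>\<theta>. A \<theta> $$ (i, j)))"

definition GL_cocycle :: "nat \<Rightarrow> ('a::topological_space \<Rightarrow> complex mat) \<Rightarrow> bool" where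
  "GL_cocycle q A \<longleftrightarrow> continuous_mat q A \<and> (\<forall>\<theta>. invertible_mat (A \<theta>))"

primrec cocycle_iter :: "nat \<Rightarrow> ('a \<Rightarrow> 'a) \<Rightarrow> ('a \<Rightarrow> complex mat) \<Rightarrow> nat \<Rightarrow> 'a \<Rightarrow> complex mat" where
  "cocycle_iter q T A 0 \<theta> = 1\<^sub>m q"
| "cocycle_iter q T A (Suc n) \<theta> = A ((T ^^ n) \<theta>) * cocycle_iter q T A n \<theta>"

definition cvec_norm :: "complex vec \<Rightarrow> real" where
  "cvec_norm v = L2_set (\<lambda>i. cmod (v $ i)) {..<dim_vec v}"

text \<open>
  Continuity of the splitting means that the projection onto \<open>Es \<theta>\<close> along \<open>Eu \<theta>\<close>
  depends continuously on \<open>\<theta>\<close>.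
\<close>

definition continuous_splitting ::
  "nat \<Rightarrow> ('a::topological_space \<Rightarrow> complex vec set) \<Rightarrow> ('a \<Rightarrow> complex vec set) \<Rightarrow> bool"
where
  "continuous_splitting q Es Eu \<longleftrightarrow>
     (\<forall>\<theta>. VectorSpace.subspace class_ring (Es \<theta>) (module_vec TYPE(complex) q) \<and>
          VectorSpace.subspace class_ring (Eu \<theta>) (module_vec TYPE(complex) q) \<and>
          Es \<theta> \<inter> Eu \<theta> = {0\<^sub>v q} \<and>
          (\<forall>v \<in> carrier_vec q. \<exists>x \<in> Es \<theta>. \<exists>y \<in> Eu \<theta>. v = x + y)) \<and>
     (\<exists>P. continuous_mat q P \<and>
        (\<forall>\<theta>. (\<forall>v \<in> Es \<theta>. P \<theta> *\<^sub>v v = v) \<and> (\<forall>v \<in> Eu \<theta>. P \<theta> *\<^sub>v v = 0\<^sub>v q)))"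

text \<open>
  Contraction of \<open>Eu\<close> by the inverses of the iterates is written without inverse matrices:
  by invariance, the vectors of \<open>Eu ((T ^^ n) \<theta>)\<close> are exactly the images of those of \<open>Eu \<theta>\<close>
  under the \<open>n\<close>-th iterate. For \<open>q = 0\<close> the trivial splitting satisfies all conditions.
\<close>

definition uniformly_hyperbolic ::
  "nat \<Rightarrow> ('a::topological_space \<Rightarrow> 'a) \<Rightarrow> ('a \<Rightarrow> complex mat) \<Rightarrow> bool"
where
  "uniformly_hyperbolic q T A \<longleftrightarrow>
     GL_cocycle q A \<and>
     (\<exists>Es Eu. continuous_splitting q Es Eu \<and>
        (\<forall>\<theta>. (\<lambda>v. A \<theta> *\<^sub>v v) ` Es \<theta> = Es (T \<theta>) \<and> (\<lambda>v. A \<theta> *\<^sub>v v) ` Eu \<theta> = Eu (T \<theta>)) \<and>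
        (\<exists>K lam. 0 < K \<and> 0 < lam \<and> lam < 1 \<and>
           (\<forall>\<theta> n. (\<forall>v \<in> Es \<theta>. cvec_norm (cocycle_iter q T A n \<theta> *\<^sub>v v) \<le> K * lam ^ n * cvec_norm v) \<and>
                  (\<forall>v \<in> Eu \<theta>. cvec_norm v \<le> K * lam ^ n * cvec_norm (cocycle_iter q T A n \<theta> *\<^sub>v v)))))"

end

theory Submission
  imports Defs
begin

text \<open>
  For \<open>\<zeta> = E\<close> and \<open>\<epsilon> = 0\<close> the symbol \<open>V - E\<close> is invertible on the circles \<open>\<bar>z\<bar> = rp\<close> and
  \<open>\<bar>z\<bar> = rm\<close>, and it is the product of \<open>z - a\<close> over its zeros \<open>a\<close> on the unit circle and of a symbol
  without zeros between these circles. A Neumann series extends both facts to the perturbed operator,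
  in the form of Green's functions of growth \<open>rp powi n\<close> and \<open>rm powi n\<close> and of the estimate that a
  solution of growth \<open>max (rp powi n) (rm powi n)\<close> is controlled by \<open>2 m(E)\<close> consecutive entries.
  The center space is spanned by the differences of columns of the two Green's functions. If its
  cocycle is uniformly hyperbolic, the difference of the two Green's functions splits into a stable
  and an unstable part, and correcting one of them by these parts gives a Green's function that decays
  exponentially at both ends, hence a bounded inverse on \<open>\<ell>\<^sup>2(\<int>)\<close>. Conversely, a bounded inverse at one
  base point gives exponential decay by the Combes--Thomas argument; decay passes to the closure of
  the orbit, which is everything by minimality, and the solutions that are bounded at \<open>\<infinity>\<close>,
  respectively at \<open>- \<infinity>\<close>, form the hyperbolic splitting.
\<close>

section \<open>Operators with a Laurent symbol on weighted sequence spaces\<close>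

text \<open>The range is infinite, so the equation has no transfer matrix and a general solution is
  not determined by finitely many entries. The factorization of the symbol is the substitute:
  inverting the zero-free factor leaves a finite-order difference equation whose characteristic
  roots all have modulus 1, plus a small forcing. Two estimates follow, both stable because small
  terms are absorbed: an upper one (a window of 2 m(E) entries controls a center solution) and a
  lower one (the window controls the coefficients with respect to the contour-integral sequences).
  Together they make the square matrix of window entries invertible, which gives the dimension, the
  basis property and the continuity of coordinates at once. Spectral parameter and potential enter
  only through w = E - \<zeta> + \<epsilon> W, so one smallness threshold, depending on V, E and the
  radii, serves all \<theta> and all T. In coordinates the cocycle is the shift of sequences; hence
  hyperbolicity is a statement about solutions on half-lines.\<close>

lemma infsum_int_translate: "infsum (\<lambda>k::int. f (k + n)) UNIV = infsum f UNIV"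
  by (rule infsum_reindex_bij_witness[of _ "\<lambda>k. k - n" "\<lambda>k. k + n"]) auto

lemma summable_int_translate: "(\<lambda>k::int. f (k + n)) summable_on UNIV \<longleftrightarrow> f summable_on UNIV"
  by (rule summable_on_reindex_bij_witness[of _ "\<lambda>k. k - n" "\<lambda>k. k + n"]) auto

lemma infsum_int_reflect: "infsum (\<lambda>k::int. f (n - k)) UNIV = infsum f UNIV"
  by (rule infsum_reindex_bij_witness[of _ "\<lambda>k. n - k" "\<lambda>k. n - k"]) auto

lemma summable_int_reflect: "(\<lambda>k::int. f (n - k)) summable_on UNIV \<longleftrightarrow> f summable_on UNIV"
  by (rule summable_on_reindex_bij_witness[of _ "\<lambda>k. n - k" "\<lambda>k. n - k"]) auto

section \<open>Weighted convolution algebras and their action on sequences of given growth\<close>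

definition symop :: "(int \<Rightarrow> complex) \<Rightarrow> (int \<Rightarrow> complex) \<Rightarrow> int \<Rightarrow> complex" where
  "symop a u n = (\<Sum>\<^sub>\<infinity>k. a k * u (n + k))"

definition symprod :: "(int \<Rightarrow> complex) \<Rightarrow> (int \<Rightarrow> complex) \<Rightarrow> int \<Rightarrow> complex" where
  "symprod a b n = (\<Sum>\<^sub>\<infinity>j. a j * b (n - j))"

definition wsummable :: "(int \<Rightarrow> real) \<Rightarrow> (int \<Rightarrow> complex) \<Rightarrow> bool" where
  "wsummable \<omega> a \<longleftrightarrow> (\<lambda>k. cmod (a k) * \<omega> k) summable_on UNIV"

definition wnorm :: "(int \<Rightarrow> real) \<Rightarrow> (int \<Rightarrow> complex) \<Rightarrow> real" where
  "wnorm \<omega> a = (\<Sum>\<^sub>\<infinity>k. cmod (a k) * \<omega> k)"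

text \<open>Submultiplicativity makes the coefficients of finite \<open>wnorm\<close> an algebra
  under \<open>symprod\<close> and lets each of them act boundedly on the sequences dominated by a
  multiple of \<omega>.\<close>

definition subweight :: "(int \<Rightarrow> real) \<Rightarrow> bool" where
  "subweight \<omega> \<longleftrightarrow> (\<forall>n. 0 < \<omega> n) \<and> (\<forall>m n. \<omega> (m + n) \<le> \<omega> m * \<omega> n)"

definition deltaf :: "int \<Rightarrow> int \<Rightarrow> complex" where
  "deltaf m n = (if n = m then 1 else 0)"

lemma subweight_powi: "0 < r \<Longrightarrow> subweight (\<lambda>n. r powi n)"
  by (auto simp: subweight_def power_int_add)

lemma subweight_max: "subweight \<omega>1 \<Longrightarrow> subweight \<omega>2 \<Longrightarrow> subweight (\<lambda>n. max (\<omega>1 n) (\<omega>2 n))"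
  unfolding subweight_def
  by (smt (verit, best) mult_mono)

lemma wnorm_nonneg: "subweight \<omega> \<Longrightarrow> 0 \<le> wnorm \<omega> a"
  unfolding wnorm_def subweight_def by (intro infsum_nonneg) (simp add: less_imp_le)

lemma wbound_nonneg:
  fixes u :: "int \<Rightarrow> complex"
  assumes "subweight \<omega>" "\<And>n. cmod (u n) \<le> C * \<omega> n"
  shows "0 \<le> C"
proof -
  have "0 \<le> C * \<omega> 0" using assms(2)[of 0] norm_ge_zero order_trans by blast
  moreover have "0 < \<omega> 0" using assms(1) by (simp add: subweight_def)
  ultimately show ?thesis by (simp add: zero_le_mult_iff)
qed

lemma symop_term_bound:
  assumes "subweight \<omega>" "\<And>n. cmod (u n) \<le> C * \<omega> n"
  shows "cmod (a k * u (n + k)) \<le> (C * \<omega> n) * (cmod (a k) * \<omega> k)"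
proof -
  have C: "0 \<le> C" using wbound_nonneg[OF assms] .
  have "cmod (u (n + k)) \<le> C * \<omega> (n + k)" by (rule assms)
  also have "\<dots> \<le> C * (\<omega> n * \<omega> k)"
    using C assms(1) by (intro mult_left_mono) (auto simp: subweight_def)
  finally have "cmod (a k) * cmod (u (n + k)) \<le> cmod (a k) * (C * (\<omega> n * \<omega> k))"
    by (intro mult_left_mono) auto
  thus ?thesis by (simp add: norm_mult mult_ac)
qed

lemma symop_abs_summable:
  assumes "subweight \<omega>" "wsummable \<omega> a" "\<And>n. cmod (u n) \<le> C * \<omega> n"
  shows "(\<lambda>k. cmod (a k * u (n + k))) summable_on UNIV"
  by (rule Infinite_Sum.abs_summable_on_comparison_test'[OF summable_on_cmult_right[OF assms(2)[unfolded wsummable_def]]])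
     (rule symop_term_bound[OF assms(1,3)])

lemma symop_summable:
  assumes "subweight \<omega>" "wsummable \<omega> a" "\<And>n. cmod (u n) \<le> C * \<omega> n"
  shows "(\<lambda>k. a k * u (n + k)) summable_on UNIV"
  by (rule abs_summable_summable[OF symop_abs_summable[OF assms]])

lemma symop_bound:
  assumes "subweight \<omega>" "wsummable \<omega> a" "\<And>n. cmod (u n) \<le> C * \<omega> n"
  shows "cmod (symop a u n) \<le> wnorm \<omega> a * C * \<omega> n"
proof -
  have "cmod (symop a u n) \<le> (C * \<omega> n) * wnorm \<omega> a"
    unfolding symop_def wnorm_def
  proof (rule norm_infsum_le)
    show "((\<lambda>k. a k * u (n + k)) has_sum (\<Sum>\<^sub>\<infinity>k. a k * u (n + k))) UNIV"
      by (rule has_sum_infsum[OF symop_summable[OF assms]])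
    show "((\<lambda>k. (C * \<omega> n) * (cmod (a k) * \<omega> k)) has_sum (C * \<omega> n) * (\<Sum>\<^sub>\<infinity>k. cmod (a k) * \<omega> k)) UNIV"
      using assms(2) unfolding wsummable_def by (intro has_sum_cmult_right has_sum_infsum)
  qed (rule symop_term_bound[OF assms(1,3)])
  thus ?thesis by (simp add: mult_ac)
qed

lemma symop_add:
  assumes "subweight \<omega>" "wsummable \<omega> a" "\<And>n. cmod (u n) \<le> C * \<omega> n" "\<And>n. cmod (v n) \<le> D * \<omega> n"
  shows "symop a (\<lambda>n. u n + v n) n = symop a u n + symop a v n"
  unfolding symop_def distrib_left
  by (rule infsum_add[OF symop_summable[OF assms(1,2,3)] symop_summable[OF assms(1,2,4)]])

lemma symop_cmult: "symop a (\<lambda>n. c * u n) n = c * symop a u n"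
proof -
  have "(\<lambda>k. a k * (c * u (n + k))) = (\<lambda>k. c * (a k * u (n + k)))" by (auto simp: mult_ac)
  thus ?thesis unfolding symop_def by (simp add: infsum_cmult_right')
qed

lemma symop_diff:
  assumes "subweight \<omega>" "wsummable \<omega> a" "\<And>n. cmod (u n) \<le> C * \<omega> n" "\<And>n. cmod (v n) \<le> D * \<omega> n"
  shows "symop a (\<lambda>n. u n - v n) n = symop a u n - symop a v n"
  using symop_add[OF assms(1,2,3), of "\<lambda>n. (-1) * v n" D n] assms(4)
  by (simp add: symop_cmult[of a "-1" v, simplified])

lemma symop_translate: "symop a (\<lambda>n. u (n + m)) n = symop a u (n + m)"
  unfolding symop_def by (rule infsum_cong) (simp add: add_ac)

lemma has_sum_finite_sum:
  fixes f :: "'i \<Rightarrow> 'b \<Rightarrow> 'c::{topological_comm_monoid_add}"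
  assumes "finite I" "\<And>i. i \<in> I \<Longrightarrow> (f i has_sum s i) A"
  shows "((\<lambda>k. \<Sum>i\<in>I. f i k) has_sum (\<Sum>i\<in>I. s i)) A"
  using assms by (induction I rule: finite_induct) (auto intro!: has_sum_add)

lemma symop_sum:
  assumes "subweight \<omega>" "wsummable \<omega> a" "finite I" "\<And>i n. i \<in> I \<Longrightarrow> cmod (u i n) \<le> C i * \<omega> n"
  shows "symop a (\<lambda>n. \<Sum>i\<in>I. x i * u i n) n = (\<Sum>i\<in>I. x i * symop a (u i) n)"
proof -
  have s: "(\<lambda>k. a k * u i (n + k)) summable_on UNIV" if "i \<in> I" for i
    by (rule symop_summable[OF assms(1,2), of _ "C i"]) (use assms(4) that in auto)
  have "symop a (\<lambda>n. \<Sum>i\<in>I. x i * u i n) n = (\<Sum>\<^sub>\<infinity>k. \<Sum>i\<in>I. x i * (a k * u i (n + k)))"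
    unfolding symop_def by (simp add: sum_distrib_left mult_ac)
  also have "\<dots> = (\<Sum>i\<in>I. \<Sum>\<^sub>\<infinity>k. x i * (a k * u i (n + k)))"
    by (intro infsumI has_sum_finite_sum assms(3) has_sum_infsum summable_on_cmult_right s)
  finally show ?thesis by (simp add: symop_def infsum_cmult_right')
qed

lemma symop_deltaf [simp]: "symop (deltaf 0) u = u"
proof
  fix n
  have "symop (deltaf 0) u n = (\<Sum>\<^sub>\<infinity>k\<in>{0}. deltaf 0 k * u (n + k))"
    unfolding symop_def by (rule infsum_cong_neutral) (auto simp: deltaf_def)
  thus "symop (deltaf 0) u n = u n" by (simp add: deltaf_def)
qed

text \<open>Two applications of submultiplicativity dominate the double family by a product of two
  summable families; this licenses the interchange of sums in \<open>symop_symop\<close>.\<close>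

lemma symprod_pair_summable:
  assumes "subweight \<omega>" "wsummable \<omega> a" "wsummable \<omega> b" "\<And>n. cmod (u n) \<le> C * \<omega> n"
  shows "(\<lambda>p. cmod (case p of (j,k) \<Rightarrow> a j * b k * u (n + j + k))) summable_on UNIV \<times> UNIV"
proof -
  have pos: "0 < \<omega> j" for j using assms(1) by (simp add: subweight_def)
  have C: "0 \<le> C" using wbound_nonneg[OF assms(1,4)] .
  have 1: "(\<lambda>p. cmod (case p of (j,k) \<Rightarrow> (a j * \<omega> j) * (b k * \<omega> k))) summable_on UNIV \<times> UNIV"
  proof (subst Infinite_Sum.abs_summable_on_Sigma_iff, intro conjI ballI)
    have B: "(\<lambda>k. cmod (b k * \<omega> k)) summable_on UNIV"
      using assms(3) pos by (simp add: wsummable_def norm_mult less_imp_le abs_of_pos)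
    show "(\<lambda>y. cmod (case (x, y) of (j, k) \<Rightarrow> a j * complex_of_real (\<omega> j) * (b k * complex_of_real (\<omega> k)))) summable_on UNIV" for x
      using summable_on_cmult_right[OF B, of "cmod (a x * \<omega> x)"] by (simp add: norm_mult)
    have "(\<lambda>k. cmod (a k * \<omega> k)) summable_on UNIV"
      using assms(2) pos by (simp add: wsummable_def norm_mult less_imp_le abs_of_pos)
    from summable_on_cmult_left[OF this, of "\<Sum>\<^sub>\<infinity>k. cmod (b k * \<omega> k)"]
    have "(\<lambda>x. norm (\<Sum>\<^sub>\<infinity>y. cmod (a x * \<omega> x) * cmod (b y * \<omega> y))) summable_on UNIV"
      by (simp add: infsum_cmult_right' infsum_nonneg abs_mult)
    thus "(\<lambda>x. norm (\<Sum>\<^sub>\<infinity>y\<in>UNIV. cmod (case (x, y) of (j, k) \<Rightarrow> a j * complex_of_real (\<omega> j) * (b k * complex_of_real (\<omega> k))))) summable_on UNIV"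
      by (simp add: norm_mult)
  qed
  have 2: "(\<lambda>p. cmod (complex_of_real (C * \<omega> n) * (case p of (j,k) \<Rightarrow> (a j * \<omega> j) * (b k * \<omega> k)))) summable_on UNIV \<times> UNIV"
    using summable_on_cmult_right[OF 1, of "cmod (C * \<omega> n)"] by (simp add: norm_mult)
  show ?thesis
  proof (rule Infinite_Sum.abs_summable_on_comparison_test[OF 2])
    fix p :: "int \<times> int"
    obtain j k where p: "p = (j,k)" by force
    have "cmod (u (n + j + k)) \<le> C * \<omega> (n + j + k)" by (rule assms)
    also have "\<dots> \<le> C * (\<omega> n * \<omega> j * \<omega> k)"
    proof (rule mult_left_mono[OF _ C])
      have "\<omega> (n + j + k) \<le> \<omega> (n + j) * \<omega> k" using assms(1) by (simp add: subweight_def)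
      also have "\<dots> \<le> \<omega> n * \<omega> j * \<omega> k"
        using assms(1) by (intro mult_right_mono) (auto simp: subweight_def less_imp_le)
      finally show "\<omega> (n + j + k) \<le> \<omega> n * \<omega> j * \<omega> k" .
    qed
    finally have "cmod (a j) * cmod (b k) * cmod (u (n + j + k)) \<le> cmod (a j) * cmod (b k) * (C * (\<omega> n * \<omega> j * \<omega> k))"
      by (intro mult_left_mono) auto
    thus "cmod (case p of (j,k) \<Rightarrow> a j * b k * u (n + j + k)) \<le> cmod (complex_of_real (C * \<omega> n) * (case p of (j,k) \<Rightarrow> (a j * \<omega> j) * (b k * \<omega> k)))"
      using C pos by (simp add: p norm_mult less_imp_le abs_of_pos mult_ac)
  qed
qed

lemma symop_symop:
  assumes "subweight \<omega>" "wsummable \<omega> a" "wsummable \<omega> b" "\<And>n. cmod (u n) \<le> C * \<omega> n"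
  shows "symop a (symop b u) = symop (symprod a b) u"
proof
  fix n
  have S: "(\<lambda>(j,k). a j * b k * u (n + j + k)) summable_on UNIV \<times> UNIV"
    by (rule abs_summable_summable[OF symprod_pair_summable[OF assms]])
  \<comment> \<open>A shear of the index plane turns summation at fixed k into the convolution
    \<open>symprod a b\<close>.\<close>
  have S': "(\<lambda>(j,k). a j * b (k - j) * u (n + k)) summable_on UNIV \<times> UNIV"
  proof -
    have "bij_betw (\<lambda>(j,k). (j, k - j)) (UNIV \<times> UNIV) ((UNIV::int set) \<times> (UNIV::int set))"
      by (rule bij_betwI[of _ _ _ "\<lambda>(j,k). (j, k + j)"]) auto
    from summable_on_reindex_bij_betw[OF this, of "\<lambda>(j,k). a j * b k * u (n + j + k)"] S
    show ?thesis by (simp add: case_prod_unfold)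
  qed
  have "symop a (symop b u) n = (\<Sum>\<^sub>\<infinity>j. \<Sum>\<^sub>\<infinity>k. a j * (b k * u (n + j + k)))"
    unfolding symop_def by (simp add: infsum_cmult_right')
  also have "\<dots> = (\<Sum>\<^sub>\<infinity>j. \<Sum>\<^sub>\<infinity>k. a j * b (k - j) * u (n + k))"
  proof (rule infsum_cong)
    fix j
    show "(\<Sum>\<^sub>\<infinity>k. a j * (b k * u (n + j + k))) = (\<Sum>\<^sub>\<infinity>k. a j * b (k - j) * u (n + k))"
      by (rule infsum_reindex_bij_witness[of _ "\<lambda>k. k - j" "\<lambda>k. k + j"]) (auto simp: algebra_simps)
  qed
  also have "\<dots> = (\<Sum>\<^sub>\<infinity>k. \<Sum>\<^sub>\<infinity>j. a j * b (k - j) * u (n + k))"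
    by (rule infsum_swap_banach[OF S'])
  also have "\<dots> = symop (symprod a b) u n"
    unfolding symop_def symprod_def by (simp add: infsum_cmult_left')
  finally show "symop a (symop b u) n = symop (symprod a b) u n" .
qed

section \<open>Laurent coefficients\<close>

text \<open>Unordered sums are limits along the net of finite subsets. The dominating series makes
  this convergence uniform on [0, 1], so the integral passes to the limit.\<close>

lemma integral_has_sum:
  fixes f :: "'j \<Rightarrow> real \<Rightarrow> complex"
  assumes cont: "\<And>j. continuous_on {0..1} (f j)"
    and bound: "\<And>j x. j \<in> X \<Longrightarrow> x \<in> {0..1} \<Longrightarrow> cmod (f j x) \<le> M j"
    and M: "M summable_on X"
  shows "((\<lambda>j. integral {0..1} (f j)) has_sum integral {0..1} (\<lambda>x. \<Sum>\<^sub>\<infinity>j\<in>X. f j x)) X"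
proof -
  have u: "uniform_limit {0..1} (\<lambda>Y x. \<Sum>j\<in>Y. f j x) (\<lambda>x. \<Sum>\<^sub>\<infinity>j\<in>X. f j x) (finite_subsets_at_top X)"
    by (rule Weierstrass_m_test_general[OF bound M])
  have c: "continuous_on {0..1} (\<lambda>x. \<Sum>j\<in>Y. f j x)" for Y
    by (intro continuous_on_sum cont)
  obtain I J where IJ: "\<And>Y. ((\<lambda>x. \<Sum>j\<in>Y. f j x) has_integral I Y) {0..1}"
      "((\<lambda>x. \<Sum>\<^sub>\<infinity>j\<in>X. f j x) has_integral J) {0..1}" "(I \<longlongrightarrow> J) (finite_subsets_at_top X)"
    using uniform_limit_integral[OF u c finite_subsets_at_top_neq_bot] by blast
  have "I = (\<lambda>Y. \<Sum>j\<in>Y. integral {0..1} (f j))"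
  proof (rule ext)
    fix Y show "I Y = (\<Sum>j\<in>Y. integral {0..1} (f j))"
    proof (cases "finite Y")
      case True
      have "integral {0..1} (\<lambda>x. \<Sum>j\<in>Y. f j x) = (\<Sum>j\<in>Y. integral {0..1} (f j))"
        by (rule integral_sum[OF True]) (rule integrable_continuous_real[OF cont])
      thus ?thesis using IJ(1)[of Y] by (metis integral_unique)
    next
      \<comment> \<open>A sum over an infinite set is 0 by convention, so both sides vanish.\<close>
      case False
      thus ?thesis using IJ(1)[of Y] by (simp add: has_integral_0_eq)
    qed
  qed
  moreover have "J = integral {0..1} (\<lambda>x. \<Sum>\<^sub>\<infinity>j\<in>X. f j x)" using IJ(2) by (metis integral_unique)
  ultimately show ?thesis using IJ(3) unfolding has_sum_def by simp
qed

lemma has_sum_subtract: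
  fixes f g :: "'b \<Rightarrow> 'c::real_normed_vector"
  assumes "(f has_sum a) A" "(g has_sum b) A"
  shows "((\<lambda>x. f x - g x) has_sum (a - b)) A"
  using has_sum_add[OF assms(1), of "\<lambda>x. - g x" "- b"] assms(2) by (simp add: has_sum_uminus)

lemma has_sum_geometric_int:
  fixes q :: "'a::{real_normed_field,banach}"
  assumes "norm q < 1"
  shows "((\<lambda>n::int. q powi n) has_sum (1 / (1 - q))) {0..}"
proof -
  have "((\<lambda>n. q ^ n) has_sum (1 / (1 - q))) (UNIV :: nat set)"
    by (rule norm_summable_imp_has_sum) (use assms geometric_sums[of q] in \<open>auto simp: norm_power intro!: summable_geometric\<close>)
  moreover have "bij_betw int UNIV {0..}"
    by (rule bij_betwI[of _ _ _ nat]) auto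
  ultimately show ?thesis
    using has_sum_reindex_bij_betw[of int UNIV "{0..}" "\<lambda>n. q powi n"] by simp
qed

lemma has_sum_geometric_int_neg:
  fixes q :: "'a::{real_normed_field,banach}"
  assumes "1 < norm q"
  shows "((\<lambda>n::int. q powi n) has_sum (1 / (q - 1))) {..<0}"
proof -
  have q0: "q \<noteq> 0" "q \<noteq> 1" using assms by auto
  have "norm (inverse q) < 1" using assms by (simp add: norm_inverse inverse_less_1_iff)
  from has_sum_cmult_right[OF has_sum_geometric_int[OF this], of "inverse q"]
  have "((\<lambda>n::int. inverse q * inverse q powi n) has_sum (inverse q * (1 / (1 - inverse q)))) {0..}" .
  also have "inverse q * (1 / (1 - inverse q)) = 1 / (q - 1)" using q0 by (simp add: field_simps)
  finally have *: "((\<lambda>n::int. inverse q * inverse q powi n) has_sum (1 / (q - 1))) {0..}" .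
  have "((\<lambda>n::int. q powi n) has_sum (1 / (q - 1))) {..<0} \<longleftrightarrow>
        ((\<lambda>n::int. inverse q * inverse q powi n) has_sum (1 / (q - 1))) {0..}"
  proof (rule has_sum_reindex_bij_witness[of _ "\<lambda>n. - 1 - n" "\<lambda>n. - 1 - n"])
    show "inverse q * inverse q powi (- 1 - a) = q powi a" for a
      using power_int_add[of q "1" "a"] q0 by (simp add: power_int_minus power_int_inverse power_int_diff)
  qed auto
  thus ?thesis using * by blast
qed

lemma summable_int_geometric:
  assumes "0 \<le> q" "q < (1::real)"
  shows "(\<lambda>n::int. q ^ nat \<bar>n\<bar>) summable_on UNIV"
proof -
  have 1: "(\<lambda>n::int. q ^ nat \<bar>n\<bar>) summable_on {0..}"
  proof (subst summable_on_cong)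
    show "(\<lambda>n::int. q powi n) summable_on {0..}"
      using has_sum_imp_summable[OF has_sum_geometric_int[of q]] assms by simp
  qed (simp add: power_int_def)
  have "(\<lambda>n::int. q ^ nat \<bar>n\<bar>) summable_on {..0}"
    using summable_on_reindex_bij_witness[of "{..0::int}" uminus uminus "{0..}" "\<lambda>n. q ^ nat \<bar>n\<bar>" "\<lambda>n. q ^ nat \<bar>n\<bar>"] 1
    by auto
  hence "(\<lambda>n::int. q ^ nat \<bar>n\<bar>) summable_on ({0..} \<union> {..0})"
    by (rule summable_on_union[OF 1])
  moreover have "{0..} \<union> {..0} = (UNIV::int set)" by auto
  ultimately show ?thesis by simp
qed

section \<open>Laurent coefficients as integrals over circles\<close>

definition circ :: "real \<Rightarrow> real \<Rightarrow> complex" where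
  "circ r x = of_real r * cis (2 * pi * x)"

lemma norm_circ [simp]: "cmod (circ r x) = \<bar>r\<bar>"
  by (simp add: circ_def norm_mult)

lemma circ_nonzero [simp]: "r \<noteq> 0 \<Longrightarrow> circ r x \<noteq> 0"
  by (simp add: circ_def)

lemma continuous_on_circ [continuous_intros]: "continuous_on A g \<Longrightarrow> continuous_on A (\<lambda>x. circ r (g x))"
  unfolding circ_def by (intro continuous_intros)

lemma circlepath_circ: "circlepath 0 r x = circ r x"
  by (simp add: circlepath circ_def cis_conv_exp mult_ac)

text \<open>The contour integral of \<open>f z * z powi (- n - 1)\<close> divided by 2 pi i; the
  differential contributes one factor z, which raises the exponent to - n. The radius stays a
  parameter because the reciprocal of a symbol with zeros on the unit circle has different
  coefficients inside and outside.\<close>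

definition lcoeff :: "(complex \<Rightarrow> complex) \<Rightarrow> real \<Rightarrow> int \<Rightarrow> complex" where
  "lcoeff f r n = integral {0..1} (\<lambda>x. f (circ r x) * circ r x powi (- n))"

lemma fourier_coeff_lcoeff: "fourier_coeff V = lcoeff V 1"
proof
  fix n
  have "cis (- (2 * pi * of_int n * x)) = cis (2 * pi * x) powi (- n)" for x
    by (simp add: cis_power_int mult_ac)
  thus "fourier_coeff V n = lcoeff V 1 n"
    unfolding fourier_coeff_def lcoeff_def circ_def by simp
qed

lemma contour_integral_circ:
  "contour_integral (circlepath 0 r) F = 2 * of_real pi * \<i> * integral {0..1} (\<lambda>x. circ r x * F (circ r x))"
proof -
  have "contour_integral (circlepath 0 r) F = integral {0..1} (\<lambda>x. 2 * of_real pi * \<i> * (circ r x * F (circ r x)))"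
    unfolding contour_integral_integral
    by (intro integral_cong) (simp add: vector_derivative_circlepath circlepath_circ circ_def cis_conv_exp mult_ac)
  thus ?thesis by simp
qed

lemma lcoeff_contour:
  assumes "0 < r"
  shows "contour_integral (circlepath 0 r) (\<lambda>z. f z * z powi (- n - 1)) = 2 * of_real pi * \<i> * lcoeff f r n"
proof -
  have "circ r x * (f (circ r x) * circ r x powi (- n - 1)) = f (circ r x) * circ r x powi (- n)" for x
    using assms by (simp add: power_int_diff)
  thus ?thesis unfolding contour_integral_circ lcoeff_def by (simp only:)
qed

lemma homotopic_circlepaths:
  assumes "0 \<le> \<rho>1" "\<rho>1 < r" "r < \<rho>2" "\<rho>1 < s" "s < \<rho>2"
  shows "homotopic_loops {z. \<rho>1 < cmod z \<and> cmod z < \<rho>2} (circlepath 0 r) (circlepath 0 s)"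
proof (rule homotopic_loops_linear)
  fix t :: real and x assume "t \<in> {0..1}"
  show "closed_segment (circlepath 0 r t) (circlepath 0 s t) \<subseteq> {z. \<rho>1 < cmod z \<and> cmod z < \<rho>2}"
  proof
    fix z assume "z \<in> closed_segment (circlepath 0 r t) (circlepath 0 s t)"
    then obtain u where u: "0 \<le> u" "u \<le> 1" "z = (1 - u) *\<^sub>R circ r t + u *\<^sub>R circ s t"
      by (auto simp: in_segment circlepath_circ)
    have "z = circ ((1 - u) * r + u * s) t"
      using u(3) by (simp add: circ_def scaleR_conv_of_real algebra_simps)
    moreover have "\<rho>1 < (1 - u) * r + u * s" "(1 - u) * r + u * s < \<rho>2"
      using convex_bound_lt[of "-r" "-\<rho>1" "-s" "1-u" u] convex_bound_lt[of r \<rho>2 s "1-u" u] u assms by auto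
    ultimately show "z \<in> {z. \<rho>1 < cmod z \<and> cmod z < \<rho>2}" using assms by simp
  qed
qed auto

lemma open_ann: "open {z::complex. \<rho>1 < cmod z \<and> cmod z < \<rho>2}"
  by (intro open_Collect_conj open_Collect_less continuous_intros)

lemma contour_integral_circlepaths_eq:
  assumes "f holomorphic_on {z. \<rho>1 < cmod z \<and> cmod z < \<rho>2}"
    and "0 \<le> \<rho>1" "\<rho>1 < r" "r < \<rho>2" "\<rho>1 < s" "s < \<rho>2"
  shows "contour_integral (circlepath 0 r) f = contour_integral (circlepath 0 s) f"
  by (rule Cauchy_theorem_homotopic_loops[OF homotopic_circlepaths[OF assms(2-)] open_ann assms(1)]) auto

text \<open>Cauchy's theorem for homotopic circles. The freedom in the radius is what produces
  geometric decay of the coefficients in both directions.\<close>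

lemma lcoeff_radius:
  assumes "f holomorphic_on {z. \<rho>1 < cmod z \<and> cmod z < \<rho>2}"
    and "0 \<le> \<rho>1" "\<rho>1 < r" "r < \<rho>2" "\<rho>1 < s" "s < \<rho>2"
  shows "lcoeff f r n = lcoeff f s n"
proof -
  have "(\<lambda>z. f z * z powi (- n - 1)) holomorphic_on {z. \<rho>1 < cmod z \<and> cmod z < \<rho>2}"
    using assms(2) by (intro holomorphic_intros assms(1)) auto
  from contour_integral_circlepaths_eq[OF this assms(2-)]
  have "2 * of_real pi * \<i> * lcoeff f r n = 2 * of_real pi * \<i> * lcoeff f s n"
    using assms by (simp add: lcoeff_contour)
  thus ?thesis by simp
qed

lemma continuous_on_holo_circ:
  assumes "f holomorphic_on {z. \<rho>1 < cmod z \<and> cmod z < \<rho>2}" "0 \<le> \<rho>1" "\<rho>1 < r" "r < \<rho>2"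
  shows "continuous_on A (\<lambda>x. f (circ r x))"
  using assms by (intro continuous_on_compose2[OF holomorphic_on_imp_continuous_on[OF assms(1)]] continuous_intros) auto

lemma holo_circ_bounded:
  assumes "f holomorphic_on {z. \<rho>1 < cmod z \<and> cmod z < \<rho>2}" "0 \<le> \<rho>1" "\<rho>1 < r" "r < \<rho>2"
  obtains M where "0 \<le> M" "\<And>x. x \<in> {0..1} \<Longrightarrow> cmod (f (circ r x)) \<le> M"
proof -
  have "compact ((\<lambda>x. f (circ r x)) ` {0..1})"
    by (intro compact_continuous_image continuous_on_holo_circ[OF assms]) auto
  then obtain M where "\<forall>y\<in>(\<lambda>x. f (circ r x)) ` {0..1}. cmod y \<le> M"
    using compact_imp_bounded bounded_iff by metis
  hence "0 \<le> \<bar>M\<bar>" "\<And>x. x \<in> {0..1} \<Longrightarrow> cmod (f (circ r x)) \<le> \<bar>M\<bar>" by force+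
  thus ?thesis using that by blast
qed

lemma continuous_on_circ_powi: "0 < r \<Longrightarrow> continuous_on A (\<lambda>x. circ r x powi n)"
  by (intro continuous_on_power_int continuous_intros) auto

lemma lcoeff_bound:
  assumes "continuous_on {0..1} (\<lambda>x. f (circ r x))" "0 < r" "\<And>x. x \<in> {0..1} \<Longrightarrow> cmod (f (circ r x)) \<le> M"
  shows "cmod (lcoeff f r n) \<le> M * r powi (- n)"
proof -
  have "norm (integral {0..1} (\<lambda>x. f (circ r x) * circ r x powi (- n))) \<le> (M * r powi (- n)) * (1 - 0)"
  proof (rule integral_bound)
    show "continuous_on {0..1} (\<lambda>x. f (circ r x) * circ r x powi (- n))"
      by (intro continuous_intros assms(1) continuous_on_circ_powi assms(2))
    show "cmod (f (circ r t) * circ r t powi - n) \<le> M * r powi - n" if "t \<in> {0..1}" for t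
      using assms that by (simp add: norm_mult norm_power_int mult_right_mono)
  qed auto
  thus ?thesis by (simp add: lcoeff_def)
qed

text \<open>On a circle slightly larger than \<open>rp\<close> the coefficients are seen to decay
  faster than \<open>rp powi (- n)\<close> as n grows; a circle slightly smaller than
  \<open>rm\<close> handles negative n. The strict gaps leave a geometric series.\<close>

lemma lcoeff_wsummable:
  assumes "f holomorphic_on {z. \<rho>1 < cmod z \<and> cmod z < \<rho>2}" "0 \<le> \<rho>1" "\<rho>1 < rm" "rm \<le> rp" "rp < \<rho>2" "\<rho>1 < r" "r < \<rho>2"
  shows "wsummable (\<lambda>n. max (rp powi n) (rm powi n)) (lcoeff f r)"
proof -
  obtain s1 where s1: "\<rho>1 < s1" "s1 < rm" using assms dense by blast
  obtain s2 where s2: "rp < s2" "s2 < \<rho>2" using assms dense by blast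
  have pos: "0 < s1" "0 < s2" "0 < rm" "0 < rp" using s1 s2 assms by auto
  obtain M1 where M1: "0 \<le> M1" "\<And>x. x \<in> {0..1} \<Longrightarrow> cmod (f (circ s1 x)) \<le> M1"
    using holo_circ_bounded[OF assms(1,2), of s1] s1 assms by auto
  obtain M2 where M2: "0 \<le> M2" "\<And>x. x \<in> {0..1} \<Longrightarrow> cmod (f (circ s2 x)) \<le> M2"
    using holo_circ_bounded[OF assms(1,2), of s2] s2 assms by auto
  define M where "M = max M1 M2"
  define q where "q = max (rp / s2) (s1 / rm)"
  have q: "0 \<le> q" "q < 1" using pos s1 s2 by (auto simp: q_def le_max_iff_disj)
  have c1: "cmod (lcoeff f r n) \<le> M * s1 powi (- n)" for n
  proof -
    have "lcoeff f r n = lcoeff f s1 n" by (rule lcoeff_radius[OF assms(1)]) (use assms s1 in auto)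
    moreover have "cmod (lcoeff f s1 n) \<le> M * s1 powi (- n)"
      by (rule lcoeff_bound[OF continuous_on_holo_circ[OF assms(1)]]) (use assms s1 M1 in \<open>force simp: M_def\<close>)+
    ultimately show ?thesis by simp
  qed
  have c2: "cmod (lcoeff f r n) \<le> M * s2 powi (- n)" for n
  proof -
    have "lcoeff f r n = lcoeff f s2 n" by (rule lcoeff_radius[OF assms(1)]) (use assms s2 in auto)
    moreover have "cmod (lcoeff f s2 n) \<le> M * s2 powi (- n)"
      by (rule lcoeff_bound[OF continuous_on_holo_circ[OF assms(1)]]) (use assms s2 M2 in \<open>force simp: M_def\<close>)+
    ultimately show ?thesis by simp
  qed
  have M0: "0 \<le> M" using M1 by (auto simp: M_def)
  show ?thesis unfolding wsummable_def
  proof (rule summable_on_comparison_test)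
    show "(\<lambda>n::int. M * q ^ nat \<bar>n\<bar>) summable_on UNIV"
      by (intro summable_on_cmult_right summable_int_geometric q)
    show "0 \<le> cmod (lcoeff f r n) * max (rp powi n) (rm powi n)" for n
      using pos by (simp add: le_max_iff_disj)
    show "cmod (lcoeff f r n) * max (rp powi n) (rm powi n) \<le> M * q ^ nat \<bar>n\<bar>" for n
    proof (cases "0 \<le> n")
      case True
      then obtain k where k: "n = int k" using nonneg_int_cases by blast
      have "max (rp powi n) (rm powi n) = rp ^ k"
        using power_mono[of rm rp k] assms pos by (simp add: k)
      hence "cmod (lcoeff f r n) * max (rp powi n) (rm powi n) \<le> M * s2 powi (- n) * rp ^ k"
        using c2[of n] pos by (simp add: mult_right_mono)
      also have "\<dots> = M * (rp / s2) ^ k" using pos by (simp add: k power_int_minus power_divide field_simps)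
      also have "\<dots> \<le> M * q ^ k"
        using M0 pos by (intro mult_left_mono power_mono) (auto simp: q_def)
      finally show ?thesis by (simp add: k)
    next
      case False
      then obtain k where k: "n = - int k" using int_cases2 by (metis of_nat_0_le_iff)
      have "max (rp powi n) (rm powi n) = inverse rm ^ k"
        using assms pos by (simp add: k max_def power_int_minus power_inverse[symmetric] power_mono)
      hence "cmod (lcoeff f r n) * max (rp powi n) (rm powi n) \<le> M * s1 powi (- n) * inverse rm ^ k"
        using c1[of n] pos by (simp add: mult_right_mono)
      also have "\<dots> = M * (s1 / rm) ^ k" using pos by (simp add: k power_inverse power_divide field_simps)
      also have "\<dots> \<le> M * q ^ k"
        using M0 pos by (intro mult_left_mono power_mono) (auto simp: q_def)
      finally show ?thesis by (simp add: k)
    qed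
  qed
qed

lemma lcoeff_wsummable_powi:
  assumes "f holomorphic_on {z. \<rho>1 < cmod z \<and> cmod z < \<rho>2}" "0 \<le> \<rho>1" "\<rho>1 < r" "r < \<rho>2" "\<rho>1 < s" "s < \<rho>2"
  shows "wsummable (\<lambda>n. s powi n) (lcoeff f r)"
  using lcoeff_wsummable[OF assms(1,2), of s s r] assms by simp

lemma integral_circ_powi:
  assumes "0 < r" "n \<noteq> 0"
  shows "integral {0..1} (\<lambda>x. circ r x powi n) = 0"
proof -
  define c where "c = 2 * of_real pi * \<i> * of_int n"
  have c: "c \<noteq> 0" using assms by (simp add: c_def)
  have eq: "circ r x powi n = of_real r powi n * exp (of_real x * c)" for x
  proof -
    have "cis (2 * pi * x) powi n = exp (of_real x * c)"
      unfolding cis_power_int by (simp add: cis_conv_exp c_def mult_ac)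
    thus ?thesis by (simp add: circ_def power_int_mult_distrib)
  qed
  have "((\<lambda>x. of_real r powi n * exp (of_real x * c)) has_integral
        of_real r powi n * exp (of_real 1 * c) / c - of_real r powi n * exp (of_real 0 * c) / c) {0..1}"
  proof (rule fundamental_theorem_of_calculus)
    show "((\<lambda>x. of_real r powi n * exp (of_real x * c) / c) has_vector_derivative of_real r powi n * exp (of_real x * c)) (at x within {0..1})" for x
      by (rule has_vector_derivative_real_field) (use c in \<open>auto intro!: derivative_eq_intros\<close>)
  qed auto
  moreover have "exp c = 1"
    unfolding c_def using exp_integer_2pi[of "of_int n"] by (simp add: mult_ac)
  ultimately have "((\<lambda>x. circ r x powi n) has_integral 0) {0..1}" by (simp add: eq)
  thus ?thesis by (rule integral_unique)
qed

lemma lcoeff_one: "0 < r \<Longrightarrow> lcoeff (\<lambda>z. 1) r = deltaf 0"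
  by (rule ext) (auto simp: lcoeff_def deltaf_def integral_circ_powi)

text \<open>The Cauchy kernel on a circle of larger (smaller) radius is a geometric series in
  nonnegative (negative) powers of \<open>z\<close>.\<close>

lemma cauchy_kernel_outer:
  assumes "continuous_on {0..1} (\<lambda>x. h (circ s x))" "cmod z < s" "z \<noteq> 0"
  shows "((\<lambda>n. lcoeff h s n * z powi n) has_sum
     integral {0..1} (\<lambda>x. h (circ s x) * (circ s x / (circ s x - z)))) {0..}"
proof -
  have s: "0 < s" using assms(2) norm_ge_zero[of z] by linarith
  have "compact ((\<lambda>x. h (circ s x)) ` {0..1})"
    by (intro compact_continuous_image assms(1)) auto
  then obtain M where M: "\<And>x. x \<in> {0..1} \<Longrightarrow> cmod (h (circ s x)) \<le> M"
    using compact_imp_bounded bounded_iff by (metis imageI)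
  have "((\<lambda>n. integral {0..1} (\<lambda>x. h (circ s x) * (z / circ s x) powi n)) has_sum
     integral {0..1} (\<lambda>x. \<Sum>\<^sub>\<infinity>n\<in>{0::int..}. h (circ s x) * (z / circ s x) powi n)) {0..}"
  proof (rule integral_has_sum[where M = "\<lambda>n. M * (cmod z / s) powi n"])
    show "continuous_on {0..1} (\<lambda>x. h (circ s x) * (z / circ s x) powi n)" for n
      using s assms by (intro continuous_intros assms continuous_on_power_int) auto
    show "cmod (h (circ s x) * (z / circ s x) powi n) \<le> M * (cmod z / s) powi n" if "x \<in> {0..1}" for n x
      using M[OF that] s by (simp add: norm_mult norm_power_int norm_divide mult_right_mono)
    show "(\<lambda>n. M * (cmod z / s) powi n) summable_on {0..}"
      using assms s by (intro summable_on_cmult_right has_sum_imp_summable[OF has_sum_geometric_int]) (simp add: abs_of_pos)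
  qed
  moreover have "(\<Sum>\<^sub>\<infinity>n\<in>{0::int..}. h (circ s x) * (z / circ s x) powi n) = h (circ s x) * (circ s x / (circ s x - z))" for x
  proof -
    have "cmod (z / circ s x) < 1" using assms s by (simp add: norm_divide)
    hence "(\<Sum>\<^sub>\<infinity>n\<in>{0::int..}. h (circ s x) * (z / circ s x) powi n) = h (circ s x) * (1 / (1 - z / circ s x))"
      by (intro infsumI has_sum_cmult_right has_sum_geometric_int)
    also have "1 / (1 - z / circ s x) = circ s x / (circ s x - z)" using s by (simp add: field_simps)
    finally show ?thesis .
  qed
  moreover have "integral {0..1} (\<lambda>x. h (circ s x) * (z / circ s x) powi n) = lcoeff h s n * z powi n" for n
  proof -
    have "(\<lambda>x. h (circ s x) * (z / circ s x) powi n) = (\<lambda>x. h (circ s x) * circ s x powi (- n) * z powi n)"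
      by (auto simp: power_int_divide_distrib power_int_minus inverse_eq_divide)
    thus ?thesis by (simp add: lcoeff_def)
  qed
  ultimately show ?thesis by simp
qed

lemma cauchy_kernel_inner:
  assumes "continuous_on {0..1} (\<lambda>x. h (circ s x))" "s < cmod z" "0 < s"
  shows "((\<lambda>n. lcoeff h s n * z powi n) has_sum
     - integral {0..1} (\<lambda>x. h (circ s x) * (circ s x / (circ s x - z)))) {..<0}"
proof -
  have z: "z \<noteq> 0" using assms by auto
  have "compact ((\<lambda>x. h (circ s x)) ` {0..1})"
    by (intro compact_continuous_image assms(1)) auto
  then obtain M where M: "\<And>x. x \<in> {0..1} \<Longrightarrow> cmod (h (circ s x)) \<le> M"
    using compact_imp_bounded bounded_iff by (metis imageI)
  have "((\<lambda>n. integral {0..1} (\<lambda>x. h (circ s x) * (z / circ s x) powi n)) has_sum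
     integral {0..1} (\<lambda>x. \<Sum>\<^sub>\<infinity>n\<in>{..<0::int}. h (circ s x) * (z / circ s x) powi n)) {..<0}"
  proof (rule integral_has_sum[where M = "\<lambda>n. M * (cmod z / s) powi n"])
    show "continuous_on {0..1} (\<lambda>x. h (circ s x) * (z / circ s x) powi n)" for n
      using assms z by (intro continuous_intros assms continuous_on_power_int) auto
    show "cmod (h (circ s x) * (z / circ s x) powi n) \<le> M * (cmod z / s) powi n" if "x \<in> {0..1}" for n x
      using M[OF that] assms by (simp add: norm_mult norm_power_int norm_divide mult_right_mono)
    show "(\<lambda>n. M * (cmod z / s) powi n) summable_on {..<0}"
      using assms by (intro summable_on_cmult_right has_sum_imp_summable[OF has_sum_geometric_int_neg]) (simp add: abs_of_pos)
  qed
  moreover have "(\<Sum>\<^sub>\<infinity>n\<in>{..<0::int}. h (circ s x) * (z / circ s x) powi n) = - (h (circ s x) * (circ s x / (circ s x - z)))" for x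
  proof -
    have ne: "circ s x \<noteq> z" using assms by (metis norm_circ abs_of_pos less_irrefl)
    have "1 < cmod (z / circ s x)" using assms by (simp add: norm_divide)
    hence "(\<Sum>\<^sub>\<infinity>n\<in>{..<0::int}. h (circ s x) * (z / circ s x) powi n) = h (circ s x) * (1 / (z / circ s x - 1))"
      by (intro infsumI has_sum_cmult_right has_sum_geometric_int_neg)
    also have "1 / (z / circ s x - 1) = - (circ s x / (circ s x - z))" using assms ne by (simp add: divide_simps) (simp add: algebra_simps)
    finally show ?thesis by simp
  qed
  moreover have "integral {0..1} (\<lambda>x. h (circ s x) * (z / circ s x) powi n) = lcoeff h s n * z powi n" for n
  proof -
    have "(\<lambda>x. h (circ s x) * (z / circ s x) powi n) = (\<lambda>x. h (circ s x) * circ s x powi (- n) * z powi n)"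
      by (auto simp: power_int_divide_distrib power_int_minus inverse_eq_divide)
    thus ?thesis by (simp add: lcoeff_def)
  qed
  ultimately show ?thesis by simp
qed

text \<open>The difference quotient of f at z extends holomorphically across z, so its integrals
  over a circle of smaller and one of larger radius than the modulus of z agree. Expanding the two
  Cauchy kernels yields the terms with negative and with nonnegative index.\<close>

lemma laurent_expansion:
  assumes holo: "f holomorphic_on {z. \<rho>1 < cmod z \<and> cmod z < \<rho>2}" and "0 \<le> \<rho>1" "\<rho>1 < r" "r < \<rho>2"
    and z: "\<rho>1 < cmod z" "cmod z < \<rho>2"
  shows "((\<lambda>n. lcoeff f r n * z powi n) has_sum f z) UNIV"
proof -
  let ?A = "{z. \<rho>1 < cmod z \<and> cmod z < \<rho>2}"
  obtain s1 where s1: "\<rho>1 < s1" "s1 < cmod z" using z dense by blast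
  obtain s2 where s2: "cmod z < s2" "s2 < \<rho>2" using z dense by blast
  have pos: "0 < s1" "0 < s2" "z \<noteq> 0" using assms s1 s2 by auto
  define g where "g = (\<lambda>w. if w = z then deriv f z else (f w - f z) / (w - z))"
  have g: "g holomorphic_on ?A" unfolding g_def by (rule pole_lemma_open[OF holo open_ann])
  have con: "continuous_on {0..1} (\<lambda>x. f (circ s x))" if "\<rho>1 < s" "s < \<rho>2" for s
    by (rule continuous_on_holo_circ[OF holo]) (use that assms in auto)
  define I where "I = (\<lambda>h s. integral {0..1} (\<lambda>x. h (circ s x) * (circ s x / (circ s x - z))))"
  have split: "integral {0..1} (\<lambda>x. circ s x * g (circ s x)) = I f s - f z * I (\<lambda>_. 1) s"
    if s: "\<rho>1 < s" "s < \<rho>2" "s \<noteq> cmod z" for s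
  proof -
    have "0 < s" using assms s by auto
    hence ne: "circ s x \<noteq> z" for x using s by (metis norm_circ abs_of_pos)
    have i1: "(\<lambda>x. f (circ s x) * (circ s x / (circ s x - z))) integrable_on {0..1}"
      using ne by (intro integrable_continuous_real continuous_intros con s) auto
    have i2: "(\<lambda>x. f z * (1 * (circ s x / (circ s x - z)))) integrable_on {0..1}"
      using ne by (intro integrable_continuous_real continuous_intros) auto
    have "integral {0..1} (\<lambda>x. circ s x * g (circ s x)) =
      integral {0..1} (\<lambda>x. f (circ s x) * (circ s x / (circ s x - z)) - f z * (1 * (circ s x / (circ s x - z))))"
      using ne by (intro integral_cong) (simp add: g_def divide_simps, simp add: algebra_simps)
    also have "\<dots> = I f s - integral {0..1} (\<lambda>x. f z * (1 * (circ s x / (circ s x - z))))"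
      unfolding I_def by (rule integral_diff[OF i1 i2])
    also have "integral {0..1} (\<lambda>x. f z * (1 * (circ s x / (circ s x - z)))) = f z * I (\<lambda>_. 1) s"
      unfolding I_def by (rule integral_mult_right)
    finally show ?thesis .
  qed
  have "contour_integral (circlepath 0 s2) g = contour_integral (circlepath 0 s1) g"
    by (rule contour_integral_circlepaths_eq[OF g]) (use assms s1 s2 in auto)
  hence eq: "I f s2 - f z * I (\<lambda>_. 1) s2 = I f s1 - f z * I (\<lambda>_. 1) s1"
    using split[of s1] split[of s2] s1 s2 z by (simp add: contour_integral_circ)
  \<comment> \<open>The kernel expansions for the constant 1 evaluate the two winding integrals: 1
    for the outer circle, 0 for the inner one.\<close>
  have "((\<lambda>n. deltaf 0 n * z powi n) has_sum I (\<lambda>_. 1) s2) {0..}"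
    using cauchy_kernel_outer[of "\<lambda>_. 1" s2 z] s2 pos by (simp add: lcoeff_one I_def)
  moreover have "((\<lambda>n. deltaf 0 n * z powi n) has_sum 1) {0..}"
    by (rule has_sum_finite_neutralI[of "{0}"]) (auto simp: deltaf_def)
  ultimately have I2: "I (\<lambda>_. 1) s2 = 1" by (rule has_sum_unique)
  have "((\<lambda>n. deltaf 0 n * z powi n) has_sum - I (\<lambda>_. 1) s1) {..<0}"
    using cauchy_kernel_inner[of "\<lambda>_. 1" s1 z] s1 pos by (simp add: lcoeff_one I_def)
  moreover have "((\<lambda>n. deltaf 0 n * z powi n) has_sum 0) {..<0}"
    by (rule has_sum_0) (auto simp: deltaf_def)
  ultimately have I1: "I (\<lambda>_. 1) s1 = 0" using has_sum_unique by fastforce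
  have r2: "lcoeff f s2 n = lcoeff f r n" for n by (rule lcoeff_radius[OF holo]) (use assms s2 in auto)
  have r1: "lcoeff f s1 n = lcoeff f r n" for n by (rule lcoeff_radius[OF holo]) (use assms s1 in auto)
  have "((\<lambda>n. lcoeff f r n * z powi n) has_sum I f s2) {0..}"
    using cauchy_kernel_outer[OF con, of s2 z] s2 z pos by (simp add: r2 I_def)
  moreover have "((\<lambda>n. lcoeff f r n * z powi n) has_sum - I f s1) {..<0}"
    using cauchy_kernel_inner[OF con, of s1 z] s1 z pos by (simp add: r1 I_def)
  ultimately have "((\<lambda>n. lcoeff f r n * z powi n) has_sum (I f s2 + - I f s1)) ({0..} \<union> {..<0})"
    by (rule has_sum_Un_disjoint) auto
  moreover have "{0..} \<union> {..<0} = (UNIV :: int set)" by auto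
  moreover have "I f s2 + - I f s1 = f z" using eq I1 I2 by (simp add: algebra_simps)
  ultimately show ?thesis by simp
qed

text \<open>Expand f in its Laurent series on the circle and integrate term by term against
  g.\<close>

lemma lcoeff_mult:
  assumes f: "f holomorphic_on {z. \<rho>1 < cmod z \<and> cmod z < \<rho>2}" and g: "g holomorphic_on {z. \<rho>1 < cmod z \<and> cmod z < \<rho>2}"
    and r: "0 \<le> \<rho>1" "\<rho>1 < r" "r < \<rho>2"
  shows "symprod (lcoeff f r) (lcoeff g r) = lcoeff (\<lambda>z. f z * g z) r"
proof
  fix n
  have r0: "0 < r" using r by simp
  obtain M where M: "0 \<le> M" "\<And>x. x \<in> {0..1} \<Longrightarrow> cmod (g (circ r x)) \<le> M"
    using holo_circ_bounded[OF g r] by blast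
  have gc: "continuous_on {0..1} (\<lambda>x. g (circ r x))" by (rule continuous_on_holo_circ[OF g r])
  have "((\<lambda>j. integral {0..1} (\<lambda>x. lcoeff f r j * (g (circ r x) * circ r x powi (- (n - j))))) has_sum
     integral {0..1} (\<lambda>x. \<Sum>\<^sub>\<infinity>j. lcoeff f r j * (g (circ r x) * circ r x powi (- (n - j))))) UNIV"
  proof (rule integral_has_sum[where M = "\<lambda>j. (M * r powi (- n)) * (cmod (lcoeff f r j) * r powi j)"])
    show "continuous_on {0..1} (\<lambda>x. lcoeff f r j * (g (circ r x) * circ r x powi - (n - j)))" for j
      by (intro continuous_intros gc continuous_on_circ_powi r0)
    show "cmod (lcoeff f r j * (g (circ r x) * circ r x powi - (n - j))) \<le> M * r powi - n * (cmod (lcoeff f r j) * r powi j)"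
      if "x \<in> {0..1}" for j x
    proof -
      have "r powi - (n - j) = r powi (- n) * r powi j"
        using r0 by (simp flip: power_int_add)
      moreover have "cmod (lcoeff f r j) * (cmod (g (circ r x)) * r powi - (n - j)) \<le> cmod (lcoeff f r j) * (M * r powi - (n - j))"
        using M(2)[OF that] r0 by (intro mult_left_mono mult_right_mono) auto
      ultimately show ?thesis using r0 by (simp add: norm_mult norm_power_int mult_ac)
    qed
    show "(\<lambda>j. M * r powi - n * (cmod (lcoeff f r j) * r powi j)) summable_on UNIV"
      using lcoeff_wsummable_powi[OF f r r(2,3)] unfolding wsummable_def by (rule summable_on_cmult_right)
  qed
  moreover have "(\<Sum>\<^sub>\<infinity>j. lcoeff f r j * (g (circ r x) * circ r x powi (- (n - j)))) = f (circ r x) * g (circ r x) * circ r x powi (- n)" for x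
  proof -
    have "circ r x powi - (n - j) = circ r x powi j * circ r x powi (- n)" for j
      using r0 by (simp flip: power_int_add)
    hence "(\<Sum>\<^sub>\<infinity>j. lcoeff f r j * (g (circ r x) * circ r x powi (- (n - j)))) =
       (\<Sum>\<^sub>\<infinity>j. (lcoeff f r j * circ r x powi j) * (g (circ r x) * circ r x powi (- n)))"
      by (simp add: mult_ac)
    also have "\<dots> = f (circ r x) * (g (circ r x) * circ r x powi (- n))"
      by (intro infsumI has_sum_cmult_left laurent_expansion[OF f r]) (use r in auto)
    finally show ?thesis by simp
  qed
  ultimately have "((\<lambda>j. lcoeff f r j * lcoeff g r (n - j)) has_sum lcoeff (\<lambda>z. f z * g z) r n) UNIV"
    by (simp add: lcoeff_def)
  thus "symprod (lcoeff f r) (lcoeff g r) n = lcoeff (\<lambda>z. f z * g z) r n"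
    unfolding symprod_def by (rule infsumI)
qed

section \<open>Difference operators with prescribed characteristic roots\<close>

primrec dfactors :: "complex list \<Rightarrow> (int \<Rightarrow> complex) \<Rightarrow> int \<Rightarrow> complex" where
  "dfactors [] v = v"
| "dfactors (a # as) v = dfactors as (\<lambda>n. v (n + 1) - a * v n)"

lemma lcoeff_linear_factor:
  assumes "continuous_on {0..1} (\<lambda>x. f (circ r x))" "0 < r"
  shows "lcoeff (\<lambda>z. (z - a) * f z) r n = lcoeff f r (n - 1) - a * lcoeff f r n"
proof -
  have "circ r x powi (- (n - 1)) = circ r x * circ r x powi (- n)" for x
    using assms by (simp add: power_int_diff power_int_minus divide_inverse)
  hence "(circ r x - a) * f (circ r x) * circ r x powi - n =
        f (circ r x) * circ r x powi - (n - 1) - a * (f (circ r x) * circ r x powi - n)" for x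
    by (simp add: algebra_simps)
  moreover
  have "(\<lambda>x. f (circ r x) * circ r x powi m) integrable_on {0..1}" for m
    by (intro integrable_continuous_real continuous_intros assms continuous_on_circ_powi)
  hence "integral {0..1} (\<lambda>x. f (circ r x) * circ r x powi - (n - 1) - a * (f (circ r x) * circ r x powi - n)) =
      integral {0..1} (\<lambda>x. f (circ r x) * circ r x powi - (n - 1)) - integral {0..1} (\<lambda>x. a * (f (circ r x) * circ r x powi - n))"
    by (intro integral_diff integrable_on_mult_right)
  ultimately show ?thesis unfolding lcoeff_def by (simp only: integral_mult_right)
qed

text \<open>The symbol \<open>z - a\<close> acts as the shift minus a, so the polynomial with roots
  \<open>as\<close> acts as \<open>dfactors as\<close>. Induction moves one factor at a time from
  the coefficients to the sequence; summability is free because a polynomial is entire.\<close>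

lemma symop_lcoeff_dfactors:
  assumes "0 < rm" "rm \<le> rp" "0 < r" "rm \<le> r" "r \<le> rp" "\<And>n. cmod (u n) \<le> C * max (rp powi n) (rm powi n)"
  shows "symop (lcoeff (\<lambda>z. prod_list (map (\<lambda>a. z - a) as)) r) u = dfactors as u"
  using assms(6)
proof (induction as arbitrary: u C)
  case Nil
  show ?case using lcoeff_one[of r] assms by simp
next
  case (Cons a as)
  let ?\<omega> = "\<lambda>n. max (rp powi n) (rm powi n)"
  have rp: "0 < rp" using assms by simp
  have sw: "subweight ?\<omega>" by (intro subweight_max subweight_powi assms rp)
  let ?P = "\<lambda>z. prod_list (map (\<lambda>a. z - a) as)"
  have cont: "continuous_on A (\<lambda>x. ?P (circ r x))" for A
    by (induction as) (auto intro!: continuous_intros)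
  have holo: "?P holomorphic_on A" for A
    by (induction as) (auto intro!: holomorphic_intros)
  have ws: "wsummable ?\<omega> (lcoeff ?P r)"
    by (rule lcoeff_wsummable[OF holo, of 0 rm rp "rp + 1"]) (use assms rp in auto)
  have C0: "0 \<le> C" by (rule wbound_nonneg[OF sw Cons.prems])
  have b1: "cmod (u (n + 1)) \<le> (C * ?\<omega> 1) * ?\<omega> n" for n
  proof -
    have "cmod (u (n + 1)) \<le> C * ?\<omega> (n + 1)" by (rule Cons.prems)
    also have "\<dots> \<le> C * (?\<omega> n * ?\<omega> 1)"
      using sw C0 by (intro mult_left_mono) (auto simp only: subweight_def)
    finally show ?thesis by (simp add: mult_ac)
  qed
  have b2: "cmod (a * u n) \<le> (cmod a * C) * ?\<omega> n" for n
    using Cons.prems[of n] by (simp add: norm_mult mult_left_mono mult.assoc)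
  have b3: "cmod (u (n + 1) - a * u n) \<le> (C * ?\<omega> 1 + cmod a * C) * ?\<omega> n" for n
    using norm_triangle_ineq4[of "u (n + 1)" "a * u n"] b1[of n] b2[of n]
    by (simp only: distrib_right)
  have "symop (lcoeff (\<lambda>z. (z - a) * ?P z) r) u n = symop (lcoeff ?P r) (\<lambda>n. u (n + 1) - a * u n) n" for n
  proof -
    let ?c = "lcoeff ?P r"
    have s1: "(\<lambda>k. ?c k * u (n + k)) summable_on UNIV" for n by (rule symop_summable[OF sw ws Cons.prems])
    have s2: "(\<lambda>k. ?c (k - 1) * u (n + k)) summable_on UNIV"
      using s1[of "n + 1"] summable_int_translate[of "\<lambda>k. ?c (k - 1) * u (n + k)" 1] by (simp add: add_ac)
    have "symop (lcoeff (\<lambda>z. (z - a) * ?P z) r) u n = (\<Sum>\<^sub>\<infinity>k. ?c (k - 1) * u (n + k) - a * (?c k * u (n + k)))"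
      unfolding symop_def lcoeff_linear_factor[OF cont assms(3)]
      by (simp only: left_diff_distrib mult.assoc)
    also have "\<dots> = (\<Sum>\<^sub>\<infinity>k. ?c (k - 1) * u (n + k)) - (\<Sum>\<^sub>\<infinity>k. a * (?c k * u (n + k)))"
      by (intro infsumI has_sum_subtract has_sum_infsum s2 summable_on_cmult_right s1)
    also have "(\<Sum>\<^sub>\<infinity>k. ?c (k - 1) * u (n + k)) = symop ?c u (n + 1)"
      unfolding symop_def using infsum_int_translate[of "\<lambda>k. ?c (k - 1) * u (n + k)" 1] by (simp add: add_ac)
    also have "(\<Sum>\<^sub>\<infinity>k. a * (?c k * u (n + k))) = a * symop ?c u n"
      unfolding symop_def by (simp add: infsum_cmult_right')
    also have "symop ?c u (n + 1) - a * symop ?c u n = symop ?c (\<lambda>n. u (n + 1) - a * u n) n"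
      using symop_diff[OF sw ws b1 b2, of n] by (simp add: symop_translate symop_cmult)
    finally show ?thesis .
  qed
  moreover have "symop (lcoeff ?P r) (\<lambda>n. u (n + 1) - a * u n) = dfactors as (\<lambda>n. u (n + 1) - a * u n)"
    by (rule Cons.IH[OF b3])
  ultimately show ?case by (simp add: fun_eq_iff)
qed

section \<open>Splitting off the zeros of a symbol\<close>

lemma split_off_zero:
  assumes "f holomorphic_on S" "open S" "connected S" "z0 \<in> S" "\<exists>w\<in>S. f w \<noteq> 0"
  obtains g where "g holomorphic_on S" "g z0 \<noteq> 0" "\<And>w. w \<in> S \<Longrightarrow> f w = (w - z0) ^ nat (zorder f z0) * g w"
proof -
  define n where "n = nat (zorder f z0)"
  obtain r where r: "0 < r" "cball z0 r \<subseteq> S" "zor_poly f z0 holomorphic_on cball z0 r"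
    "\<And>w. w \<in> cball z0 r \<Longrightarrow> f w = zor_poly f z0 w * (w - z0) ^ n \<and> zor_poly f z0 w \<noteq> 0"
    using zorder_exist_zero[OF assms] unfolding n_def by blast
  \<comment> \<open>The quotient by the power, with the removable singularity filled by the value of
    \<open>zor_poly\<close>.\<close>
  define g where "g = (\<lambda>w. if w = z0 then zor_poly f z0 z0 else f w / (w - z0) ^ n)"
  have "g holomorphic_on ball z0 r"
    by (rule holomorphic_transform[OF holomorphic_on_subset[OF r(3)]]) (use r in \<open>auto simp: g_def\<close>)
  moreover have "g holomorphic_on (S - {z0})"
    by (rule holomorphic_transform[of "\<lambda>w. f w / (w - z0) ^ n"])
       (auto simp: g_def intro!: holomorphic_intros holomorphic_on_subset[OF assms(1)])
  ultimately have "g holomorphic_on (ball z0 r \<union> (S - {z0}))"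
    using assms(2) by (intro holomorphic_on_Un) auto
  moreover have "ball z0 r \<union> (S - {z0}) = S" using r assms(4) by (auto simp: subset_iff)
  ultimately have "g holomorphic_on S" by simp
  moreover have "g z0 \<noteq> 0" using r by (simp add: g_def)
  moreover have "f w = (w - z0) ^ n * g w" if "w \<in> S" for w
    using r(1) r(4)[of z0] that by (auto simp: g_def)
  ultimately show ?thesis using that n_def by blast
qed

text \<open>Zeros are removed one point at a time. Dividing by a power of \<open>w - z0\<close>
  leaves the orders at the other points unchanged, so the multiplicities of the original f are the
  lengths of the blocks of \<open>as\<close>.\<close>

lemma split_off_zeros:
  assumes "finite Z" "f holomorphic_on S" "open S" "connected S" "Z \<subseteq> S" "\<exists>w\<in>S. f w \<noteq> 0"
  shows "\<exists>as g. g holomorphic_on S \<and> set as \<subseteq> Z \<and> length as = (\<Sum>z\<in>Z. nat (zorder f z)) \<and>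
     (\<forall>w\<in>S. f w = prod_list (map (\<lambda>a. w - a) as) * g w) \<and> (\<forall>z\<in>Z. g z \<noteq> 0)"
  using assms
proof (induction Z arbitrary: f rule: finite_induct)
  case empty
  thus ?case by (intro exI[of _ "[]"] exI[of _ f]) auto
next
  case (insert z0 Z)
  obtain g0 where g0: "g0 holomorphic_on S" "g0 z0 \<noteq> 0" "\<And>w. w \<in> S \<Longrightarrow> f w = (w - z0) ^ nat (zorder f z0) * g0 w"
    using split_off_zero[OF insert.prems(1,2,3) _ insert.prems(5), of z0] insert.prems(4) by blast
  have nz: "\<exists>w\<in>S. g0 w \<noteq> 0" using g0(2) insert.prems(4) by blast
  have zo: "zorder f z = zorder g0 z" if z: "z \<in> Z" for z
  proof -
    have zS: "z \<in> S" "z \<noteq> z0" using z insert by auto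
    have ge: "0 \<le> zorder g0 z"
      using zorder_exist_zero[OF g0(1) insert.prems(2,3) zS(1) nz] by (auto split: if_splits)
    obtain r where r: "0 < r" "cball z r \<subseteq> S" "zor_poly g0 z holomorphic_on cball z r"
      "\<And>w. w \<in> cball z r \<Longrightarrow> g0 w = zor_poly g0 z w * (w - z) ^ nat (zorder g0 z) \<and> zor_poly g0 z w \<noteq> 0"
      using zorder_exist_zero[OF g0(1) insert.prems(2,3) zS(1) nz] by blast
    show ?thesis
    proof (rule zorder_eqI[of "ball z r" z "\<lambda>w. (w - z0) ^ nat (zorder f z0) * zor_poly g0 z w"])
      show "(\<lambda>w. (w - z0) ^ nat (zorder f z0) * zor_poly g0 z w) holomorphic_on ball z r"
        by (intro holomorphic_intros holomorphic_on_subset[OF r(3)]) auto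
      show "(z - z0) ^ nat (zorder f z0) * zor_poly g0 z z \<noteq> 0" using zS r by simp
      show "f w = (w - z0) ^ nat (zorder f z0) * zor_poly g0 z w * (w - z) powi zorder g0 z" if "w \<in> ball z r" "w \<noteq> z" for w
      proof -
        have w: "w \<in> cball z r" "w \<in> S" using that r by auto
        have "(w - z) powi zorder g0 z = (w - z) ^ nat (zorder g0 z)" using ge by (simp add: power_int_def)
        thus ?thesis using g0(3)[OF w(2)] r(4)[OF w(1)] by simp
      qed
    qed (use r in auto)
  qed
  have ZS: "Z \<subseteq> S" using insert.prems(4) by blast
  obtain as g where IH: "g holomorphic_on S" "set as \<subseteq> Z" "length as = (\<Sum>z\<in>Z. nat (zorder g0 z))"
     "\<forall>w\<in>S. g0 w = prod_list (map (\<lambda>a. w - a) as) * g w" "\<forall>z\<in>Z. g z \<noteq> 0"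
    using insert.IH[OF g0(1) insert.prems(2,3) ZS nz] by (elim exE conjE)
  show ?case
  proof (intro exI conjI)
    show "g holomorphic_on S" by fact
    show "set (replicate (nat (zorder f z0)) z0 @ as) \<subseteq> insert z0 Z" using IH(2) by auto
    show "length (replicate (nat (zorder f z0)) z0 @ as) = (\<Sum>z\<in>insert z0 Z. nat (zorder f z))"
      using insert IH(3) zo by simp
    show "\<forall>w\<in>S. f w = prod_list (map (\<lambda>a. w - a) (replicate (nat (zorder f z0)) z0 @ as)) * g w"
      using g0(3) IH(4) by (simp add: map_replicate mult.assoc)
    show "\<forall>z\<in>insert z0 Z. g z \<noteq> 0"
    proof -
      have "z0 \<in> S" using insert.prems(4) by blast
      hence "g z0 \<noteq> 0" using IH(4)[rule_format, of z0] g0(2) by (metis mult_zero_right)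
      thus ?thesis using IH(5) by blast
    qed
  qed
qed

lemma annulus_fattening:
  assumes "open U" "{z::complex. rm \<le> cmod z \<and> cmod z \<le> rp} \<subseteq> U" "0 < rm" "rm \<le> rp"
  obtains \<rho>1 \<rho>2 where "0 \<le> \<rho>1" "\<rho>1 < rm" "rp < \<rho>2" "{z. \<rho>1 < cmod z \<and> cmod z < \<rho>2} \<subseteq> U"
proof -
  let ?K = "{z::complex. rm \<le> cmod z \<and> cmod z \<le> rp}"
  have "?K = cball 0 rp - ball 0 rm" by auto
  hence "compact ?K" by (simp add: compact_diff)
  then obtain e where e: "0 < e" "(\<Union>x\<in>?K. ball x e) \<subseteq> U"
    using compact_subset_open_imp_ball_epsilon_subset[OF _ assms(1,2)] by blast
  have "z \<in> U" if z: "max 0 (rm - e) < cmod z" "cmod z < rp + e" for z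
  proof -
    \<comment> \<open>z differs from its radial projection y to the closed annulus by less than e,
      hence lies in the ball around y.\<close>
    define s where "s = max rm (min rp (cmod z))"
    define y where "y = of_real (s / cmod z) * z"
    have z0: "cmod z > 0" using z by simp
    have "rm - e < cmod z" using z by simp
    hence s: "rm \<le> s" "s \<le> rp" "\<bar>s - cmod z\<bar> < e" using assms z e by (auto simp: s_def max_def min_def)
    have "cmod y = s" using z0 s assms by (simp add: y_def norm_mult norm_divide)
    hence "y \<in> ?K" using s by simp
    moreover have "y - z = of_real ((s - cmod z) / cmod z) * z"
      using z0 by (simp add: y_def field_simps)
    hence "cmod (y - z) = \<bar>s - cmod z\<bar>" using z0
      by (simp add: norm_mult norm_divide flip: of_real_diff)
    hence "z \<in> ball y e" using s by (simp add: dist_norm)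
    ultimately show ?thesis using e by blast
  qed
  thus ?thesis using that[of "max 0 (rm - e)" "rp + e"] e assms by auto
qed

text \<open>Infinitely many zeros on the compact circle would accumulate there, and the identity
  theorem would make f vanish.\<close>

lemma finite_zeros_on_circle:
  assumes "f holomorphic_on S" "open S" "connected S" "sphere 0 1 \<subseteq> S" "\<exists>w\<in>S. f w \<noteq> 0"
  shows "finite {z. cmod z = 1 \<and> f z = 0}"
proof (rule ccontr)
  assume inf: "infinite {z. cmod z = 1 \<and> f z = 0}"
  have "{z. cmod z = 1 \<and> f z = 0} \<subseteq> sphere 0 1" by auto
  then obtain x where x: "x \<in> sphere 0 1" "x islimpt {z. cmod z = 1 \<and> f z = 0}"
    using compact_eq_Bolzano_Weierstrass[of "sphere (0::complex) 1"] inf by auto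
  have "f w = 0" if "w \<in> S" for w
    by (rule analytic_continuation[OF assms(1,2,3) _ _ x(2) _ that]) (use assms x in auto)
  thus False using assms(5) by blast
qed

text \<open>In the closed annulus V - E vanishes only on the unit circle, and these zeros are
  divided out with multiplicity. The quotient \<psi> is zero-free on the compact annulus, hence on a
  slightly larger open one; the extra room makes the coefficients of V, \<psi> and 1 / \<psi>
  summable against the weights at \<open>rm\<close> and \<open>rp\<close>.\<close>

lemma symbol_factorization:
  fixes V :: "complex \<Rightarrow> complex"
  assumes holo: "V holomorphic_on annulus h"
    and nonconst: "\<not> V constant_on sphere 0 1"
    and radii: "exp (- h) < rm" "rm < 1" "1 < rp" "rp < exp h"
    and zeros: "\<And>z. rm \<le> cmod z \<Longrightarrow> cmod z \<le> rp \<Longrightarrow> V z = E \<Longrightarrow> cmod z = 1"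
  obtains as \<psi> \<rho>1 \<rho>2 where "0 \<le> \<rho>1" "\<rho>1 < rm" "rp < \<rho>2"
    "V holomorphic_on {z. \<rho>1 < cmod z \<and> cmod z < \<rho>2}" "\<psi> holomorphic_on {z. \<rho>1 < cmod z \<and> cmod z < \<rho>2}"
    "\<And>z. \<rho>1 < cmod z \<Longrightarrow> cmod z < \<rho>2 \<Longrightarrow> \<psi> z \<noteq> 0"
    "\<And>z. \<rho>1 < cmod z \<Longrightarrow> cmod z < \<rho>2 \<Longrightarrow> V z - E = prod_list (map (\<lambda>a. z - a) as) * \<psi> z"
    "length as = center_dim V E" "\<And>a. a \<in> set as \<Longrightarrow> cmod a = 1"
proof -
  let ?S = "annulus h"
  have op: "open ?S" unfolding annulus_def by (rule open_ann)
  have con: "connected ?S" unfolding annulus_def using connected_annulus(1)[where a = "0::complex"] by simp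
  have h: "0 < h" using radii by (metis exp_gt_zero less_trans linorder_not_less neg_less_iff_less one_less_exp_iff)
  have sub: "{z. rm \<le> cmod z \<and> cmod z \<le> rp} \<subseteq> ?S" using radii by (auto simp: annulus_def)
  have sph: "sphere 0 1 \<subseteq> ?S" using radii sub by auto
  let ?f = "\<lambda>z. V z - E" and ?Z = "{z. cmod z = 1 \<and> V z = E}"
  have f: "?f holomorphic_on ?S" by (intro holomorphic_intros holo)
  have nz: "\<exists>w\<in>?S. ?f w \<noteq> 0"
  proof (rule ccontr)
    assume "\<not> ?thesis"
    hence "V w = E" if "w \<in> sphere 0 1" for w using sph that by (metis eq_iff_diff_eq_0 subsetD)
    thus False using nonconst unfolding constant_on_def by blast
  qed
  have fin: "finite ?Z" using finite_zeros_on_circle[OF f op con sph nz] by simp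
  have ZS: "?Z \<subseteq> ?S" using sph by auto
  obtain as \<psi> where *: "\<psi> holomorphic_on ?S" "set as \<subseteq> ?Z" "length as = (\<Sum>z\<in>?Z. nat (zorder ?f z))"
     "\<And>w. w\<in>?S \<Longrightarrow> V w - E = prod_list (map (\<lambda>a. w - a) as) * \<psi> w" "\<And>z. z\<in>?Z \<Longrightarrow> \<psi> z \<noteq> 0"
    using split_off_zeros[OF fin f op con ZS nz] by blast
  define U where "U = ?S \<inter> \<psi> -` (- {0})"
  have "open U" unfolding U_def
    by (rule continuous_open_preimage[OF holomorphic_on_imp_continuous_on[OF *(1)] op]) auto
  moreover have "{z. rm \<le> cmod z \<and> cmod z \<le> rp} \<subseteq> U"
  proof
    fix z assume "z \<in> {z. rm \<le> cmod z \<and> cmod z \<le> rp}"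
    hence z: "rm \<le> cmod z" "cmod z \<le> rp" "z \<in> ?S" using sub by auto
    have "\<psi> z \<noteq> 0"
    proof
      assume "\<psi> z = 0"
      hence "V z = E" using *(4)[OF z(3)] by simp
      thus False using zeros[OF z(1,2)] *(5)[of z] \<open>\<psi> z = 0\<close> by blast
    qed
    thus "z \<in> U" using z by (simp add: U_def)
  qed
  ultimately obtain \<rho>1 \<rho>2 where \<rho>: "0 \<le> \<rho>1" "\<rho>1 < rm" "rp < \<rho>2" "{z. \<rho>1 < cmod z \<and> cmod z < \<rho>2} \<subseteq> U"
    using annulus_fattening[of U rm rp] radii by (smt (verit) exp_gt_zero)
  hence US: "{z. \<rho>1 < cmod z \<and> cmod z < \<rho>2} \<subseteq> ?S" by (auto simp: U_def)
  show ?thesis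
  proof (rule that[OF \<rho>(1-3) holomorphic_on_subset[OF holo US] holomorphic_on_subset[OF *(1) US], of as])
    show "length as = center_dim V E" using *(3) by (simp add: center_dim_def)
    show "\<And>a. a \<in> set as \<Longrightarrow> cmod a = 1" using *(2) by auto
    show "\<psi> z \<noteq> 0" if "\<rho>1 < cmod z" "cmod z < \<rho>2" for z using \<rho>(4) that by (auto simp: U_def)
    show "V z - E = prod_list (map (\<lambda>a. z - a) as) * \<psi> z" if "\<rho>1 < cmod z" "cmod z < \<rho>2" for z
      by (rule *(4)) (use US that in auto)
  qed
qed

section \<open>A priori estimates for the perturbed difference equation\<close>

text \<open>Plays the role of a Neumann series where only inequalities are available: any finite
  bound C improves to \<open>A + q * C\<close>, and the iteration converges to the fixed point
  \<open>A / (1 - q)\<close>. The initial C may be arbitrarily bad and leaves no trace; this is how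
  qualitative growth becomes a quantitative estimate.\<close>

lemma bound_iterate:
  fixes f g :: "'n \<Rightarrow> real"
  assumes start: "\<And>n. n \<in> X \<Longrightarrow> f n \<le> C * g n" and C: "0 \<le> C"
    and step: "\<And>C n. 0 \<le> C \<Longrightarrow> (\<And>m. m \<in> X \<Longrightarrow> f m \<le> C * g m) \<Longrightarrow> n \<in> X \<Longrightarrow> f n \<le> (A + q * C) * g n"
    and q: "0 \<le> q" "q < 1" and A: "0 \<le> A" and g: "\<And>n. n \<in> X \<Longrightarrow> 0 \<le> g n" and n: "n \<in> X"
  shows "f n \<le> A / (1 - q) * g n"
proof -
  have *: "f n \<le> (A / (1 - q) + q ^ N * C) * g n" if "n \<in> X" for N n
    using that
  proof (induction N arbitrary: n)
    case 0
    have "C * g n \<le> (A / (1 - q) + C) * g n" using g[OF 0] A q by (intro mult_right_mono) auto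
    thus ?case using start[OF 0] by simp
  next
    case (Suc N)
    have "f n \<le> (A + q * (A / (1 - q) + q ^ N * C)) * g n"
      by (rule step[OF _ Suc.IH Suc.prems]) (use A q C in auto)
    also have "A + q * (A / (1 - q) + q ^ N * C) = A / (1 - q) + q ^ Suc N * C"
      using q by (simp add: field_simps)
    finally show ?case .
  qed
  have "(\<lambda>N. q ^ N) \<longlonglongrightarrow> 0" by (rule LIMSEQ_power_zero) (use q in simp)
  hence "(\<lambda>N. (A / (1 - q) + q ^ N * C) * g n) \<longlonglongrightarrow> (A / (1 - q) + 0 * C) * g n"
    by (intro tendsto_add tendsto_mult tendsto_const)
  hence "f n \<le> (A / (1 - q) + 0 * C) * g n"
    by (rule LIMSEQ_le_const) (use *[OF n] in auto)
  thus ?thesis by simp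
qed

section \<open>The growth weight of center solutions and finite-order difference equations\<close>

definition wt :: "real \<Rightarrow> real \<Rightarrow> int \<Rightarrow> real" where
  "wt rm rp n = max (rp powi n) (rm powi n)"

locale radii =
  fixes rm rp :: real
  assumes rm_pos: "0 < rm" and rm_less: "rm < 1" and rp_gt: "1 < rp"
begin

abbreviation "\<omega> \<equiv> wt rm rp"

lemma rp_pos: "0 < rp" using rp_gt by simp

lemma subweight_wt: "subweight \<omega>"
  using subweight_max[OF subweight_powi[OF rp_pos] subweight_powi[OF rm_pos]] by (simp add: wt_def[abs_def])

lemma wt_pos: "0 < \<omega> n" using subweight_wt by (simp add: subweight_def)

lemma wt_add: "\<omega> (m + n) \<le> \<omega> m * \<omega> n" using subweight_wt by (simp add: subweight_def)

lemma wt_nat: "\<omega> (int n) = rp ^ n"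
  using power_mono[of rm rp n] rm_pos rm_less rp_gt by (simp add: wt_def)

lemma wt_neg_nat: "\<omega> (- int n) = (1 / rm) ^ n"
proof -
  have "inverse rp ^ n \<le> inverse rm ^ n" using rm_pos rm_less rp_gt by (intro power_mono) (auto intro: le_imp_inverse_le)
  thus ?thesis by (simp add: wt_def power_int_minus inverse_eq_divide power_divide power_inverse[symmetric])
qed

lemma wt_ge1: "1 \<le> \<omega> n"
proof (cases n rule: int_cases2)
  case (nonneg k) thus ?thesis using wt_nat[of k] rp_gt by simp
next
  case (nonpos k) thus ?thesis using wt_neg_nat[of k] rm_pos rm_less by (simp add: one_le_power)
qed

lemma rp_le_wt: "rp powi n \<le> \<omega> n" and rm_le_wt: "rm powi n \<le> \<omega> n"
  by (auto simp: wt_def)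

text \<open>As a has modulus 1, a step in either direction changes the modulus of v by at most the
  forcing. Summing the forcing gives the geometric series behind \<open>1 / (rp - 1)\<close> to the
  right and \<open>1 / (1 - rm)\<close> to the left.\<close>

lemma first_order_bound:
  assumes a: "cmod a = 1" and F: "\<And>n. cmod (v (n + 1) - a * v n) \<le> F * \<omega> n"
  shows "cmod (v n) \<le> (cmod (v 0) + F * (1 / (rp - 1) + 1 / (1 - rm))) * \<omega> n"
proof -
  have F0: "0 \<le> F" by (rule wbound_nonneg[OF subweight_wt F])
  have up: "cmod (v (n + 1)) \<le> cmod (v n) + F * \<omega> n" for n
    using norm_triangle_ineq[of "v (n + 1) - a * v n" "a * v n"] F[of n] a by (simp add: norm_mult)
  have dn: "cmod (v n) \<le> cmod (v (n + 1)) + F * \<omega> n" for n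
    using norm_triangle_ineq4[of "v (n + 1)" "v (n + 1) - a * v n"] F[of n] a by (simp add: norm_mult)
  have pos: "cmod (v (int k)) \<le> cmod (v 0) + F * (rp ^ k / (rp - 1))" for k
  proof (induction k)
    case 0 thus ?case using F0 rp_gt by simp
  next
    case (Suc k)
    have "cmod (v (int (Suc k))) \<le> cmod (v (int k)) + F * rp ^ k"
      using up[of "int k"] wt_nat[of k] by (simp add: add.commute)
    also have "\<dots> \<le> cmod (v 0) + F * (rp ^ k / (rp - 1)) + F * rp ^ k" using Suc by simp
    also have "\<dots> = cmod (v 0) + F * (rp ^ Suc k / (rp - 1))"
      using rp_gt by (simp add: field_simps)
    finally show ?case .
  qed
  have neg: "cmod (v (- int k)) \<le> cmod (v 0) + F * ((1 / rm) ^ k / (1 - rm))" for k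
  proof (induction k)
    case 0 thus ?case using F0 rm_less by simp
  next
    case (Suc k)
    \<comment> \<open>Leftwards the forcing is evaluated at the new index, hence the exponent
      \<open>Suc k\<close>.\<close>
    have "cmod (v (- int (Suc k))) \<le> cmod (v (- int k)) + F * (1 / rm) ^ Suc k"
      using dn[of "- int (Suc k)"] wt_neg_nat[of "Suc k"] by simp
    also have "\<dots> \<le> cmod (v 0) + F * ((1 / rm) ^ k / (1 - rm)) + F * (1 / rm) ^ Suc k" using Suc by simp
    also have "\<dots> = cmod (v 0) + F * ((1 / rm) ^ Suc k / (1 - rm))"
      using rm_less rm_pos by (simp add: field_simps)
    finally show ?case .
  qed
  have c: "0 \<le> 1 / (rp - 1)" "0 \<le> 1 / (1 - rm)" using rp_gt rm_less by auto
  have "cmod (v n) \<le> cmod (v 0) * \<omega> n + F * (1 / (rp - 1) + 1 / (1 - rm)) * \<omega> n"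
  proof (cases n rule: int_cases2)
    case (nonneg k)
    have "F * (rp ^ k / (rp - 1)) \<le> F * (1 / (rp - 1) + 1 / (1 - rm)) * rp ^ k"
      using F0 c rp_gt mult_nonneg_nonneg[OF mult_nonneg_nonneg[OF F0 c(2)], of "rp ^ k"]
      by (simp add: algebra_simps)
    moreover have "cmod (v 0) \<le> cmod (v 0) * \<omega> n" using wt_ge1[of n] mult_left_mono[of 1 "\<omega> n" "cmod (v 0)"] by simp
    ultimately show ?thesis using pos[of k] nonneg wt_nat[of k] by simp
  next
    case (nonpos k)
    have "F * ((1 / rm) ^ k / (1 - rm)) \<le> F * (1 / (rp - 1) + 1 / (1 - rm)) * (1 / rm) ^ k"
      using F0 c rm_pos mult_nonneg_nonneg[OF mult_nonneg_nonneg[OF F0 c(1)], of "(1 / rm) ^ k"]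
      by (simp add: algebra_simps)
    moreover have "cmod (v 0) \<le> cmod (v 0) * \<omega> n" using wt_ge1[of n] mult_left_mono[of 1 "\<omega> n" "cmod (v 0)"] by simp
    ultimately show ?thesis using neg[of k] nonpos wt_neg_nat[of k] by simp
  qed
  thus ?thesis by (simp add: distrib_right)
qed

text \<open>Quantitative form of the fact that an equation of order q is determined by q consecutive
  values. The induction hypothesis bounds the reduced sequence \<open>v (n + 1) - a * v n\<close>,
  and \<open>first_order_bound\<close> recovers v. K is fixed before v and F.\<close>

lemma dfactors_initial_values:
  assumes "\<forall>a\<in>set as. cmod a = 1"
  shows "\<exists>K\<ge>0. \<forall>v F. (\<forall>n. cmod (dfactors as v n) \<le> F * \<omega> n) \<longrightarrow>
     (\<forall>n. cmod (v n) \<le> K * ((\<Sum>i<length as. cmod (v (int i))) + F) * \<omega> n)"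
  using assms
proof (induction as)
  case Nil
  show ?case by (rule exI[of _ 1]) auto
next
  case (Cons a as)
  then obtain K where K: "0 \<le> K" "\<And>v F n. (\<And>n. cmod (dfactors as v n) \<le> F * \<omega> n) \<Longrightarrow>
     cmod (v n) \<le> K * ((\<Sum>i<length as. cmod (v (int i))) + F) * \<omega> n" by fastforce
  define c where "c = 1 / (rp - 1) + 1 / (1 - rm)"
  have c: "0 \<le> c" using rp_gt rm_less by (auto simp: c_def)
  show ?case
  proof (intro exI[of _ "1 + 2 * K * c"] conjI allI impI)
    show "0 \<le> 1 + 2 * K * c" using K c by simp
    fix v F n assume F: "\<forall>n. cmod (dfactors (a # as) v n) \<le> F * \<omega> n"
    define v' where "v' = (\<lambda>n. v (n + 1) - a * v n)"
    define J where "J = (\<Sum>i<length (a # as). cmod (v (int i)))"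
    have F0: "0 \<le> F" by (rule wbound_nonneg[OF subweight_wt]) (use F in blast)
    have a: "cmod a = 1" using Cons.prems by simp
    have J1: "(\<Sum>i<length as. cmod (v (int i))) \<le> J" by (simp add: J_def)
    have J2: "(\<Sum>i<length as. cmod (v (int i + 1))) \<le> J"
      using sum.lessThan_Suc_shift[of "\<lambda>i. cmod (v (int i))" "length as"] by (simp add: J_def add.commute)
    have J3: "cmod (v 0) \<le> J"
      using sum.lessThan_Suc_shift[of "\<lambda>i. cmod (v (int i))" "length as"] by (simp add: J_def sum_nonneg)
    \<comment> \<open>The reduced sequence has one initial value fewer, and each of them combines
      two neighbours in the window of v: hence the factor 2.\<close>
    have "(\<Sum>i<length as. cmod (v' (int i))) \<le> (\<Sum>i<length as. cmod (v (int i + 1)) + cmod (v (int i)))"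
      using a by (intro sum_mono) (auto simp: v'_def norm_mult intro!: norm_triangle_ineq4[THEN order_trans])
    also have "\<dots> \<le> 2 * J" using J1 J2 by (simp add: sum.distrib)
    finally have J4: "(\<Sum>i<length as. cmod (v' (int i))) \<le> 2 * J" .
    have "cmod (v' n) \<le> (K * (2 * J + F)) * \<omega> n" for n
    proof -
      have "cmod (v' n) \<le> K * ((\<Sum>i<length as. cmod (v' (int i))) + F) * \<omega> n"
        by (rule K(2)) (use F in \<open>simp add: v'_def\<close>)
      also have "\<dots> \<le> (K * (2 * J + F)) * \<omega> n"
        using J4 K wt_pos[of n] by (intro mult_right_mono mult_left_mono) auto
      finally show ?thesis .
    qed
    from first_order_bound[OF a this[unfolded v'_def]]
    have "cmod (v n) \<le> (cmod (v 0) + K * (2 * J + F) * c) * \<omega> n" by (simp add: c_def)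
    also have "\<dots> \<le> ((1 + 2 * K * c) * (J + F)) * \<omega> n"
    proof (rule mult_right_mono)
      have "K * (2 * J + F) * c \<le> K * (2 * (J + F)) * c"
        using K c F0 by (intro mult_right_mono mult_left_mono) auto
      thus "cmod (v 0) + K * (2 * J + F) * c \<le> (1 + 2 * K * c) * (J + F)"
        using J3 F0 by (simp add: algebra_simps)
    qed (simp add: wt_pos less_imp_le)
    finally show "cmod (v n) \<le> (1 + 2 * K * c) * ((\<Sum>i<length (a # as). cmod (v (int i))) + F) * \<omega> n"
      by (simp only: J_def)
  qed
qed

text \<open>Roots of modulus 1 admit no decaying homogeneous solution, so a decaying v is determined
  by the forcing. Solving backwards from +infinity contracts by \<open>rm\<close> per factor; C
  serves only as the start of \<open>bound_iterate\<close>.\<close>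

lemma dfactors_decay_right:
  assumes "\<forall>a\<in>set as. cmod a = 1" "0 \<le> F"
    and "\<And>n. 0 \<le> n \<Longrightarrow> cmod (v n) \<le> C * rm powi n"
    and "\<And>n. 0 \<le> n \<Longrightarrow> cmod (dfactors as v n) \<le> F * rm powi n" and "0 \<le> n"
  shows "cmod (v n) \<le> F / (1 - rm) ^ length as * rm powi n"
  using assms
proof (induction as arbitrary: v C n)
  case Nil thus ?case by simp
next
  case (Cons a as)
  define F' where "F' = F / (1 - rm) ^ length as"
  have F': "0 \<le> F'" using Cons.prems rm_less by (simp add: F'_def)
  have a: "cmod a = 1" using Cons.prems by simp
  have C: "0 \<le> C" using Cons.prems(3)[of 0] by (metis norm_ge_zero order_refl order_trans mult.right_neutral power_int_0_right)
  have bb: "cmod (v (m + 1) - a * v m) \<le> (C * (rm + 1)) * rm powi m" if "0 \<le> m" for m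
  proof -
    have "cmod (v (m + 1)) \<le> C * (rm * rm powi m)"
      using Cons.prems(3)[of "m + 1"] that rm_pos by (simp add: power_int_add mult_ac)
    thus ?thesis using norm_triangle_ineq4[of "v (m + 1)" "a * v m"] Cons.prems(3)[OF that] a
      by (simp add: norm_mult algebra_simps)
  qed
  have v': "cmod (v (m + 1) - a * v m) \<le> F' * rm powi m" if "0 \<le> m" for m
    unfolding F'_def by (rule Cons.IH[of "\<lambda>m. v (m + 1) - a * v m", OF _ _ bb]) (use Cons.prems that in auto)
  have "cmod (v n) \<le> F' / (1 - rm) * rm powi n"
  proof (rule bound_iterate[where X = "{0..}" and C = C and q = rm and A = F' and f = "\<lambda>n. cmod (v n)"])
    fix C n assume h: "0 \<le> C" "\<And>m. m \<in> {0..} \<Longrightarrow> cmod (v m) \<le> C * rm powi m" "(n::int) \<in> {0..}"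
    have "cmod (v n) \<le> cmod (v (n + 1)) + cmod (v (n + 1) - a * v n)"
      using norm_triangle_ineq4[of "v (n + 1)" "v (n + 1) - a * v n"] a by (simp add: norm_mult)
    also have "\<dots> \<le> C * rm powi (n + 1) + F' * rm powi n"
      using h(2)[of "n + 1"] v'[of n] h(3) by simp
    also have "\<dots> = (F' + rm * C) * rm powi n" using rm_pos by (simp add: power_int_add algebra_simps)
    finally show "cmod (v n) \<le> (F' + rm * C) * rm powi n" .
  qed (use Cons.prems C F' rm_pos rm_less in auto)
  thus ?case by (simp add: F'_def mult.commute)
qed

text \<open>The mirror image, solved forwards from -infinity with contraction \<open>1 / rp\<close>.
  Since \<open>dfactors as v n\<close> reads v up to index \<open>n + length as\<close>, control of
  v up to N corresponds to the equation up to \<open>N - length as\<close>.\<close>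

lemma dfactors_decay_left:
  assumes "\<forall>a\<in>set as. cmod a = 1" "0 \<le> F"
    and "\<And>n. n \<le> N \<Longrightarrow> cmod (v n) \<le> C * rp powi n"
    and "\<And>n. n \<le> N - int (length as) \<Longrightarrow> cmod (dfactors as v n) \<le> F * rp powi n" and "n \<le> N"
  shows "cmod (v n) \<le> F / (rp - 1) ^ length as * rp powi n"
  using assms
proof (induction as arbitrary: v C n N)
  case Nil thus ?case by simp
next
  case (Cons a as)
  define F' where "F' = F / (rp - 1) ^ length as"
  have F': "0 \<le> F'" using Cons.prems rp_gt by (simp add: F'_def)
  have a: "cmod a = 1" using Cons.prems by simp
  have C: "0 \<le> C"
  proof -
    have "0 \<le> C * rp powi N" using Cons.prems(3)[of N] norm_ge_zero order_trans by blast
    moreover have "0 < rp powi N" using rp_pos by simp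
    ultimately show ?thesis by (simp add: zero_le_mult_iff)
  qed
  have bb: "cmod (v (m + 1) - a * v m) \<le> (C * (rp + 1)) * rp powi m" if "m \<le> N - 1" for m
  proof -
    have "cmod (v (m + 1)) \<le> C * (rp * rp powi m)"
      using Cons.prems(3)[of "m + 1"] that rp_pos by (simp add: power_int_add mult_ac)
    thus ?thesis using norm_triangle_ineq4[of "v (m + 1)" "a * v m"] Cons.prems(3)[of m] that a
      by (simp add: norm_mult algebra_simps)
  qed
  have v': "cmod (v (m + 1) - a * v m) \<le> F' * rp powi m" if "m \<le> N - 1" for m
    unfolding F'_def
    by (rule Cons.IH[of "N - 1" "\<lambda>m. v (m + 1) - a * v m", OF _ _ bb]) (use Cons.prems that in \<open>auto simp: algebra_simps\<close>)
  have "cmod (v n) \<le> F' / rp / (1 - 1 / rp) * rp powi n"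
  proof (rule bound_iterate[where X = "{..N}" and C = C and q = "1 / rp" and A = "F' / rp" and f = "\<lambda>n. cmod (v n)"])
    fix C n assume h: "0 \<le> C" "\<And>m. m \<in> {..N} \<Longrightarrow> cmod (v m) \<le> C * rp powi m" "(n::int) \<in> {..N}"
    have "cmod (v n) \<le> cmod (v (n - 1)) + cmod (v (n - 1 + 1) - a * v (n - 1))"
      using norm_triangle_ineq[of "a * v (n - 1)" "v n - a * v (n - 1)"] a by (simp add: norm_mult)
    also have "\<dots> \<le> C * rp powi (n - 1) + F' * rp powi (n - 1)"
      using h(2)[of "n - 1"] v'[of "n - 1"] h(3) by auto
    also have "\<dots> = (F' / rp + 1 / rp * C) * rp powi n" using rp_pos by (simp add: power_int_diff field_simps)
    finally show "cmod (v n) \<le> (F' / rp + 1 / rp * C) * rp powi n" .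
  qed (use Cons.prems C F' rp_pos rp_gt in auto)
  also have "F' / rp / (1 - 1 / rp) = F / (rp - 1) ^ length (a # as)"
    using rp_gt by (simp add: F'_def field_simps)
  finally show ?case .
qed

lemma dfactors_upper:
  assumes "\<forall>a\<in>set as. cmod a = 1" "\<And>n. cmod (v n) \<le> B * \<omega> n"
  shows "cmod (dfactors as v n) \<le> (rp + 1) ^ length as * B * \<omega> n"
  using assms
proof (induction as arbitrary: v B n)
  case Nil thus ?case by simp
next
  case (Cons a as)
  have B: "0 \<le> B" by (rule wbound_nonneg[OF subweight_wt Cons.prems(2)])
  have a: "cmod a = 1" using Cons.prems by simp
  have bb: "cmod (v (m + 1) - a * v m) \<le> ((rp + 1) * B) * \<omega> m" for m
  proof -
    have "cmod (v (m + 1)) \<le> B * \<omega> (m + 1)" by (rule Cons.prems)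
    also have "\<dots> \<le> B * (\<omega> m * \<omega> 1)" by (intro mult_left_mono wt_add B)
    also have "\<omega> 1 = rp" using wt_nat[of 1] by simp
    finally have "cmod (v (m + 1)) \<le> B * (\<omega> m * rp)" .
    thus ?thesis using norm_triangle_ineq4[of "v (m + 1)" "a * v m"] Cons.prems(2)[of m] a
      by (simp add: norm_mult algebra_simps)
  qed
  have "cmod (dfactors as (\<lambda>n. v (n + 1) - a * v n) n) \<le> (rp + 1) ^ length as * ((rp + 1) * B) * \<omega> n"
    by (rule Cons.IH[OF _ bb]) (use Cons.prems in auto)
  thus ?case by (simp add: mult_ac)
qed

end

section \<open>Estimates that are uniform over small perturbations\<close>

lemma wsummable_mono:
  assumes "wsummable \<omega> a" "\<And>n. 0 \<le> \<omega>' n" "\<And>n. \<omega>' n \<le> \<omega> n"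
  shows "wsummable \<omega>' a"
  using assms unfolding wsummable_def
  by (elim summable_on_comparison_test) (auto intro!: mult_left_mono)

text \<open>Applying the left inverse b turns the equation into u = - b (w u), which contracts in
  the sup norm weighted by \<open>r powi n\<close>.\<close>

lemma kernel_trivial_of_inverse:
  assumes r: "0 < r" and wa: "wsummable (\<lambda>n. r powi n) a" and wb: "wsummable (\<lambda>n. r powi n) b" and inv: "symprod b a = deltaf 0"
    and w: "\<And>n. cmod (w n) \<le> \<tau>" "\<tau> * wnorm (\<lambda>n. r powi n) b < 1"
    and u: "\<And>n. cmod (u n) \<le> C * r powi n" and eq: "\<And>n. symop a u n + w n * u n = 0"
  shows "u n = 0"
proof -
  let ?b = "wnorm (\<lambda>n. r powi n) b"
  have sw: "subweight (\<lambda>n. r powi n)" by (rule subweight_powi[OF r])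
  have t: "0 \<le> \<tau>" using w(1)[of 0] norm_ge_zero order_trans by blast
  have bn: "0 \<le> ?b" by (rule wnorm_nonneg[OF sw])
  have "symop b (symop a u) = u" using symop_symop[OF sw wb wa u] inv by simp
  moreover have "symop a u = (\<lambda>n. - (w n * u n))" using eq by (metis eq_neg_iff_add_eq_0)
  ultimately have ub: "u = symop b (\<lambda>n. - (w n * u n))" by simp
  have "cmod (u n) \<le> 0 / (1 - \<tau> * ?b) * r powi n"
  proof (rule bound_iterate[where X = UNIV and C = C and q = "\<tau> * ?b" and A = 0 and f = "\<lambda>n. cmod (u n)"])
    fix C n assume h: "0 \<le> C" "\<And>m. m \<in> UNIV \<Longrightarrow> cmod (u m) \<le> C * r powi m"
    have "cmod (- (w m * u m)) \<le> (\<tau> * C) * r powi m" for m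
      using mult_mono[OF w(1)[of m] h(2)[of m]] t by (simp add: norm_mult mult.assoc)
    from symop_bound[OF sw wb this, of n]
    show "cmod (u n) \<le> (0 + \<tau> * ?b * C) * r powi n" using ub by (simp add: mult_ac)
  qed (use u t bn w(2) wbound_nonneg[OF sw u] r in auto)
  thus ?thesis by simp
qed

text \<open>\<open>bp\<close> and \<open>bm\<close> are the Laurent coefficients of the reciprocal of the symbol on the two circles;
  \<open>\<eta>\<close> is the zero-free factor of the symbol and \<open>\<kappa>\<close> its reciprocal.\<close>

locale laurent_symbol = radii rm rp for rm rp :: real +
  fixes \<alpha> bm bp \<kappa> \<eta> :: "int \<Rightarrow> complex" and as :: "complex list"
  assumes wsummable_\<alpha>: "wsummable \<omega> \<alpha>" and wsummable_\<kappa>: "wsummable \<omega> \<kappa>" and wsummable_\<eta>: "wsummable \<omega> \<eta>"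
    and wsummable_bp: "wsummable (\<lambda>n. rp powi n) bp" and wsummable_bm: "wsummable (\<lambda>n. rm powi n) bm"
    and inv_p: "symprod \<alpha> bp = deltaf 0" "symprod bp \<alpha> = deltaf 0"
    and inv_m: "symprod \<alpha> bm = deltaf 0" "symprod bm \<alpha> = deltaf 0"
    and roots: "\<forall>a\<in>set as. cmod a = 1"
    and dfactors_\<kappa>: "\<And>u C. (\<And>n. cmod (u n) \<le> C * \<omega> n) \<Longrightarrow> symop \<kappa> (symop \<alpha> u) = dfactors as u"
    and dfactors_\<eta>: "\<And>u C. (\<And>n. cmod (u n) \<le> C * \<omega> n) \<Longrightarrow> dfactors as (symop \<eta> u) = symop \<alpha> u"
begin

lemma wsummable_powi:
  assumes "wsummable \<omega> c" shows "wsummable (\<lambda>n. rp powi n) c" "wsummable (\<lambda>n. rm powi n) c"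
  using assms rp_pos rm_pos by (auto intro!: wsummable_mono[OF assms] rp_le_wt rm_le_wt)

text \<open>Applying \<kappa> leaves a finite-order equation with the small right-hand side -
  \<kappa> (w u). The window controls its solution up to a fraction of u itself, which
  \<open>bound_iterate\<close> absorbs. The constants precede w and u, so they serve all base points
  at once.\<close>

lemma center_window_bound:
  "\<exists>K\<ge>0. \<exists>\<tau>>0. \<forall>w u C. (\<forall>n. cmod (w n) \<le> \<tau>) \<longrightarrow> (\<forall>n. cmod (u n) \<le> C * \<omega> n) \<longrightarrow>
     (\<forall>n. symop \<alpha> u n + w n * u n = 0) \<longrightarrow>
     (\<forall>n. cmod (u n) \<le> K * (\<Sum>i<length as. cmod (u (int i))) * \<omega> n)"
proof -
  obtain K where K: "0 \<le> K" "\<And>v F n. (\<And>n. cmod (dfactors as v n) \<le> F * \<omega> n) \<Longrightarrow>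
     cmod (v n) \<le> K * ((\<Sum>i<length as. cmod (v (int i))) + F) * \<omega> n"
    using dfactors_initial_values[OF roots] by auto
  define k where "k = wnorm \<omega> \<kappa>"
  have k: "0 \<le> k" unfolding k_def by (rule wnorm_nonneg[OF subweight_wt])
  define M where "M = K * k"
  have M: "0 \<le> M" using K k by (simp add: M_def)
  \<comment> \<open>Makes the feedback factor \<open>K * (k * \<tau>)\<close> at most 1/2.\<close>
  define \<tau> where "\<tau> = 1 / (2 * (M + 1))"
  have "0 < \<tau>" "M * \<tau> \<le> 1 / 2" using M by (auto simp: \<tau>_def field_simps)
  hence \<tau>: "0 < \<tau>" "K * (k * \<tau>) \<le> 1 / 2" by (auto simp: M_def mult.assoc)
  have main: "cmod (u n) \<le> 2 * K * (\<Sum>i<length as. cmod (u (int i))) * \<omega> n"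
    if w: "\<forall>n. cmod (w n) \<le> \<tau>" and u: "\<forall>n. cmod (u n) \<le> C * \<omega> n" and eq: "\<forall>n. symop \<alpha> u n + w n * u n = 0"
    for w u :: "int \<Rightarrow> complex" and C n
  proof -
    define J where "J = (\<Sum>i<length as. cmod (u (int i)))"
    have J: "0 \<le> J" by (simp add: J_def sum_nonneg)
    have su: "symop \<alpha> u = (\<lambda>n. - (w n * u n))" using eq by (metis eq_neg_iff_add_eq_0)
    have df: "dfactors as u = symop \<kappa> (\<lambda>n. - (w n * u n))"
      using dfactors_\<kappa>[of u C] u su by simp
    have "cmod (u n) \<le> K * J / (1 - K * (k * \<tau>)) * \<omega> n"
    proof (rule bound_iterate[where X = UNIV and C = C and q = "K * (k * \<tau>)" and A = "K * J" and f = "\<lambda>n. cmod (u n)"])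
      fix C n assume h: "0 \<le> C" "\<And>m. m \<in> UNIV \<Longrightarrow> cmod (u m) \<le> C * \<omega> m"
      have "cmod (- (w m * u m)) \<le> (\<tau> * C) * \<omega> m" for m
        using mult_mono[of "cmod (w m)" \<tau> "cmod (u m)" "C * \<omega> m"] w h(2)[of m] \<tau> by (simp add: norm_mult mult.assoc)
      from symop_bound[OF subweight_wt wsummable_\<kappa> this]
      have "cmod (dfactors as u m) \<le> (k * (\<tau> * C)) * \<omega> m" for m by (simp add: df k_def)
      from K(2)[OF this, of n]
      show "cmod (u n) \<le> (K * J + K * (k * \<tau>) * C) * \<omega> n" by (simp add: J_def algebra_simps)
    qed (use u \<tau> K k J wbound_nonneg[OF subweight_wt, of u C] wt_pos in \<open>auto simp: less_imp_le\<close>)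
    also have "\<dots> \<le> K * J * 2 * \<omega> n"
    proof (rule mult_right_mono)
      have "K * J / (1 - K * (k * \<tau>)) \<le> K * J / (1 / 2)"
        using \<tau> K J by (intro divide_left_mono) auto
      thus "K * J / (1 - K * (k * \<tau>)) \<le> K * J * 2" by simp
    qed (simp add: wt_pos less_imp_le)
    finally show ?thesis by (simp add: J_def mult_ac)
  qed
  show ?thesis
    by (rule exI[of _ "2 * K"], rule conjI, use K in simp, rule exI[of _ \<tau>], use \<tau> main in blast)
qed

text \<open>Linear independence of the differences \<open>vp - vm\<close>, with constants. The case
  w = 0 shows the mechanism: after applying \<eta>, \<open>dfactors as\<close> of either sequence is
  the source, supported on -q, ..., -1. The sequence decaying at -infinity then vanishes up to -1,
  the one decaying at +infinity vanishes from 0 on. If the two agree, both vanish, and so does the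
  source. With a perturbation, vanishing becomes smallness of order \<tau>0 times the size of
  x.\<close>

lemma center_frame_bound:
  assumes K0: "0 \<le> K0"
  shows "\<exists>K\<ge>0. \<exists>\<tau>0>0. \<forall>w x vp vm. (\<forall>n. cmod (w n) \<le> \<tau>0) \<longrightarrow>
     (\<forall>n. cmod (vp n) \<le> K0 * (\<Sum>p<length as. cmod (x p)) * rp powi n) \<longrightarrow>
     (\<forall>n. cmod (vm n) \<le> K0 * (\<Sum>p<length as. cmod (x p)) * rm powi n) \<longrightarrow>
     (\<forall>n. symop \<alpha> vp n + w n * vp n = (\<Sum>p<length as. x p * deltaf (- int p - 1) n)) \<longrightarrow>
     (\<forall>n. symop \<alpha> vm n + w n * vm n = (\<Sum>p<length as. x p * deltaf (- int p - 1) n)) \<longrightarrow>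
     (\<Sum>p<length as. cmod (x p)) \<le> K * (\<Sum>i<length as. cmod (vp (int i) - vm (int i)))"
proof -
  obtain K2 \<tau>2 where K2: "0 \<le> K2" "0 < \<tau>2" and K2': "\<And>w u C n. (\<And>n. cmod (w n) \<le> \<tau>2) \<Longrightarrow> (\<And>n. cmod (u n) \<le> C * \<omega> n) \<Longrightarrow>
     (\<And>n. symop \<alpha> u n + w n * u n = 0) \<Longrightarrow> cmod (u n) \<le> K2 * (\<Sum>i<length as. cmod (u (int i))) * \<omega> n"
    using center_window_bound by (elim exE conjE) blast
  define q where "q = length as"
  define P where "P = wnorm \<omega> \<eta>"
  define D where "D = (rp + 1) ^ q"
  define c where "c = 1 / (rp - 1) ^ q + 1 / (1 - rm) ^ q"
  define \<Omega> where "\<Omega> = (\<Sum>p<q. \<omega> (- int p - 1))"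
  \<comment> \<open>Collects everything that multiplies \<tau>0 times the size of x in the final
    estimate.\<close>
  define M where "M = \<Omega> * (D * c * K0 + K0)"
  have P: "0 \<le> P" unfolding P_def by (rule wnorm_nonneg[OF subweight_wt])
  have D: "0 \<le> D" using rp_pos by (simp add: D_def)
  have c1: "0 \<le> 1 / (rp - 1) ^ q" "0 \<le> 1 / (1 - rm) ^ q" using rp_gt rm_less by auto
  hence c: "0 \<le> c" by (simp add: c_def)
  have \<Omega>: "0 \<le> \<Omega>" unfolding \<Omega>_def by (intro sum_nonneg) (simp add: wt_pos less_imp_le)
  have M: "0 \<le> M" using \<Omega> D c K0 by (simp add: M_def)
  define \<tau>0 where "\<tau>0 = min \<tau>2 (1 / (2 * (M + 1)))"
  have \<tau>0: "0 < \<tau>0" "\<tau>0 \<le> \<tau>2" "M * \<tau>0 \<le> 1 / 2"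
  proof -
    show "0 < \<tau>0" "\<tau>0 \<le> \<tau>2" using K2 M by (auto simp: \<tau>0_def)
    have "M * \<tau>0 \<le> M * (1 / (2 * (M + 1)))" using M by (intro mult_left_mono) (auto simp: \<tau>0_def)
    also have "\<dots> \<le> 1 / 2" using M by (simp add: field_simps)
    finally show "M * \<tau>0 \<le> 1 / 2" .
  qed
  have main: "(\<Sum>p<length as. cmod (x p)) \<le> 2 * (\<Omega> * D * P * K2) * (\<Sum>i<length as. cmod (vp (int i) - vm (int i)))"
    if w: "\<forall>n. cmod (w n) \<le> \<tau>0"
      and hyps: "\<forall>n. cmod (vp n) \<le> K0 * (\<Sum>p<length as. cmod (x p)) * rp powi n"
      "\<forall>n. cmod (vm n) \<le> K0 * (\<Sum>p<length as. cmod (x p)) * rm powi n"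
      "\<forall>n. symop \<alpha> vp n + w n * vp n = (\<Sum>p<length as. x p * deltaf (- int p - 1) n)"
      "\<forall>n. symop \<alpha> vm n + w n * vm n = (\<Sum>p<length as. x p * deltaf (- int p - 1) n)"
    for w vp vm :: "int \<Rightarrow> complex" and x :: "nat \<Rightarrow> complex"
  proof -
    define X where "X = (\<Sum>p<length as. cmod (x p))"
    define g where "g = (\<lambda>n. \<Sum>p<length as. x p * deltaf (- int p - 1) n)"
    define J where "J = (\<Sum>i<length as. cmod (vp (int i) - vm (int i)))"
    from hyps have vp: "\<And>n. cmod (vp n) \<le> (K0 * X) * rp powi n" and vm: "\<And>n. cmod (vm n) \<le> (K0 * X) * rm powi n"
      and ep: "\<And>n. symop \<alpha> vp n = g n - w n * vp n" and em: "\<And>n. symop \<alpha> vm n = g n - w n * vm n"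
      unfolding X_def[symmetric] g_def by (auto simp: eq_diff_eq)
    have X: "0 \<le> X" by (simp add: X_def sum_nonneg)
    have J: "0 \<le> J" by (simp add: J_def sum_nonneg)
    have KX: "0 \<le> K0 * X" using K0 X by simp
    have vp': "cmod (vp n) \<le> (K0 * X) * \<omega> n" for n
      using vp[of n] mult_left_mono[OF rp_le_wt KX, of n] by simp
    have vm': "cmod (vm n) \<le> (K0 * X) * \<omega> n" for n
      using vm[of n] mult_left_mono[OF rm_le_wt KX, of n] by simp
    have g0: "g n = 0" if "0 \<le> n \<or> n < - int q" for n
      unfolding g_def by (rule sum.neutral) (use that in \<open>auto simp: deltaf_def q_def\<close>)
    have gp: "g (- int p - 1) = x p" if "p < q" for p
    proof -
      have "g (- int p - 1) = (\<Sum>p'<length as. if p' = p then x p' else 0)"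
        unfolding g_def by (rule sum.cong) (auto simp: deltaf_def)
      thus ?thesis using that by (simp add: q_def)
    qed
    have uw: "cmod (vp n - vm n) \<le> K2 * J * \<omega> n" for n
    proof -
      have "cmod (vp m - vm m) \<le> (K0 * X + K0 * X) * \<omega> m" for m
        using norm_triangle_ineq4[of "vp m" "vm m"] vp'[of m] vm'[of m] by (simp add: distrib_right)
      moreover have "symop \<alpha> (\<lambda>n. vp n - vm n) m + w m * (vp m - vm m) = 0" for m
        using symop_diff[OF subweight_wt wsummable_\<alpha> vp' vm', of m] by (simp add: ep em algebra_simps)
      moreover have "cmod (w m) \<le> \<tau>2" for m using w \<tau>0 order_trans by blast
      ultimately show ?thesis using K2'[of w "\<lambda>n. vp n - vm n" "K0 * X + K0 * X" n] by (simp add: J_def)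
    qed
    define yp where "yp = symop \<eta> vp"
    define ym where "ym = symop \<eta> vm"
    have ydiff: "cmod (yp n - ym n) \<le> P * (K2 * J) * \<omega> n" for n
      using symop_bound[OF subweight_wt wsummable_\<eta> uw, of n] symop_diff[OF subweight_wt wsummable_\<eta> vp' vm', of n]
      by (simp add: yp_def ym_def P_def)
    have dp: "dfactors as yp n = g n - w n * vp n" for n
      using dfactors_\<eta>[OF vp'] ep by (simp add: yp_def)
    have dm: "dfactors as ym n = g n - w n * vm n" for n
      using dfactors_\<eta>[OF vm'] em by (simp add: ym_def)
    have wvp: "cmod (w n * vp n) \<le> (\<tau>0 * (K0 * X)) * rp powi n" for n
      using mult_mono[of "cmod (w n)" \<tau>0 "cmod (vp n)" "(K0 * X) * rp powi n"] w vp[of n] \<tau>0 by (simp add: norm_mult mult.assoc)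
    have wvm: "cmod (w n * vm n) \<le> (\<tau>0 * (K0 * X)) * rm powi n" for n
      using mult_mono[of "cmod (w n)" \<tau>0 "cmod (vm n)" "(K0 * X) * rm powi n"] w vm[of n] \<tau>0 by (simp add: norm_mult mult.assoc)
    have TX: "0 \<le> \<tau>0 * (K0 * X)" using KX \<tau>0 by simp
    \<comment> \<open>-1 is the exact limit: below -q the source is zero, and there
      \<open>dfactors\<close> reads entries up to -1 only.\<close>
    have ypb: "cmod (yp n) \<le> \<tau>0 * (K0 * X) / (rp - 1) ^ length as * rp powi n" if "n \<le> - 1" for n
    proof (rule dfactors_decay_left[OF roots TX _ _ that])
      show "cmod (yp n) \<le> wnorm (\<lambda>n. rp powi n) \<eta> * (K0 * X) * rp powi n" for n
        unfolding yp_def by (rule symop_bound[OF subweight_powi[OF rp_pos] wsummable_powi(1)[OF wsummable_\<eta>] vp])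
      show "cmod (dfactors as yp n) \<le> \<tau>0 * (K0 * X) * rp powi n" if "n \<le> - 1 - int (length as)" for n
        using wvp[of n] g0[of n] that by (simp add: dp q_def)
    qed
    have ymb: "cmod (ym n) \<le> \<tau>0 * (K0 * X) / (1 - rm) ^ length as * rm powi n" if "0 \<le> n" for n
    proof (rule dfactors_decay_right[OF roots TX _ _ that])
      show "cmod (ym n) \<le> wnorm (\<lambda>n. rm powi n) \<eta> * (K0 * X) * rm powi n" for n
        unfolding ym_def by (rule symop_bound[OF subweight_powi[OF rm_pos] wsummable_powi(2)[OF wsummable_\<eta>] vm])
      show "cmod (dfactors as ym n) \<le> \<tau>0 * (K0 * X) * rm powi n" if "0 \<le> n" for n
        using wvm[of n] g0[of n] that by (simp add: dm)
    qed
    \<comment> \<open>Up to -1 the sequence \<open>yp\<close> is small by itself; from 0 on it is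
      \<open>ym\<close>, which is small there, plus the difference, which the window
      controls.\<close>
    define B where "B = c * (\<tau>0 * (K0 * X)) + P * (K2 * J)"
    have PKJ: "0 \<le> P * (K2 * J)" using P K2 J by simp
    have yb: "cmod (yp n) \<le> B * \<omega> n" for n
    proof (cases "n \<le> - 1")
      case True
      have "cmod (yp n) \<le> (1 / (rp - 1) ^ q * (\<tau>0 * (K0 * X))) * rp powi n" using ypb[OF True] by (simp add: q_def)
      also have "\<dots> \<le> B * \<omega> n"
        using TX c1 PKJ rp_pos
        by (intro mult_mono rp_le_wt) (auto simp: B_def c_def distrib_right intro!: add_increasing2 mult_nonneg_nonneg)
      finally show ?thesis .
    next
      case False
      have "cmod (ym n) \<le> (1 / (1 - rm) ^ q * (\<tau>0 * (K0 * X))) * rm powi n" using ymb[of n] False by (simp add: q_def)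
      also have "\<dots> \<le> (c * (\<tau>0 * (K0 * X))) * \<omega> n"
      proof (rule mult_mono[OF mult_right_mono[OF _ TX] rm_le_wt mult_nonneg_nonneg[OF c TX]])
        show "1 / (1 - rm) ^ q \<le> c" using c1 by (simp add: c_def)
      qed (use rm_pos in simp)
      finally show ?thesis using norm_triangle_ineq[of "ym n" "yp n - ym n"] ydiff[of n] by (simp add: B_def distrib_right)
    qed
    have xp: "cmod (x p) \<le> (D * B + \<tau>0 * (K0 * X)) * \<omega> (- int p - 1)" if "p < q" for p
    proof -
      let ?n = "- int p - 1"
      have "x p = dfactors as yp ?n + w ?n * vp ?n" using gp[OF that] by (simp add: dp)
      hence "cmod (x p) \<le> cmod (dfactors as yp ?n) + cmod (w ?n * vp ?n)" using norm_triangle_ineq by metis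
      moreover have "cmod (dfactors as yp ?n) \<le> D * B * \<omega> ?n"
        using dfactors_upper[OF roots yb, of ?n] by (simp add: D_def q_def)
      moreover have "cmod (w ?n * vp ?n) \<le> (\<tau>0 * (K0 * X)) * \<omega> ?n"
        using wvp[of ?n] mult_left_mono[OF rp_le_wt TX, of ?n] by linarith
      ultimately show ?thesis by (simp add: distrib_right)
    qed
    have "X = (\<Sum>p<q. cmod (x p))" by (simp add: X_def q_def)
    also have "\<dots> \<le> (\<Sum>p<q. (D * B + \<tau>0 * (K0 * X)) * \<omega> (- int p - 1))"
      by (rule sum_mono) (rule xp, simp)
    also have "\<dots> = (D * B + \<tau>0 * (K0 * X)) * \<Omega>" by (simp only: \<Omega>_def sum_distrib_left)
    \<comment> \<open>The part proportional to X is at most X / 2 and moves to the left-hand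
      side.\<close>
    also have "\<dots> = (M * \<tau>0) * X + (\<Omega> * D * P * K2) * J"
      by (simp add: B_def M_def algebra_simps)
    also have "\<dots> \<le> (1 / 2) * X + (\<Omega> * D * P * K2) * J"
      using mult_right_mono[OF \<tau>0(3) X] by simp
    finally show ?thesis by (simp add: X_def J_def)
  qed
  show ?thesis
    by (rule exI[of _ "2 * (\<Omega> * D * P * K2)"], rule conjI, use \<Omega> D P K2 in simp,
        rule exI[of _ \<tau>0], use \<tau>0 main in blast)
qed

end

section \<open>From the potential to its symbol data\<close>

lemma lcoeff_cong:
  assumes "\<And>z. cmod z = r \<Longrightarrow> f z = g z" "0 \<le> r"
  shows "lcoeff f r = lcoeff g r"
  unfolding lcoeff_def using assms by simp

lemma lcoeff_diff_const:
  assumes "continuous_on {0..1} (\<lambda>x. f (circ 1 x))"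
  shows "lcoeff (\<lambda>z. f z - c) 1 n = lcoeff f 1 n - c * deltaf 0 n"
proof -
  have "(\<lambda>x. f (circ 1 x) * circ 1 x powi (- n)) integrable_on {0..1}"
    by (intro integrable_continuous_real continuous_intros assms continuous_on_circ_powi) simp
  moreover have "(\<lambda>x. c * (1 * circ 1 x powi (- n))) integrable_on {0..1}"
    by (intro integrable_continuous_real continuous_intros assms continuous_on_circ_powi) simp
  ultimately have "integral {0..1} (\<lambda>x. f (circ 1 x) * circ 1 x powi (- n) - c * (1 * circ 1 x powi (- n)))
     = lcoeff f 1 n - integral {0..1} (\<lambda>x. c * (1 * circ 1 x powi (- n)))"
    unfolding lcoeff_def by (rule integral_diff)
  also have "integral {0..1} (\<lambda>x. c * (1 * circ 1 x powi (- n))) = c * lcoeff (\<lambda>z. 1) 1 n"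
    unfolding lcoeff_def by (rule integral_mult_right)
  finally show ?thesis by (simp add: lcoeff_one lcoeff_def[of "\<lambda>z. f z - c"] left_diff_distrib)
qed

text \<open>The coefficients \<alpha> of V - E are the same on all circles of the annulus, but 1 /
  (V - E) may have poles on the unit circle, so its expansions on the two sides differ. Thus
  \<open>bp\<close> and \<open>bm\<close> are two inverses of the same \<alpha>, on sequences of
  different growth; their discrepancy is the source of the center space.\<close>

lemma laurent_symbol_exists:
  fixes V :: "complex \<Rightarrow> complex"
  assumes holo: "V holomorphic_on annulus h"
    and nonconst: "\<not> V constant_on sphere 0 1"
    and radii: "exp (- h) < rm" "rm < 1" "1 < rp" "rp < exp h"
    and zeros: "\<And>z. rm \<le> cmod z \<Longrightarrow> cmod z \<le> rp \<Longrightarrow> V z = E \<Longrightarrow> cmod z = 1"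
  obtains bm bp \<kappa> \<eta> as where
    "laurent_symbol rm rp (\<lambda>n. fourier_coeff V n - E * deltaf 0 n) bm bp \<kappa> \<eta> as" "length as = center_dim V E"
proof (rule symbol_factorization[OF holo nonconst radii zeros])
  fix as \<psi> \<rho>1 \<rho>2
  assume \<rho>: "0 \<le> \<rho>1" "\<rho>1 < rm" "rp < \<rho>2"
    and V: "V holomorphic_on {z. \<rho>1 < cmod z \<and> cmod z < \<rho>2}"
    and \<psi>: "\<psi> holomorphic_on {z. \<rho>1 < cmod z \<and> cmod z < \<rho>2}"
    and \<psi>0: "\<And>z. \<rho>1 < cmod z \<Longrightarrow> cmod z < \<rho>2 \<Longrightarrow> \<psi> z \<noteq> 0"
    and fact: "\<And>z. \<rho>1 < cmod z \<Longrightarrow> cmod z < \<rho>2 \<Longrightarrow> V z - E = prod_list (map (\<lambda>a. z - a) as) * \<psi> z"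
    and len: "length as = center_dim V E" and roots: "\<And>a. a \<in> set as \<Longrightarrow> cmod a = 1"
  define \<phi> where "\<phi> = (\<lambda>z. V z - E)"
  define Q where "Q = (\<lambda>z. prod_list (map (\<lambda>a. z - a) as))"
  have rm0: "0 < rm" using \<rho> by simp
  interpret radii rm rp by unfold_locales (use rm0 radii in auto)
  have \<phi>: "\<phi> holomorphic_on {z. \<rho>1 < cmod z \<and> cmod z < \<rho>2}" unfolding \<phi>_def by (intro holomorphic_intros V)
  have Qh: "Q holomorphic_on A" for A unfolding Q_def by (induction as) (auto intro!: holomorphic_intros)
  have Q0: "Q z \<noteq> 0" if "cmod z \<noteq> 1" for z
    using roots that unfolding Q_def by (auto simp: prod_list_zero_iff)
  have \<phi>0: "\<phi> z \<noteq> 0" if "\<rho>1 < cmod z" "cmod z < \<rho>2" "cmod z \<noteq> 1" for z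
    using fact[OF that(1,2)] \<psi>0[OF that(1,2)] Q0[OF that(3)] by (simp add: \<phi>_def Q_def)
  let ?A = "{z. \<rho>1 < cmod z \<and> cmod z < \<rho>2}" and ?Ap = "{z. 1 < cmod z \<and> cmod z < \<rho>2}" and ?Am = "{z. \<rho>1 < cmod z \<and> cmod z < 1}"
  have i\<psi>: "(\<lambda>z. 1 / \<psi> z) holomorphic_on ?A" by (intro holomorphic_intros \<psi>) (use \<psi>0 in auto)
  have \<phi>p: "\<phi> holomorphic_on ?Ap" by (rule holomorphic_on_subset[OF \<phi>]) (use \<rho> radii in auto)
  have \<phi>m: "\<phi> holomorphic_on ?Am" by (rule holomorphic_on_subset[OF \<phi>]) (use \<rho> radii in auto)
  have ip: "(\<lambda>z. 1 / \<phi> z) holomorphic_on ?Ap" by (intro holomorphic_intros \<phi>p) (use \<phi>0 \<rho> radii in auto)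
  have im: "(\<lambda>z. 1 / \<phi> z) holomorphic_on ?Am" by (intro holomorphic_intros \<phi>m) (use \<phi>0 \<rho> radii in auto)
  define \<alpha> where "\<alpha> = lcoeff \<phi> 1"
  have \<alpha>eq: "\<alpha> = (\<lambda>n. fourier_coeff V n - E * deltaf 0 n)"
  proof
    have "continuous_on {0..1} (\<lambda>x. V (circ 1 x))"
      by (rule continuous_on_holo_circ[OF V]) (use \<rho> radii in auto)
    thus "\<alpha> n = fourier_coeff V n - E * deltaf 0 n" for n
      unfolding \<alpha>_def \<phi>_def fourier_coeff_lcoeff by (rule lcoeff_diff_const)
  qed
  have \<alpha>p: "\<alpha> = lcoeff \<phi> rp" and \<alpha>m: "\<alpha> = lcoeff \<phi> rm"
    unfolding \<alpha>_def using \<rho> radii by (auto intro!: ext lcoeff_radius[OF \<phi>])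
  define bp where "bp = lcoeff (\<lambda>z. 1 / \<phi> z) rp"
  define bm where "bm = lcoeff (\<lambda>z. 1 / \<phi> z) rm"
  define \<kappa> where "\<kappa> = lcoeff (\<lambda>z. 1 / \<psi> z) 1"
  define \<eta> where "\<eta> = lcoeff \<psi> 1"
  have ws: "wsummable \<omega> (lcoeff f 1)" if "f holomorphic_on ?A" for f
    unfolding wt_def[abs_def] by (rule lcoeff_wsummable[OF that]) (use \<rho> radii in auto)
  have ws\<kappa>: "wsummable \<omega> \<kappa>" and ws\<eta>: "wsummable \<omega> \<eta>" and ws\<alpha>: "wsummable \<omega> \<alpha>"
    using ws[OF i\<psi>] ws[OF \<psi>] ws[OF \<phi>] by (simp_all add: \<kappa>_def \<eta>_def \<alpha>_def)
  have wsQ: "wsummable \<omega> (lcoeff Q 1)" by (rule ws[OF Qh])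
  have dQ: "symop (lcoeff Q 1) u = dfactors as u" if "\<And>n. cmod (u n) \<le> C * \<omega> n" for u C
    unfolding Q_def by (rule symop_lcoeff_dfactors[of rm rp _ _ C]) (use that rm0 radii in \<open>auto simp: wt_def\<close>)
  have "laurent_symbol rm rp \<alpha> bm bp \<kappa> \<eta> as"
  proof unfold_locales
    show "wsummable \<omega> \<alpha>" "wsummable \<omega> \<kappa>" "wsummable \<omega> \<eta>" by fact+
    show "wsummable (\<lambda>n. rp powi n) bp" unfolding bp_def
      by (rule lcoeff_wsummable_powi[OF ip]) (use \<rho> radii in auto)
    show "wsummable (\<lambda>n. rm powi n) bm" unfolding bm_def
      by (rule lcoeff_wsummable_powi[OF im]) (use \<rho> radii in auto)
    have "symprod \<alpha> bp = lcoeff (\<lambda>z. \<phi> z * (1 / \<phi> z)) rp"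
      unfolding \<alpha>p bp_def by (rule lcoeff_mult[OF \<phi>p ip]) (use \<rho> radii in auto)
    also have "\<dots> = lcoeff (\<lambda>z. 1) rp" by (rule lcoeff_cong) (use \<phi>0 \<rho> radii in auto)
    finally show "symprod \<alpha> bp = deltaf 0" using rp_pos by (simp add: lcoeff_one)
    have "symprod bp \<alpha> = lcoeff (\<lambda>z. (1 / \<phi> z) * \<phi> z) rp"
      unfolding \<alpha>p bp_def by (rule lcoeff_mult[OF ip \<phi>p]) (use \<rho> radii in auto)
    also have "\<dots> = lcoeff (\<lambda>z. 1) rp" by (rule lcoeff_cong) (use \<phi>0 \<rho> radii in auto)
    finally show "symprod bp \<alpha> = deltaf 0" using rp_pos by (simp add: lcoeff_one)
    have "symprod \<alpha> bm = lcoeff (\<lambda>z. \<phi> z * (1 / \<phi> z)) rm"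
      unfolding \<alpha>m bm_def by (rule lcoeff_mult[OF \<phi>m im]) (use \<rho> radii in auto)
    also have "\<dots> = lcoeff (\<lambda>z. 1) rm" by (rule lcoeff_cong) (use \<phi>0 \<rho> radii in auto)
    finally show "symprod \<alpha> bm = deltaf 0" using rm_pos by (simp add: lcoeff_one)
    have "symprod bm \<alpha> = lcoeff (\<lambda>z. (1 / \<phi> z) * \<phi> z) rm"
      unfolding \<alpha>m bm_def by (rule lcoeff_mult[OF im \<phi>m]) (use \<rho> radii in auto)
    also have "\<dots> = lcoeff (\<lambda>z. 1) rm" by (rule lcoeff_cong) (use \<phi>0 \<rho> radii in auto)
    finally show "symprod bm \<alpha> = deltaf 0" using rm_pos by (simp add: lcoeff_one)
    show "\<forall>a\<in>set as. cmod a = 1" using roots by blast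
    fix u :: "int \<Rightarrow> complex" and C assume u: "\<And>n. cmod (u n) \<le> C * \<omega> n"
    have "symop \<kappa> (symop \<alpha> u) = symop (symprod \<kappa> \<alpha>) u" by (rule symop_symop[OF subweight_wt ws\<kappa> ws\<alpha> u])
    also have "symprod \<kappa> \<alpha> = lcoeff (\<lambda>z. (1 / \<psi> z) * \<phi> z) 1"
      unfolding \<kappa>_def \<alpha>_def by (rule lcoeff_mult[OF i\<psi> \<phi>]) (use \<rho> radii in auto)
    also have "\<dots> = lcoeff Q 1"
      by (rule lcoeff_cong) (use \<psi>0 fact \<rho> radii in \<open>auto simp: \<phi>_def Q_def\<close>)
    finally show "symop \<kappa> (symop \<alpha> u) = dfactors as u" using dQ[OF u] by simp
    have "dfactors as (symop \<eta> u) = symop (lcoeff Q 1) (symop \<eta> u)"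
      by (rule dQ[symmetric, OF symop_bound[OF subweight_wt ws\<eta> u]])
    also have "\<dots> = symop (symprod (lcoeff Q 1) \<eta>) u" by (rule symop_symop[OF subweight_wt wsQ ws\<eta> u])
    also have "symprod (lcoeff Q 1) \<eta> = lcoeff (\<lambda>z. Q z * \<psi> z) 1"
      unfolding \<eta>_def by (rule lcoeff_mult[OF Qh \<psi>]) (use \<rho> radii in auto)
    also have "\<dots> = \<alpha>" unfolding \<alpha>_def
      by (rule lcoeff_cong) (use fact \<rho> radii in \<open>auto simp: \<phi>_def Q_def\<close>)
    finally show "dfactors as (symop \<eta> u) = symop \<alpha> u" .
  qed
  thus ?thesis using that[of bm bp \<kappa> \<eta> as] len by (simp add: \<alpha>eq)
qed

section \<open>Orbits of a homeomorphism\<close>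

lemma ziter_0 [simp]: "ziter T 0 \<theta> = \<theta>"
  by (simp add: ziter_def)

lemma ziter_nat: "ziter T (int n) \<theta> = (T ^^ n) \<theta>"
  by (simp add: ziter_def)

lemma ziter_1 [simp]: "ziter T 1 \<theta> = T \<theta>"
  using ziter_nat[of T 1] by simp

lemma ziter_Suc:
  assumes "bij T"
  shows "ziter T (n + 1) \<theta> = T (ziter T n \<theta>)"
proof (cases "0 \<le> n")
  case True
  thus ?thesis by (simp add: ziter_def nat_add_distrib)
next
  case False
  then obtain k where n: "n = - int (Suc k)"
    using negD by force
  have "T (inv_into UNIV T x) = x" for x using assms by (simp add: bij_is_surj surj_f_inv_f)
  moreover have "nat (- n) = Suc k" "nat (- (n + 1)) = k" "\<not> 0 \<le> n" using n by auto
  moreover have "ziter T (n + 1) \<theta> = (inv_into UNIV T ^^ k) \<theta>"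
    using n by (cases "k = 0") (auto simp: ziter_def)
  ultimately show ?thesis by (simp add: ziter_def)
qed

lemma ziter_add:
  assumes "bij T"
  shows "ziter T (m + n) \<theta> = ziter T m (ziter T n \<theta>)"
proof (induction m rule: int_induct[where k = 0])
  case base show ?case by simp
next
  case (step1 i)
  thus ?case using ziter_Suc[OF assms, of "i + n" \<theta>] ziter_Suc[OF assms, of i "ziter T n \<theta>"] by (simp add: add_ac)
next
  case (step2 i)
  have "T (ziter T (i - 1 + n) \<theta>) = T (ziter T (i - 1) (ziter T n \<theta>))"
    using step2 ziter_Suc[OF assms, of "i - 1 + n" \<theta>] ziter_Suc[OF assms, of "i - 1" "ziter T n \<theta>"] by (simp add: add_ac)
  thus ?case using assms by (meson bij_is_inj injD)
qed

lemma continuous_on_ziter: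
  assumes "homeomorphism UNIV UNIV T (inv_into UNIV T)"
  shows "continuous_on UNIV (ziter T n)"
proof -
  have *: "continuous_on UNIV (f ^^ k)" if "continuous_on UNIV f" for f :: "'a \<Rightarrow> 'a" and k
  proof (induction k)
    case 0 show ?case by (simp add: id_def continuous_on_id)
  next
    case (Suc k)
    thus ?case using continuous_on_compose[OF Suc, of f] continuous_on_subset[OF that] by simp
  qed
  have "continuous_on UNIV T" "continuous_on UNIV (inv_into UNIV T)"
    using assms by (auto simp: homeomorphism_def)
  thus ?thesis using * by (cases "0 \<le> n") (auto simp: ziter_def[abs_def])
qed

lemma homeomorphism_bij: "homeomorphism UNIV UNIV T g \<Longrightarrow> bij T"
  by (metis UNIV_I bijI' homeomorphism_def)

lemma continuous_on_infsum:
  fixes f :: "'j \<Rightarrow> 'b::topological_space \<Rightarrow> 'c::banach"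
  assumes "\<And>j. continuous_on A (f j)" "\<And>j x. x \<in> A \<Longrightarrow> norm (f j x) \<le> M j" "M summable_on UNIV"
  shows "continuous_on A (\<lambda>x. \<Sum>\<^sub>\<infinity>j. f j x)"
proof (rule uniform_limit_theorem)
  show "uniform_limit A (\<lambda>Y x. \<Sum>j\<in>Y. f j x) (\<lambda>x. \<Sum>\<^sub>\<infinity>j. f j x) (finite_subsets_at_top UNIV)"
    by (rule Weierstrass_m_test_general) (use assms in auto)
  show "\<forall>\<^sub>F Y in finite_subsets_at_top UNIV. continuous_on A (\<lambda>x. \<Sum>j\<in>Y. f j x)"
    by (intro always_eventually allI continuous_on_sum assms)
qed simp

section \<open>Green's function on a circle\<close>

text \<open>On the space of sequences of growth \<open>r powi n\<close> the operator with symbol \<open>a\<close> has the inverse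
  with symbol \<open>b\<close>; the potential \<open>w\<close> along the orbits of \<open>T\<close> is small enough for a Neumann series.\<close>

locale green =
  fixes r :: real and a b :: "int \<Rightarrow> complex" and T :: "'a::metric_space \<Rightarrow> 'a" and w :: "'a \<Rightarrow> complex" and \<tau> :: real
  assumes r: "0 < r"
    and wsummable_a: "wsummable (\<lambda>n. r powi n) a" and wsummable_b: "wsummable (\<lambda>n. r powi n) b"
    and inverse_ab: "symprod a b = deltaf 0" "symprod b a = deltaf 0"
    and homeo: "homeomorphism UNIV UNIV T (inv_into UNIV T)"
    and w_cont: "continuous_on UNIV w" and w_bound: "\<And>\<theta>. cmod (w \<theta>) \<le> \<tau>"
    and small: "\<tau> * wnorm (\<lambda>n. r powi n) b \<le> 1 / 2"
begin

abbreviation "\<beta> \<equiv> wnorm (\<lambda>n. r powi n) b"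

lemma sw: "subweight (\<lambda>n. r powi n)" by (rule subweight_powi[OF r])

lemma bij: "bij T" by (rule homeomorphism_bij[OF homeo])

lemma \<tau>_nonneg: "0 \<le> \<tau>" using w_bound norm_ge_zero order_trans by blast

lemma \<beta>_nonneg: "0 \<le> \<beta>" by (rule wnorm_nonneg[OF sw])

text \<open>Terms of the right-hand side of g = b (1 - w g), which is D g = 1 after inverting the
  unperturbed symbol. The second argument is the position on the circle, so that a single fixed
  point treats all z of modulus r and is jointly continuous.\<close>

definition resolvent_term :: "('a \<times> real \<Rightarrow> complex) \<Rightarrow> int \<Rightarrow> 'a \<times> real \<Rightarrow> complex" where
  "resolvent_term f j p = b j * circ r (snd p) powi j * (1 - w (ziter T j (fst p)) * f (ziter T j (fst p), snd p))"

lemma resolvent_term_cont: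
  assumes "continuous_on UNIV f"
  shows "continuous_on UNIV (resolvent_term f j)"
proof -
  have z: "continuous_on UNIV (\<lambda>p::'a \<times> real. ziter T j (fst p))"
    by (rule continuous_on_compose2[OF continuous_on_ziter[OF homeo]]) (auto intro: continuous_intros)
  have "continuous_on UNIV (\<lambda>p::'a \<times> real. circ r (snd p) powi j)"
    by (intro continuous_on_power_int continuous_intros) (use r in auto)
  moreover have "continuous_on UNIV (\<lambda>p::'a \<times> real. w (ziter T j (fst p)))"
    by (rule continuous_on_compose2[OF w_cont z]) auto
  moreover have "continuous_on UNIV (\<lambda>p::'a \<times> real. f (ziter T j (fst p), snd p))"
    by (rule continuous_on_compose2[OF assms]) (auto intro!: continuous_intros z)
  ultimately show ?thesis unfolding resolvent_term_def[abs_def]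
    by (intro continuous_on_mult continuous_on_diff continuous_on_const)
qed

lemma resolvent_term_bound:
  assumes "\<And>p. cmod (f p) \<le> B"
  shows "cmod (resolvent_term f j p) \<le> (1 + \<tau> * B) * (cmod (b j) * r powi j)"
proof -
  have "cmod (w \<theta> * f p) \<le> \<tau> * B" for \<theta> p
    unfolding norm_mult by (rule mult_mono[OF w_bound assms \<tau>_nonneg]) simp
  hence "cmod (1 - w (ziter T j (fst p)) * f (ziter T j (fst p), snd p)) \<le> 1 + \<tau> * B"
    using norm_triangle_ineq4[THEN order_trans] by (metis (no_types, lifting) add_left_mono norm_one)
  hence "cmod (b j) * r powi j * cmod (1 - w (ziter T j (fst p)) * f (ziter T j (fst p), snd p)) \<le> cmod (b j) * r powi j * (1 + \<tau> * B)"
    using r by (intro mult_left_mono) auto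
  thus ?thesis using r by (simp add: resolvent_term_def norm_mult norm_power_int mult_ac)
qed

lemma b_summable: "(\<lambda>j. c * (cmod (b j) * r powi j)) summable_on UNIV"
  using wsummable_b unfolding wsummable_def by (rule summable_on_cmult_right)

lemma resolvent_term_summable:
  assumes "\<And>p. cmod (f p) \<le> B"
  shows "(\<lambda>j. resolvent_term f j p) summable_on UNIV"
  by (rule abs_summable_summable[OF Infinite_Sum.abs_summable_on_comparison_test'[OF b_summable]])
     (rule resolvent_term_bound[OF assms])

lemma resolvent_sum_bound:
  assumes "\<And>p. cmod (f p) \<le> B"
  shows "cmod (\<Sum>\<^sub>\<infinity>j. resolvent_term f j p) \<le> (1 + \<tau> * B) * \<beta>"
proof (rule norm_infsum_le)
  show "((\<lambda>j. resolvent_term f j p) has_sum (\<Sum>\<^sub>\<infinity>j. resolvent_term f j p)) UNIV"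
    by (rule has_sum_infsum[OF resolvent_term_summable[OF assms]])
  show "((\<lambda>j. (1 + \<tau> * B) * (cmod (b j) * r powi j)) has_sum (1 + \<tau> * B) * \<beta>) UNIV"
    using wsummable_b unfolding wnorm_def wsummable_def by (intro has_sum_cmult_right has_sum_infsum)
qed (rule resolvent_term_bound[OF assms])

text \<open>Banach's fixed point theorem with contraction constant 1/2 on the bounded continuous
  functions of base point and circle parameter. The bound \<open>2 * \<beta>\<close> comes from the
  norm N satisfying \<open>N \<le> (1 + \<tau> * N) * \<beta>\<close> with
  \<open>\<tau> * \<beta> \<le> 1 / 2\<close>.\<close>

lemma resolvent_exists:
  "\<exists>G. continuous_on UNIV G \<and> (\<forall>p. cmod (G p) \<le> 2 * \<beta>) \<and> (\<forall>p. G p = (\<Sum>\<^sub>\<infinity>j. resolvent_term G j p))"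
proof -
  define \<Phi> :: "(('a \<times> real) \<Rightarrow>\<^sub>C complex) \<Rightarrow> (('a \<times> real) \<Rightarrow>\<^sub>C complex)" where
    "\<Phi> F = Bcontfun (\<lambda>p. \<Sum>\<^sub>\<infinity>j. resolvent_term (apply_bcontfun F) j p)" for F
  have bd: "cmod (apply_bcontfun F p) \<le> norm F" for F :: "('a \<times> real) \<Rightarrow>\<^sub>C complex" and p
    by (rule norm_bounded)
  have \<Phi>: "apply_bcontfun (\<Phi> F) p = (\<Sum>\<^sub>\<infinity>j. resolvent_term (apply_bcontfun F) j p)" for F p
  proof -
    have "(\<lambda>p. \<Sum>\<^sub>\<infinity>j. resolvent_term (apply_bcontfun F) j p) \<in> bcontfun"
    proof (rule bcontfun_normI)
      show "continuous_on UNIV (\<lambda>p. \<Sum>\<^sub>\<infinity>j. resolvent_term (apply_bcontfun F) j p)"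
        by (rule continuous_on_infsum[OF resolvent_term_cont resolvent_term_bound[OF bd] b_summable]) simp
    qed (rule resolvent_sum_bound[OF bd])
    thus ?thesis by (simp add: \<Phi>_def Bcontfun_inverse)
  qed
  have "\<exists>!F. \<Phi> F = F"
  proof (rule banach_fix_type)
    show "\<forall>F F'. dist (\<Phi> F) (\<Phi> F') \<le> (1/2) * dist F F'"
    proof (intro allI dist_bound)
      fix F F' :: "('a \<times> real) \<Rightarrow>\<^sub>C complex" and p
      have t: "cmod (resolvent_term (apply_bcontfun F) j p - resolvent_term (apply_bcontfun F') j p)
          \<le> (\<tau> * dist F F') * (cmod (b j) * r powi j)" for j
      proof -
        let ?y = "(ziter T j (fst p), snd p)"
        have "resolvent_term (apply_bcontfun F) j p - resolvent_term (apply_bcontfun F') j p =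
          b j * circ r (snd p) powi j * (w (ziter T j (fst p)) * (apply_bcontfun F' ?y - apply_bcontfun F ?y))"
          by (simp add: resolvent_term_def algebra_simps)
        moreover have "cmod (apply_bcontfun F' ?y - apply_bcontfun F ?y) \<le> dist F F'"
          by (metis dist_bounded dist_commute dist_complex_def)
        hence "cmod (w (ziter T j (fst p)) * (apply_bcontfun F' ?y - apply_bcontfun F ?y)) \<le> \<tau> * dist F F'"
          unfolding norm_mult by (rule mult_mono[OF w_bound _ \<tau>_nonneg]) simp
        hence "(cmod (b j) * r powi j) * cmod (w (ziter T j (fst p)) * (apply_bcontfun F' ?y - apply_bcontfun F ?y))
            \<le> (cmod (b j) * r powi j) * (\<tau> * dist F F')"
          using r by (intro mult_left_mono) auto
        ultimately show ?thesis using r by (simp add: norm_mult norm_power_int mult_ac)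
      qed
      have "dist (apply_bcontfun (\<Phi> F) p) (apply_bcontfun (\<Phi> F') p) \<le> (\<tau> * dist F F') * \<beta>"
        unfolding \<Phi> dist_complex_def
      proof (rule norm_infsum_le)
        show "((\<lambda>j. resolvent_term (apply_bcontfun F) j p - resolvent_term (apply_bcontfun F') j p) has_sum
          (\<Sum>\<^sub>\<infinity>j. resolvent_term (apply_bcontfun F) j p) - (\<Sum>\<^sub>\<infinity>j. resolvent_term (apply_bcontfun F') j p)) UNIV"
          by (intro has_sum_subtract has_sum_infsum resolvent_term_summable[OF bd])
        show "((\<lambda>j. (\<tau> * dist F F') * (cmod (b j) * r powi j)) has_sum (\<tau> * dist F F') * \<beta>) UNIV"
          using wsummable_b unfolding wnorm_def wsummable_def by (intro has_sum_cmult_right has_sum_infsum)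
      qed (rule t)
      also have "\<dots> \<le> (1/2) * dist F F'"
        using mult_right_mono[OF small, of "dist F F'"] by (simp add: mult_ac)
      finally show "dist (apply_bcontfun (\<Phi> F) p) (apply_bcontfun (\<Phi> F') p) \<le> (1/2) * dist F F'" .
    qed
  qed auto
  then obtain F where F: "\<Phi> F = F" by blast
  have Fp: "apply_bcontfun F p = (\<Sum>\<^sub>\<infinity>j. resolvent_term (apply_bcontfun F) j p)" for p
    using \<Phi>[of F p] unfolding F .
  have "norm F \<le> (1 + \<tau> * norm F) * \<beta>"
  proof (rule norm_bound)
    show "cmod (apply_bcontfun F p) \<le> (1 + \<tau> * norm F) * \<beta>" for p
      unfolding Fp[of p] by (rule resolvent_sum_bound[OF bd])
  qed
  hence "norm F \<le> 2 * \<beta>" using mult_right_mono[OF small, of "norm F"] by (simp add: algebra_simps)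
  hence "cmod (apply_bcontfun F p) \<le> 2 * \<beta>" for p using bd[of F p] by linarith
  thus ?thesis using Fp continuous_on_apply_bcontfun[of UNIV F] by blast
qed

text \<open>The function g(z, \<theta>) of the center construction at z = \<open>circ r t\<close>;
  the identification is \<open>g_fun_eq_G\<close>.\<close>

definition G :: "'a \<times> real \<Rightarrow> complex" where
  "G = (SOME G. continuous_on UNIV G \<and> (\<forall>p. cmod (G p) \<le> 2 * \<beta>) \<and> (\<forall>p. G p = (\<Sum>\<^sub>\<infinity>j. resolvent_term G j p)))"

lemma G_cont: "continuous_on UNIV G" and G_bound: "cmod (G p) \<le> 2 * \<beta>"
  and G_fix: "G p = (\<Sum>\<^sub>\<infinity>j. resolvent_term G j p)"
  using someI_ex[OF resolvent_exists] unfolding G_def[symmetric] by blast+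

lemma G_orbit_bound: "cmod (circ r t powi n * G p) \<le> 2 * \<beta> * r powi n"
  using mult_right_mono[OF G_bound, of "r powi n" p] r by (simp add: norm_mult norm_power_int mult_ac)

text \<open>Sampled along an orbit, the fixed point equation says u = b v with v = z^n - w u;
  applying a undoes b.\<close>

lemma G_orbit:
  "symop a (\<lambda>n. circ r t powi n * G (ziter T n \<theta>, t)) n + w (ziter T n \<theta>) * (circ r t powi n * G (ziter T n \<theta>, t)) = circ r t powi n"
proof -
  define u where "u = (\<lambda>n. circ r t powi n * G (ziter T n \<theta>, t))"
  define v where "v = (\<lambda>n. circ r t powi n - w (ziter T n \<theta>) * u n)"
  have "u n = symop b v n" for n
  proof -
    have "u n = (\<Sum>\<^sub>\<infinity>j. circ r t powi n * resolvent_term G j (ziter T n \<theta>, t))"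
      unfolding u_def by (subst G_fix) (simp add: infsum_cmult_right')
    also have "\<dots> = symop b v n"
      unfolding symop_def
    proof (rule infsum_cong)
      fix j
      have "circ r t powi (n + j) = circ r t powi n * circ r t powi j" using r by (simp add: power_int_add)
      moreover have "ziter T (n + j) \<theta> = ziter T j (ziter T n \<theta>)" using ziter_add[OF bij, of j n] by (simp add: add.commute)
      ultimately show "circ r t powi n * resolvent_term G j (ziter T n \<theta>, t) = b j * v (n + j)"
        by (simp add: resolvent_term_def v_def u_def algebra_simps)
    qed
    finally show ?thesis .
  qed
  hence ub: "u = symop b v" by blast
  have vb: "cmod (v n) \<le> (1 + \<tau> * (2 * \<beta>)) * r powi n" for n
  proof -
    have "cmod (w (ziter T n \<theta>)) * cmod (u n) \<le> \<tau> * (2 * \<beta> * r powi n)"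
      unfolding u_def by (rule mult_mono[OF w_bound G_orbit_bound \<tau>_nonneg]) simp
    thus ?thesis using norm_triangle_ineq4[of "circ r t powi n" "w (ziter T n \<theta>) * u n"] r
      by (simp add: v_def norm_mult norm_power_int algebra_simps)
  qed
  have "symop a u = v"
    using symop_symop[OF sw wsummable_a wsummable_b vb] inverse_ab ub by simp
  thus ?thesis by (simp add: u_def v_def fun_eq_iff)
qed

lemma orbit_transfer:
  "symop a (\<lambda>n. circ r t powi n * f (ziter T n \<theta>)) n =
     circ r t powi n * symop a (\<lambda>k. circ r t powi k * f (ziter T k (ziter T n \<theta>))) 0"
proof -
  have eq: "a k * (circ r t powi (n + k) * f (ziter T (n + k) \<theta>)) =
      circ r t powi n * (a k * (circ r t powi (0 + k) * f (ziter T (0 + k) (ziter T n \<theta>))))" for k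
    using ziter_add[OF bij, of k n \<theta>] r by (simp add: power_int_add add.commute)
  show ?thesis unfolding symop_def infsum_cmult_right'[symmetric] by (rule infsum_cong) (rule eq)
qed

text \<open>Along an orbit the difference of two bounded solutions has growth
  \<open>r powi n\<close> and solves the homogeneous equation, so
  \<open>kernel_trivial_of_inverse\<close> applies.\<close>

lemma G_unique:
  assumes "\<And>\<theta>. cmod (f \<theta>) \<le> B"
    and "\<And>\<theta>. symop a (\<lambda>n. circ r t powi n * f (ziter T n \<theta>)) 0 + w \<theta> * f \<theta> = 1"
  shows "f \<theta> = G (\<theta>, t)"
proof -
  let ?u = "\<lambda>n. circ r t powi n * f (ziter T n \<theta>)" and ?v = "\<lambda>n. circ r t powi n * G (ziter T n \<theta>, t)"
  have ub: "cmod (?u n) \<le> B * r powi n" for n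
    using mult_right_mono[OF assms(1), of "r powi n"] r by (simp add: norm_mult norm_power_int mult_ac)
  have eu: "symop a ?u n + w (ziter T n \<theta>) * ?u n = circ r t powi n" for n
  proof -
    have "symop a ?u n + w (ziter T n \<theta>) * ?u n = circ r t powi n *
      (symop a (\<lambda>k. circ r t powi k * f (ziter T k (ziter T n \<theta>))) 0 + w (ziter T n \<theta>) * f (ziter T n \<theta>))"
      by (subst orbit_transfer) (simp add: algebra_simps)
    thus ?thesis using assms(2) by simp
  qed
  have vb: "cmod (?v n) \<le> 2 * \<beta> * r powi n" for n by (rule G_orbit_bound)
  have "?u n - ?v n = 0" for n
  proof (rule kernel_trivial_of_inverse[OF r wsummable_a wsummable_b inverse_ab(2), of "\<lambda>n. w (ziter T n \<theta>)" \<tau>])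
    show "\<tau> * \<beta> < 1" using small by simp
    show "cmod (?u n - ?v n) \<le> (B + 2 * \<beta>) * r powi n" for n
      using norm_triangle_ineq4[of "?u n" "?v n"] ub[of n] G_orbit_bound[of t n "(ziter T n \<theta>, t)"] by (simp add: distrib_right)
    show "symop a (\<lambda>n. ?u n - ?v n) n + w (ziter T n \<theta>) * (?u n - ?v n) = 0" for n
    proof -
      have "symop a (\<lambda>n. ?u n - ?v n) n + w (ziter T n \<theta>) * (?u n - ?v n) =
        (symop a ?u n + w (ziter T n \<theta>) * ?u n) - (symop a ?v n + w (ziter T n \<theta>) * ?v n)"
        unfolding symop_diff[OF sw wsummable_a ub vb, of n] by (simp only: right_diff_distrib add_diff_add)
      thus ?thesis unfolding eu G_orbit by simp
    qed
  qed (rule w_bound)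
  from this[of 0] show ?thesis by simp
qed

text \<open>The contour integral of \<open>z powi (n + p)\<close> times g over the circle, divided
  by 2 pi i; the extra power comes from dz. As a sequence in n it is a column of the Green's
  function on sequences of growth \<open>r powi n\<close>.\<close>

definition H :: "int \<Rightarrow> 'a \<Rightarrow> int \<Rightarrow> complex" where
  "H p \<theta> n = integral {0..1} (\<lambda>t. circ r t powi (n + p + 1) * G (ziter T n \<theta>, t))"

lemma G_slice_cont: "continuous_on A (\<lambda>t. G (\<theta>, t))"
  by (rule continuous_on_compose2[OF G_cont]) (auto intro!: continuous_intros)

lemma H_bound: "cmod (H p \<theta> n) \<le> 2 * \<beta> * r powi (p + 1) * r powi n"
proof -
  have "norm (H p \<theta> n) \<le> (2 * \<beta> * r powi (n + p + 1)) * (1 - 0)"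
    unfolding H_def
    by (rule integral_bound) (auto intro!: continuous_intros continuous_on_circ_powi r G_slice_cont G_orbit_bound)
  thus ?thesis using r by (simp add: power_int_add mult_ac)
qed

text \<open>Integrate \<open>G_orbit\<close>, multiplied by \<open>z powi (p + 1)\<close>, over the
  circle. Only the power with exponent 0 has a nonzero integral, which puts the unit source at - p -
  1.\<close>

lemma H_eq: "symop a (H p \<theta>) n + w (ziter T n \<theta>) * H p \<theta> n = deltaf (- p - 1) n"
proof -
  let ?f = "\<lambda>k t. a k * (circ r t powi (n + k + p + 1) * G (ziter T (n + k) \<theta>, t))"
  let ?h = "\<lambda>t. circ r t powi (n + p + 1) * G (ziter T n \<theta>, t)"
  have c: "continuous_on {0..1} (\<lambda>t. circ r t powi m * G (ziter T k \<theta>, t))" for m k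
    by (intro continuous_intros continuous_on_circ_powi r G_slice_cont)
  have Mb: "cmod (?f k t) \<le> (2 * \<beta> * r powi (n + p + 1)) * (cmod (a k) * r powi k)" for k t
  proof -
    have "r powi (n + k + p + 1) = r powi (n + p + 1) * r powi k" using r by (simp flip: power_int_add add: add_ac)
    thus ?thesis
      using mult_left_mono[OF G_orbit_bound[of t "n + k + p + 1" "(ziter T (n + k) \<theta>, t)"], of "cmod (a k)"]
      by (simp add: norm_mult mult_ac)
  qed
  have Ms: "(\<lambda>k. (2 * \<beta> * r powi (n + p + 1)) * (cmod (a k) * r powi k)) summable_on UNIV"
    using wsummable_a unfolding wsummable_def by (rule summable_on_cmult_right)
  have cf: "continuous_on {0..1} (?f k)" for k by (intro continuous_intros c)
  have "((\<lambda>k. integral {0..1} (?f k)) has_sum integral {0..1} (\<lambda>t. \<Sum>\<^sub>\<infinity>k. ?f k t)) UNIV"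
    by (rule integral_has_sum[OF cf Mb Ms])
  hence "symop a (H p \<theta>) n = integral {0..1} (\<lambda>t. \<Sum>\<^sub>\<infinity>k. ?f k t)"
    unfolding symop_def H_def by (simp add: infsumI add_ac)
  moreover have "(\<lambda>t. \<Sum>\<^sub>\<infinity>k. ?f k t) integrable_on {0..1}"
    by (intro integrable_continuous_real continuous_on_infsum[OF cf Mb Ms])
  moreover have "w (ziter T n \<theta>) * H p \<theta> n = integral {0..1} (\<lambda>t. w (ziter T n \<theta>) * ?h t)"
    unfolding H_def by simp
  moreover have "(\<lambda>t. w (ziter T n \<theta>) * ?h t) integrable_on {0..1}"
    by (intro integrable_continuous_real continuous_intros c)
  ultimately have "symop a (H p \<theta>) n + w (ziter T n \<theta>) * H p \<theta> n =
     integral {0..1} (\<lambda>t. (\<Sum>\<^sub>\<infinity>k. ?f k t) + w (ziter T n \<theta>) * ?h t)"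
    by (simp add: integral_add)
  also have "\<dots> = integral {0..1} (\<lambda>t. circ r t powi (n + p + 1))"
  proof (rule integral_cong)
    fix t
    have pw: "circ r t powi (m + p + 1) = circ r t powi (p + 1) * circ r t powi m" for m
      using r by (simp flip: power_int_add add: add_ac)
    have "(\<Sum>\<^sub>\<infinity>k. ?f k t) + w (ziter T n \<theta>) * ?h t = circ r t powi (p + 1) *
      (symop a (\<lambda>n. circ r t powi n * G (ziter T n \<theta>, t)) n + w (ziter T n \<theta>) * (circ r t powi n * G (ziter T n \<theta>, t)))"
      unfolding symop_def pw distrib_left infsum_cmult_right'[symmetric] by (simp add: mult_ac)
    thus "(\<Sum>\<^sub>\<infinity>k. ?f k t) + w (ziter T n \<theta>) * ?h t = circ r t powi (n + p + 1)"
      unfolding G_orbit pw by simp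
  qed
  also have "\<dots> = deltaf (- p - 1) n"
    using integral_circ_powi[OF r, of "n + p + 1"] by (cases "n + p + 1 = 0") (auto simp: deltaf_def)
  finally show ?thesis .
qed

lemma H_cont: "continuous_on UNIV (\<lambda>\<theta>. H p \<theta> n)"
proof -
  have "continuous_on (UNIV \<times> cbox 0 1) (\<lambda>(\<theta>, t). circ r t powi (n + p + 1) * G (ziter T n \<theta>, t))"
    unfolding case_prod_unfold
  proof (intro continuous_on_mult continuous_on_power_int)
    show "continuous_on (UNIV \<times> cbox 0 1) (\<lambda>x::'a \<times> real. G (ziter T n (fst x), snd x))"
      by (rule continuous_on_compose2[OF G_cont])
         (auto intro!: continuous_intros continuous_on_compose2[OF continuous_on_ziter[OF homeo]])
  qed (use r in \<open>auto intro!: continuous_intros\<close>)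
  from integral_continuous_on_param[OF this] show ?thesis by (simp add: H_def)
qed

end

section \<open>The center space and its cocycle\<close>

lemma inverse_of_injective_mat:
  fixes A :: "complex mat"
  assumes A: "A \<in> carrier_mat n n" and inj: "\<And>v. v \<in> carrier_vec n \<Longrightarrow> A *\<^sub>v v = 0\<^sub>v n \<Longrightarrow> v = 0\<^sub>v n"
  obtains B where "B \<in> carrier_mat n n" "A * B = 1\<^sub>m n" "B * A = 1\<^sub>m n"
proof -
  have "det A \<noteq> 0" using det_0_iff_vec_prod_zero[OF A] inj by blast
  from det_non_zero_imp_unit[OF A this, of "()"]
  show ?thesis using that by (auto simp: Units_def ring_mat_def)
qed

lemma cvec_norm_component: "v \<in> carrier_vec n \<Longrightarrow> i < n \<Longrightarrow> cmod (v $ i) \<le> cvec_norm v"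
  unfolding cvec_norm_def by (rule member_le_L2_set) auto

lemma cvec_norm_le_sum: "v \<in> carrier_vec n \<Longrightarrow> cvec_norm v \<le> (\<Sum>i<n. cmod (v $ i))"
  unfolding cvec_norm_def using L2_set_le_sum[of "{..<n}" "\<lambda>i. cmod (v $ i)"] by simp

lemma cvec_norm_nonneg: "0 \<le> cvec_norm v"
  unfolding cvec_norm_def by (rule L2_set_nonneg)

context laurent_symbol
begin

text \<open>Bounds the columns 0, ..., q - 1 of both Green's functions. It must be available before
  the frame constant is chosen, which depends on it.\<close>

definition growth_const :: real where
  "growth_const = 2 * wnorm (\<lambda>n. rp powi n) bp * rp ^ length as + 2 * wnorm (\<lambda>n. rm powi n) bm"

end

text \<open>The window and frame estimates are assumed with fixed constants, so that everything
  inside is uniform in \<theta>. They hold once \<tau> lies below the thresholds of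
  \<open>center_window_bound\<close> and \<open>center_frame_bound\<close>.\<close>

locale center = laurent_symbol rm rp \<alpha> bm bp \<kappa> \<eta> as
    + p: green rp \<alpha> bp T w \<tau> + m: green rm \<alpha> bm T w \<tau>
  for rm rp :: real and \<alpha> bm bp \<kappa> \<eta> :: "int \<Rightarrow> complex" and as :: "complex list"
    and T :: "'a::metric_space \<Rightarrow> 'a" and w :: "'a \<Rightarrow> complex" and \<tau> :: real +
  fixes Kw Kf :: real
  assumes Kw: "0 \<le> Kw" and Kf: "0 \<le> Kf"
    and window: "\<And>\<theta> u C n. (\<And>n. cmod (u n) \<le> C * \<omega> n) \<Longrightarrow> (\<And>n. symop \<alpha> u n + w (ziter T n \<theta>) * u n = 0) \<Longrightarrow>
       cmod (u n) \<le> Kw * (\<Sum>i<length as. cmod (u (int i))) * \<omega> n"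
    and frame: "\<And>\<theta> x vp vm.
       (\<And>n. cmod (vp n) \<le> growth_const * (\<Sum>p<length as. cmod (x p)) * rp powi n) \<Longrightarrow>
       (\<And>n. cmod (vm n) \<le> growth_const * (\<Sum>p<length as. cmod (x p)) * rm powi n) \<Longrightarrow>
       (\<And>n. symop \<alpha> vp n + w (ziter T n \<theta>) * vp n = (\<Sum>p<length as. x p * deltaf (- int p - 1) n)) \<Longrightarrow>
       (\<And>n. symop \<alpha> vm n + w (ziter T n \<theta>) * vm n = (\<Sum>p<length as. x p * deltaf (- int p - 1) n)) \<Longrightarrow>
       (\<Sum>p<length as. cmod (x p)) \<le> Kf * (\<Sum>i<length as. cmod (vp (int i) - vm (int i)))"
begin

abbreviation "q \<equiv> length as"

text \<open>With \<open>w = E - \<zeta> + \<epsilon> W\<close> this is the infinite-range operator minus \<open>\<zeta>\<close>.\<close>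

definition L :: "'a \<Rightarrow> (int \<Rightarrow> complex) \<Rightarrow> int \<Rightarrow> complex" where
  "L \<theta> u n = symop \<alpha> u n + w (ziter T n \<theta>) * u n"

text \<open>The basis sequence with index p of the center space. The two columns have the same
  source, so their difference solves the homogeneous equation.\<close>

definition U :: "nat \<Rightarrow> 'a \<Rightarrow> int \<Rightarrow> complex" where
  "U p \<theta> n = p.H (int p) \<theta> n - m.H (int p) \<theta> n"

definition Ev :: "'a \<Rightarrow> complex vec \<Rightarrow> int \<Rightarrow> complex" where
  "Ev \<theta> x n = (\<Sum>p<q. x $ p * U p \<theta> n)"

text \<open>Pointwise form of the growth conditions of the center space: \<open>rp powi n\<close> to
  the right, \<open>rm powi n\<close> to the left.\<close>

definition in_center :: "'a \<Rightarrow> (int \<Rightarrow> complex) \<Rightarrow> bool" where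
  "in_center \<theta> u \<longleftrightarrow> (\<exists>C. \<forall>n. cmod (u n) \<le> C * \<omega> n) \<and> (\<forall>n. L \<theta> u n = 0)"

lemmas bijT = p.bij

lemma L_diff:
  assumes "\<And>n. cmod (u n) \<le> C * \<omega> n" "\<And>n. cmod (v n) \<le> D * \<omega> n"
  shows "L \<theta> (\<lambda>n. u n - v n) n = L \<theta> u n - L \<theta> v n"
  unfolding L_def symop_diff[OF subweight_wt wsummable_\<alpha> assms] by (simp add: algebra_simps)

lemma L_translate: "L (ziter T m \<theta>) (\<lambda>n. u (n + m)) n = L \<theta> u (n + m)"
  unfolding L_def symop_translate by (simp add: ziter_add[OF bijT])

lemma wt_translate:
  assumes "\<And>n. cmod (u n) \<le> C * \<omega> n"
  shows "cmod (u (n + m)) \<le> (C * \<omega> m) * \<omega> n"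
proof -
  have C: "0 \<le> C" by (rule wbound_nonneg[OF subweight_wt assms])
  have "cmod (u (n + m)) \<le> C * \<omega> (n + m)" by (rule assms)
  also have "\<dots> \<le> C * (\<omega> n * \<omega> m)" by (rule mult_left_mono[OF wt_add C])
  finally show ?thesis by (simp add: mult_ac)
qed

lemma in_center_translate:
  assumes "in_center \<theta> u"
  shows "in_center (ziter T m \<theta>) (\<lambda>n. u (n + m))"
  using assms wt_translate[of u] unfolding in_center_def by (auto simp: L_translate)

lemma in_center_diff:
  assumes "in_center \<theta> u" "in_center \<theta> v"
  shows "in_center \<theta> (\<lambda>n. u n - v n)"
proof -
  obtain C D where b: "\<And>n. cmod (u n) \<le> C * \<omega> n" "\<And>n. cmod (v n) \<le> D * \<omega> n"
    using assms unfolding in_center_def by blast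
  have "cmod (u n - v n) \<le> (C + D) * \<omega> n" for n
    using norm_triangle_ineq4[of "u n" "v n"] b(1)[of n] b(2)[of n] by (simp add: distrib_right)
  thus ?thesis using assms L_diff[OF b] unfolding in_center_def by auto
qed

lemma in_center_window:
  assumes "in_center \<theta> u"
  shows "cmod (u n) \<le> Kw * (\<Sum>i<q. cmod (u (int i))) * \<omega> n"
  using assms window[of u _ \<theta> n] unfolding in_center_def L_def by blast

text \<open>A center solution is determined by its window, so the center space has dimension at most
  q.\<close>

lemma in_center_eqI:
  assumes "in_center \<theta> u" "in_center \<theta> v" "\<And>i. i < q \<Longrightarrow> u (int i) = v (int i)"
  shows "u = v"
proof
  fix n
  have "cmod (u n - v n) \<le> 0"
    using in_center_window[OF in_center_diff[OF assms(1,2)], of n] assms(3) by simp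
  thus "u n = v n" by simp
qed

lemma Hp_wt: "cmod (p.H k \<theta> n) \<le> (2 * p.\<beta> * rp powi (k + 1)) * \<omega> n"
  using p.H_bound[of k \<theta> n] mult_left_mono[OF rp_le_wt, of "2 * p.\<beta> * rp powi (k + 1)" n] p.\<beta>_nonneg rp_pos
  by (simp add: order_trans)

lemma Hm_wt: "cmod (m.H k \<theta> n) \<le> (2 * m.\<beta> * rm powi (k + 1)) * \<omega> n"
  using m.H_bound[of k \<theta> n] mult_left_mono[OF rm_le_wt, of "2 * m.\<beta> * rm powi (k + 1)" n] m.\<beta>_nonneg rm_pos
  by (simp add: order_trans)

lemma L_Hp: "L \<theta> (p.H k \<theta>) n = deltaf (- k - 1) n" and L_Hm: "L \<theta> (m.H k \<theta>) n = deltaf (- k - 1) n"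
  unfolding L_def by (rule p.H_eq m.H_eq)+

lemma rp_Suc_le: "i < q \<Longrightarrow> rp powi (int i + 1) \<le> rp ^ q"
  using power_increasing[of "Suc i" q rp] rp_gt by (simp add: power_int_add add.commute)

lemma rm_Suc_le: "rm powi (int i + 1) \<le> 1"
  using power_le_one[of rm "Suc i"] rm_pos rm_less by (simp add: power_int_add add.commute)

lemma growth_const_nonneg: "0 \<le> growth_const"
  using p.\<beta>_nonneg m.\<beta>_nonneg rp_pos by (simp add: growth_const_def)

lemma Hp_growth:
  assumes "i < q" shows "cmod (p.H (int i) \<theta> n) \<le> growth_const * rp powi n"
proof -
  have "2 * p.\<beta> * rp powi (int i + 1) \<le> 2 * p.\<beta> * rp ^ q"
    by (intro mult_left_mono rp_Suc_le assms) (use p.\<beta>_nonneg in auto)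
  also have "\<dots> \<le> growth_const" using m.\<beta>_nonneg by (simp add: growth_const_def)
  finally have "2 * p.\<beta> * rp powi (int i + 1) * rp powi n \<le> growth_const * rp powi n"
    by (rule mult_right_mono) (use rp_pos in auto)
  thus ?thesis using p.H_bound order_trans by blast
qed

lemma Hm_growth:
  assumes "i < q" shows "cmod (m.H (int i) \<theta> n) \<le> growth_const * rm powi n"
proof -
  have "2 * m.\<beta> * rm powi (int i + 1) \<le> 2 * m.\<beta> * 1"
    by (intro mult_left_mono rm_Suc_le) (use m.\<beta>_nonneg in auto)
  also have "\<dots> \<le> growth_const" using p.\<beta>_nonneg rp_pos by (simp add: growth_const_def)
  finally have "2 * m.\<beta> * rm powi (int i + 1) * rm powi n \<le> growth_const * rm powi n"
    by (rule mult_right_mono) (use rm_pos in auto)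
  thus ?thesis using m.H_bound order_trans by blast
qed

lemma U_bound: "i < q \<Longrightarrow> cmod (U i \<theta> n) \<le> 2 * growth_const * \<omega> n"
  using norm_triangle_ineq4[of "p.H (int i) \<theta> n" "m.H (int i) \<theta> n"] Hp_growth[of i \<theta> n] Hm_growth[of i \<theta> n]
    mult_left_mono[OF rp_le_wt growth_const_nonneg, of n] mult_left_mono[OF rm_le_wt growth_const_nonneg, of n]
  by (simp add: U_def)

lemma in_center_H: "in_center \<theta> (\<lambda>n. p.H k \<theta> n - m.H k \<theta> n)"
proof -
  have "cmod (p.H k \<theta> n - m.H k \<theta> n) \<le> (2 * p.\<beta> * rp powi (k + 1) + 2 * m.\<beta> * rm powi (k + 1)) * \<omega> n" for n
    using norm_triangle_ineq4[of "p.H k \<theta> n" "m.H k \<theta> n"] Hp_wt[of k \<theta> n] Hm_wt[of k \<theta> n] by (simp add: distrib_right)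
  moreover have "L \<theta> (\<lambda>n. p.H k \<theta> n - m.H k \<theta> n) n = 0" for n
    unfolding L_diff[OF Hp_wt Hm_wt] L_Hp L_Hm by simp
  ultimately show ?thesis unfolding in_center_def by blast
qed

lemma in_center_U: "in_center \<theta> (U i \<theta>)"
  using in_center_H[of \<theta> "int i"] by (simp add: U_def[abs_def])

lemma Ev_bound:
  assumes "x \<in> carrier_vec q"
  shows "cmod (Ev \<theta> x n) \<le> real q * (2 * growth_const) * \<omega> n * cvec_norm x"
proof -
  have "cmod (Ev \<theta> x n) \<le> (\<Sum>p<q. cvec_norm x * (2 * growth_const * \<omega> n))"
    unfolding Ev_def
    by (intro sum_norm_le) (auto simp: norm_mult intro!: mult_mono cvec_norm_component[OF assms] U_bound cvec_norm_nonneg)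
  thus ?thesis by (simp add: mult_ac)
qed

lemma L_sum:
  assumes "finite I" "\<And>i n. i \<in> I \<Longrightarrow> cmod (u i n) \<le> C i * \<omega> n"
  shows "L \<theta> (\<lambda>n. \<Sum>i\<in>I. x i * u i n) n = (\<Sum>i\<in>I. x i * L \<theta> (u i) n)"
proof -
  have "symop \<alpha> (\<lambda>n. \<Sum>i\<in>I. x i * u i n) n = (\<Sum>i\<in>I. x i * symop \<alpha> (u i) n)"
    by (rule symop_sum[OF subweight_wt wsummable_\<alpha> assms])
  thus ?thesis unfolding L_def by (simp add: sum_distrib_left sum.distrib algebra_simps)
qed

lemma in_center_Ev:
  assumes "x \<in> carrier_vec q"
  shows "in_center \<theta> (Ev \<theta> x)"
proof -
  have "L \<theta> (Ev \<theta> x) n = (\<Sum>p<q. x $ p * L \<theta> (U p \<theta>) n)" for n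
    unfolding Ev_def[abs_def] by (rule L_sum) (use U_bound in auto)
  moreover have "L \<theta> (U p \<theta>) n = 0" for p n using in_center_U unfolding in_center_def by blast
  ultimately have "L \<theta> (Ev \<theta> x) n = 0" for n by simp
  moreover have "cmod (Ev \<theta> x n) \<le> (real q * (2 * growth_const) * cvec_norm x) * \<omega> n" for n
    using Ev_bound[OF assms, of \<theta> n] by (simp add: mult_ac)
  ultimately show ?thesis unfolding in_center_def by blast
qed

text \<open>The combinations with coefficients x of the columns on the two circles satisfy the
  hypotheses of \<open>frame\<close>, and their difference is \<open>Ev \<theta> x\<close>. This
  makes the basis independent uniformly in \<theta>.\<close>

lemma Ev_frame:
  assumes x: "x \<in> carrier_vec q"
  shows "(\<Sum>p<q. cmod (x $ p)) \<le> Kf * (\<Sum>i<q. cmod (Ev \<theta> x (int i)))"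
proof -
  let ?X = "\<Sum>p<q. cmod (x $ p)"
  let ?vp = "\<lambda>n. \<Sum>p<q. x $ p * p.H (int p) \<theta> n" and ?vm = "\<lambda>n. \<Sum>p<q. x $ p * m.H (int p) \<theta> n"
  have "?X \<le> Kf * (\<Sum>i<q. cmod (?vp (int i) - ?vm (int i)))"
  proof (rule frame)
    show "cmod (?vp n) \<le> growth_const * ?X * rp powi n" for n
    proof -
      have "cmod (?vp n) \<le> (\<Sum>p<q. cmod (x $ p) * (growth_const * rp powi n))"
        by (intro sum_norm_le) (auto simp: norm_mult intro!: mult_left_mono Hp_growth)
      thus ?thesis by (simp add: sum_distrib_left mult_ac)
    qed
    show "cmod (?vm n) \<le> growth_const * ?X * rm powi n" for n
    proof -
      have "cmod (?vm n) \<le> (\<Sum>p<q. cmod (x $ p) * (growth_const * rm powi n))"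
        by (intro sum_norm_le) (auto simp: norm_mult intro!: mult_left_mono Hm_growth)
      thus ?thesis by (simp add: sum_distrib_left mult_ac)
    qed
    have "L \<theta> ?vp n = (\<Sum>p<q. x $ p * L \<theta> (p.H (int p) \<theta>) n)" for n
      by (rule L_sum[OF _ Hp_wt]) simp
    thus "symop \<alpha> ?vp n + w (ziter T n \<theta>) * ?vp n = (\<Sum>p<q. x $ p * deltaf (- int p - 1) n)" for n
      unfolding L_Hp by (simp only: L_def)
    have "L \<theta> ?vm n = (\<Sum>p<q. x $ p * L \<theta> (m.H (int p) \<theta>) n)" for n
      by (rule L_sum[OF _ Hm_wt]) simp
    thus "symop \<alpha> ?vm n + w (ziter T n \<theta>) * ?vm n = (\<Sum>p<q. x $ p * deltaf (- int p - 1) n)" for n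
      unfolding L_Hm by (simp only: L_def)
  qed
  thus ?thesis by (simp add: Ev_def U_def sum_subtractf right_diff_distrib)
qed

lemma Ev_lower:
  assumes "x \<in> carrier_vec q"
  shows "cvec_norm x \<le> Kf * (\<Sum>i<q. cmod (Ev \<theta> x (int i)))"
  using Ev_frame[OF assms] cvec_norm_le_sum[OF assms] order_trans by blast

lemma Ev_add: "x \<in> carrier_vec q \<Longrightarrow> y \<in> carrier_vec q \<Longrightarrow> Ev \<theta> (x + y) n = Ev \<theta> x n + Ev \<theta> y n"
  unfolding Ev_def by (simp add: sum.distrib distrib_right)

lemma Ev_diff: "x \<in> carrier_vec q \<Longrightarrow> y \<in> carrier_vec q \<Longrightarrow> Ev \<theta> (x - y) n = Ev \<theta> x n - Ev \<theta> y n"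
  unfolding Ev_def by (simp add: sum_subtractf left_diff_distrib)

lemma Ev_smult: "x \<in> carrier_vec q \<Longrightarrow> Ev \<theta> (c \<cdot>\<^sub>v x) n = c * Ev \<theta> x n"
  unfolding Ev_def by (simp add: sum_distrib_left mult_ac)

lemma Ev_zero [simp]: "Ev \<theta> (0\<^sub>v q) n = 0"
  unfolding Ev_def by simp

lemma Ev_window_inj:
  assumes "x \<in> carrier_vec q" "y \<in> carrier_vec q" "\<And>i. i < q \<Longrightarrow> Ev \<theta> x (int i) = Ev \<theta> y (int i)"
  shows "x = y"
proof -
  have xy: "x - y \<in> carrier_vec q" using assms by simp
  have "(\<Sum>p<q. cmod ((x - y) $ p)) \<le> Kf * (\<Sum>i<q. cmod (Ev \<theta> (x - y) (int i)))" by (rule Ev_frame[OF xy])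
  also have "\<dots> = 0" using assms by (simp add: Ev_diff)
  finally have "(\<Sum>p<q. cmod ((x - y) $ p)) = 0" by (simp add: order_antisym sum_nonneg)
  hence "\<forall>p<q. cmod ((x - y) $ p) = 0" by (subst (asm) sum_nonneg_eq_0_iff) auto
  thus ?thesis using assms(1,2) by (intro eq_vecI) auto
qed

lemma Ev_inj: "x \<in> carrier_vec q \<Longrightarrow> y \<in> carrier_vec q \<Longrightarrow> Ev \<theta> x = Ev \<theta> y \<Longrightarrow> x = y"
  by (rule Ev_window_inj[of x y \<theta>]) auto

text \<open>The square matrix of window entries is injective by the frame estimate, hence
  invertible, so some combination has the window of u. The window estimate then makes it equal to u
  everywhere.\<close>

lemma Ev_span:
  assumes "in_center \<theta> u"
  shows "\<exists>x\<in>carrier_vec q. Ev \<theta> x = u"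
proof -
  define M where "M = mat q q (\<lambda>(i, p). U p \<theta> (int i))"
  have M: "M \<in> carrier_mat q q" by (simp add: M_def)
  have Mv: "(M *\<^sub>v v) $ i = Ev \<theta> v (int i)" if "v \<in> carrier_vec q" "i < q" for v i
    using that by (simp add: M_def Ev_def scalar_prod_def mult.commute atLeast0LessThan)
  obtain B where B: "B \<in> carrier_mat q q" "M * B = 1\<^sub>m q"
  proof (rule inverse_of_injective_mat[OF M])
    fix v assume v: "v \<in> carrier_vec q" "M *\<^sub>v v = 0\<^sub>v q"
    show "v = 0\<^sub>v q"
      by (rule Ev_window_inj[of _ _ \<theta>]) (use v Mv[OF v(1)] in auto)
  qed auto
  define y where "y = vec q (\<lambda>i. u (int i))"
  have y: "y \<in> carrier_vec q" by (simp add: y_def)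
  have x: "B *\<^sub>v y \<in> carrier_vec q" using B y by simp
  have "M *\<^sub>v (B *\<^sub>v y) = y" using assoc_mult_mat_vec[OF M B(1) y] B(2) y by simp
  hence "Ev \<theta> (B *\<^sub>v y) (int i) = u (int i)" if "i < q" for i
    using Mv[OF x that] that by (simp add: y_def)
  hence "Ev \<theta> (B *\<^sub>v y) = u" by (intro in_center_eqI[OF in_center_Ev[OF x] assms]) auto
  thus ?thesis using x by blast
qed

text \<open>Same description as in \<open>center_cocycle\<close>, so that the two coincide as soon
  as U is identified with the contour integrals.\<close>

definition cc :: "'a \<Rightarrow> complex mat" where
  "cc \<theta> = (THE C. C \<in> carrier_mat q q \<and>
      (\<forall>p<q. \<forall>k. U p \<theta> (k + 1) = (\<Sum>i<q. U i (T \<theta>) k * C $$ (i, p))))"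

lemma cc_ex1: "\<exists>!C. C \<in> carrier_mat q q \<and>
      (\<forall>p<q. \<forall>k. U p \<theta> (k + 1) = (\<Sum>i<q. U i (T \<theta>) k * C $$ (i, p)))"
proof -
  have "\<exists>x\<in>carrier_vec q. Ev (T \<theta>) x = (\<lambda>n. U p \<theta> (n + 1))" for p
    using Ev_span[OF in_center_translate[OF in_center_U, where m = 1]] by simp
  then obtain X where X: "\<And>p. X p \<in> carrier_vec q" "\<And>p. Ev (T \<theta>) (X p) = (\<lambda>n. U p \<theta> (n + 1))" by metis
  show ?thesis
  proof (rule ex1I[of _ "mat q q (\<lambda>(i, p). X p $ i)"], safe)
    fix p k assume "p < q"
    thus "U p \<theta> (k + 1) = (\<Sum>i<q. U i (T \<theta>) k * mat q q (\<lambda>(i, p). X p $ i) $$ (i, p))"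
      using fun_cong[OF X(2), of p k] by (simp add: Ev_def mult.commute)
  next
    fix C assume C: "C \<in> carrier_mat q q" "\<forall>p<q. \<forall>k. U p \<theta> (k + 1) = (\<Sum>i<q. U i (T \<theta>) k * C $$ (i, p))"
    have "col C p = X p" if p: "p < q" for p
    proof (rule Ev_inj[of _ _ "T \<theta>"])
      show "col C p \<in> carrier_vec q" "X p \<in> carrier_vec q" using C(1) p X(1) by auto
      show "Ev (T \<theta>) (col C p) = Ev (T \<theta>) (X p)"
        unfolding X(2) using C p by (auto simp: Ev_def mult.commute)
    qed
    thus "C = mat q q (\<lambda>(i, p). X p $ i)" using C(1)
      by (intro eq_matI) (auto simp: index_col[symmetric])
  qed simp
qed

lemma cc_carrier: "cc \<theta> \<in> carrier_mat q q"
  and cc_col: "p < q \<Longrightarrow> U p \<theta> (k + 1) = (\<Sum>i<q. U i (T \<theta>) k * cc \<theta> $$ (i, p))"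
  using theI'[OF cc_ex1[of \<theta>]] unfolding cc_def[symmetric] by blast+

lemma cc_mult_carrier: "x \<in> carrier_vec q \<Longrightarrow> cc \<theta> *\<^sub>v x \<in> carrier_vec q"
  by (rule mult_mat_vec_carrier[OF cc_carrier])

text \<open>In coordinates the cocycle is the shift of sequences; iterates of the cocycle thereby
  turn into entries at distant indices.\<close>

lemma Ev_cc:
  assumes "x \<in> carrier_vec q"
  shows "Ev (T \<theta>) (cc \<theta> *\<^sub>v x) k = Ev \<theta> x (k + 1)"
proof -
  have "Ev (T \<theta>) (cc \<theta> *\<^sub>v x) k = (\<Sum>i<q. (\<Sum>p<q. cc \<theta> $$ (i, p) * x $ p) * U i (T \<theta>) k)"
    unfolding Ev_def using cc_carrier[of \<theta>] assms
    by (intro sum.cong) (auto simp: scalar_prod_def atLeast0LessThan)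
  also have "\<dots> = (\<Sum>i<q. \<Sum>p<q. x $ p * (U i (T \<theta>) k * cc \<theta> $$ (i, p)))"
    by (simp add: sum_distrib_right sum_distrib_left mult_ac)
  also have "\<dots> = (\<Sum>p<q. \<Sum>i<q. x $ p * (U i (T \<theta>) k * cc \<theta> $$ (i, p)))" by (rule sum.swap)
  also have "\<dots> = (\<Sum>p<q. x $ p * U p \<theta> (k + 1))"
    by (intro sum.cong) (auto simp: cc_col sum_distrib_left)
  finally show ?thesis by (simp add: Ev_def)
qed

lemma iter_carrier: "cocycle_iter q T cc n \<theta> \<in> carrier_mat q q"
  by (induction n) (auto intro: mult_carrier_mat cc_carrier)

lemma iter_mult_carrier: "x \<in> carrier_vec q \<Longrightarrow> cocycle_iter q T cc n \<theta> *\<^sub>v x \<in> carrier_vec q"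
  using iter_carrier mult_mat_vec_carrier by blast

lemma iter_Suc_mult:
  assumes "x \<in> carrier_vec q"
  shows "cocycle_iter q T cc (Suc n) \<theta> *\<^sub>v x = cc ((T ^^ n) \<theta>) *\<^sub>v (cocycle_iter q T cc n \<theta> *\<^sub>v x)"
  using assoc_mult_mat_vec[OF cc_carrier iter_carrier assms] by simp

lemma Ev_iter:
  assumes "x \<in> carrier_vec q"
  shows "Ev ((T ^^ n) \<theta>) (cocycle_iter q T cc n \<theta> *\<^sub>v x) k = Ev \<theta> x (k + int n)"
proof (induction n arbitrary: k)
  case 0 thus ?case using assms by simp
next
  case (Suc n)
  show ?case
    using Ev_cc[OF iter_mult_carrier[OF assms], of "(T ^^ n) \<theta>" n \<theta> k] Suc[of "k + 1"]
    by (simp only: iter_Suc_mult[OF assms] funpow.simps comp_apply of_nat_Suc add_ac)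
qed

lemma cc_inj:
  assumes "x \<in> carrier_vec q" "y \<in> carrier_vec q" "cc \<theta> *\<^sub>v x = cc \<theta> *\<^sub>v y"
  shows "x = y"
proof (rule Ev_inj[OF assms(1,2)])
  show "Ev \<theta> x = Ev \<theta> y"
  proof
    fix n show "Ev \<theta> x n = Ev \<theta> y n"
      using Ev_cc[OF assms(1), of \<theta> "n - 1"] Ev_cc[OF assms(2), of \<theta> "n - 1"] assms(3) by simp
  qed
qed

lemma cc_surj:
  assumes "y \<in> carrier_vec q"
  shows "\<exists>x\<in>carrier_vec q. cc \<theta> *\<^sub>v x = y"
proof -
  have "in_center (ziter T (- 1) (T \<theta>)) (\<lambda>n. Ev (T \<theta>) y (n + - 1))"
    by (rule in_center_translate[OF in_center_Ev[OF assms]])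
  moreover have "ziter T (- 1) (T \<theta>) = \<theta>" using ziter_add[OF bijT, of "- 1" 1 \<theta>] by simp
  ultimately obtain x where x: "x \<in> carrier_vec q" "Ev \<theta> x = (\<lambda>n. Ev (T \<theta>) y (n - 1))"
    using Ev_span[of \<theta>] by auto
  have "cc \<theta> *\<^sub>v x = y"
    by (rule Ev_inj[OF cc_mult_carrier[OF x(1)] assms, of "T \<theta>"]) (simp add: Ev_cc[OF x(1)] x(2) fun_eq_iff)
  thus ?thesis using x by blast
qed

lemma cc_invertible: "invertible_mat (cc \<theta>)"
proof -
  obtain B where "B \<in> carrier_mat q q" "cc \<theta> * B = 1\<^sub>m q" "B * cc \<theta> = 1\<^sub>m q"
  proof (rule inverse_of_injective_mat[OF cc_carrier])
    fix v assume "v \<in> carrier_vec q" "cc \<theta> *\<^sub>v v = 0\<^sub>v q"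
    moreover have "cc \<theta> *\<^sub>v 0\<^sub>v q = 0\<^sub>v q"
      by (rule Ev_inj[OF cc_mult_carrier, of _ _ "T \<theta>"]) (auto simp: Ev_cc)
    ultimately show "v = 0\<^sub>v q" using cc_inj[of v "0\<^sub>v q" \<theta>] by simp
  qed auto
  thus ?thesis using cc_carrier[of \<theta>] unfolding invertible_mat_def inverts_mat_def by auto
qed

lemma U_cont: "continuous_on UNIV (\<lambda>\<theta>. U i \<theta> n)"
  unfolding U_def by (intro continuous_intros p.H_cont m.H_cont)

lemma Ev_cont: "continuous_on UNIV (\<lambda>\<theta>. Ev \<theta> x n)"
  unfolding Ev_def by (intro continuous_intros U_cont)

text \<open>The frame estimate bounds the change of coordinates by the window of
  \<open>Ev \<theta> (X \<theta> - X \<theta>0)\<close>, taken in the basis at the moving point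
  \<theta>. Both parts of this difference are continuous scalar functions with the same limit at
  \<theta>0.\<close>

lemma coordinates_cont:
  fixes X :: "'a \<Rightarrow> complex vec"
  assumes X: "\<And>\<theta>. X \<theta> \<in> carrier_vec q" and cont: "\<And>i. i < q \<Longrightarrow> continuous_on UNIV (\<lambda>\<theta>. Ev \<theta> (X \<theta>) (int i))"
    and p: "p < q"
  shows "continuous_on UNIV (\<lambda>\<theta>. X \<theta> $ p)"
proof (rule continuous_at_imp_continuous_on, rule ballI)
  fix \<theta>0
  have "((\<lambda>\<theta>. X \<theta> $ p - X \<theta>0 $ p) \<longlongrightarrow> 0) (at \<theta>0)"
  proof (rule tendsto_norm_zero_cancel, rule tendsto_sandwich)
    show "\<forall>\<^sub>F \<theta> in at \<theta>0. 0 \<le> cmod (X \<theta> $ p - X \<theta>0 $ p)" by simp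
    show "\<forall>\<^sub>F \<theta> in at \<theta>0. cmod (X \<theta> $ p - X \<theta>0 $ p) \<le> Kf * (\<Sum>i<q. cmod (Ev \<theta> (X \<theta>) (int i) - Ev \<theta> (X \<theta>0) (int i)))"
    proof (rule always_eventually, rule allI)
      fix \<theta>
      have c: "X \<theta> - X \<theta>0 \<in> carrier_vec q" using X by simp
      have "cmod (X \<theta> $ p - X \<theta>0 $ p) = cmod ((X \<theta> - X \<theta>0) $ p)" using p X[of \<theta>0] by simp
      also have "\<dots> \<le> cvec_norm (X \<theta> - X \<theta>0)" by (rule cvec_norm_component[OF c p])
      also have "\<dots> \<le> Kf * (\<Sum>i<q. cmod (Ev \<theta> (X \<theta> - X \<theta>0) (int i)))" by (rule Ev_lower[OF c])
      finally show "cmod (X \<theta> $ p - X \<theta>0 $ p) \<le> Kf * (\<Sum>i<q. cmod (Ev \<theta> (X \<theta>) (int i) - Ev \<theta> (X \<theta>0) (int i)))"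
        using X by (simp add: Ev_diff)
    qed
    have "((\<lambda>\<theta>. Kf * (\<Sum>i<q. cmod (Ev \<theta> (X \<theta>) (int i) - Ev \<theta> (X \<theta>0) (int i)))) \<longlongrightarrow>
       Kf * (\<Sum>i<q. cmod (Ev \<theta>0 (X \<theta>0) (int i) - Ev \<theta>0 (X \<theta>0) (int i)))) (at \<theta>0)"
    proof (intro tendsto_mult tendsto_const tendsto_sum tendsto_norm tendsto_diff)
      show "((\<lambda>\<theta>. Ev \<theta> (X \<theta>) (int i)) \<longlongrightarrow> Ev \<theta>0 (X \<theta>0) (int i)) (at \<theta>0)" if "i \<in> {..<q}" for i
        using cont[of i] that by (auto simp: continuous_on_def)
      show "((\<lambda>\<theta>. Ev \<theta> (X \<theta>0) (int i)) \<longlongrightarrow> Ev \<theta>0 (X \<theta>0) (int i)) (at \<theta>0)" for i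
        using Ev_cont[of "X \<theta>0" "int i"] by (auto simp: continuous_on_def)
    qed
    thus "((\<lambda>\<theta>. Kf * (\<Sum>i<q. cmod (Ev \<theta> (X \<theta>) (int i) - Ev \<theta> (X \<theta>0) (int i)))) \<longlongrightarrow> 0) (at \<theta>0)" by simp
  qed simp
  thus "isCont (\<lambda>\<theta>. X \<theta> $ p) \<theta>0" unfolding isCont_def by (simp add: LIM_zero_iff)
qed

lemma T_cont: "continuous_on UNIV T" and invT_cont: "continuous_on UNIV (inv_into UNIV T)"
  using p.homeo by (auto simp: homeomorphism_def)

lemma cc_cont: "continuous_mat q cc"
  unfolding continuous_mat_def
proof (intro conjI allI impI cc_carrier)
  fix i j assume ij: "i < q" "j < q"
  let ?S = "inv_into UNIV T"
  have TS: "T (?S \<theta>) = \<theta>" and ST: "?S (T \<theta>) = \<theta>" for \<theta>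
    using bijT by (simp_all add: bij_is_surj surj_f_inv_f bij_is_inj)
  \<comment> \<open>The columns of \<open>cc \<theta>\<close> are coordinates in the basis at
    \<open>T \<theta>\<close>. Precomposition with the inverse of T puts them in the basis at
    \<theta>, where \<open>coordinates_cont\<close> applies.\<close>
  have "continuous_on UNIV (\<lambda>\<theta>. col (cc (?S \<theta>)) j $ i)"
  proof (rule coordinates_cont[OF _ _ ij(1)])
    show "col (cc (?S \<theta>)) j \<in> carrier_vec q" for \<theta> using cc_carrier[of "?S \<theta>"] ij by auto
    have "Ev \<theta> (col (cc (?S \<theta>)) j) k = U j (?S \<theta>) (k + 1)" for \<theta> k
      using cc_col[OF ij(2), of "?S \<theta>" k] cc_carrier[of "?S \<theta>"] ij by (simp add: TS Ev_def mult.commute)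
    moreover have "continuous_on UNIV (\<lambda>\<theta>. U j (?S \<theta>) (k + 1))" for k
      by (rule continuous_on_compose2[OF U_cont invT_cont]) simp
    ultimately show "continuous_on UNIV (\<lambda>\<theta>. Ev \<theta> (col (cc (?S \<theta>)) j) (int k))" for k by simp
  qed
  hence "continuous_on UNIV (\<lambda>\<theta>. col (cc (?S (T \<theta>))) j $ i)"
    by (rule continuous_on_compose2[OF _ T_cont]) simp
  moreover have "col (cc \<theta>) j $ i = cc \<theta> $$ (i, j)" for \<theta> using cc_carrier[of \<theta>] ij by simp
  ultimately show "continuous_on UNIV (\<lambda>\<theta>. cc \<theta> $$ (i, j))" by (simp add: ST)
qed

lemma GL_cc: "GL_cocycle q cc"
  unfolding GL_cocycle_def using cc_cont cc_invertible by blast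

end

section \<open>Square-summable sequences\<close>

lemma l2_summable: "u \<in> l2 \<Longrightarrow> (\<lambda>n. (cmod (u n))\<^sup>2) summable_on UNIV"
  by (simp add: l2_def)

lemma l2_norm_sq: "(l2_norm u)\<^sup>2 = (\<Sum>\<^sub>\<infinity>n. (cmod (u n))\<^sup>2)"
  unfolding l2_norm_def by (simp add: infsum_nonneg)

lemma l2_norm_nonneg: "0 \<le> l2_norm u"
  unfolding l2_norm_def by (simp add: infsum_nonneg)

lemma l2_component:
  assumes "u \<in> l2"
  shows "cmod (u n) \<le> l2_norm u"
proof -
  have "sum (\<lambda>n. (cmod (u n))\<^sup>2) {n} \<le> (\<Sum>\<^sub>\<infinity>n. (cmod (u n))\<^sup>2)"
    by (rule finite_sum_le_infsum[OF l2_summable[OF assms]]) auto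
  hence "(cmod (u n))\<^sup>2 \<le> (l2_norm u)\<^sup>2" by (simp add: l2_norm_sq)
  thus ?thesis using l2_norm_nonneg by (rule power2_le_imp_le)
qed

lemma l2_comparison:
  assumes "u \<in> l2" "\<And>n. cmod (v n) \<le> C * cmod (u n)"
  shows "v \<in> l2"
proof -
  have "(cmod (v n))\<^sup>2 \<le> C\<^sup>2 * (cmod (u n))\<^sup>2" for n
    using power_mono[OF assms(2)[of n], of 2] by (simp add: power_mult_distrib)
  thus ?thesis unfolding l2_def
    using summable_on_comparison_test[OF summable_on_cmult_right[OF l2_summable[OF assms(1)], of "C\<^sup>2"]] by simp
qed

lemma l2_add:
  assumes "u \<in> l2" "v \<in> l2"
  shows "(\<lambda>n. u n + v n) \<in> l2"
proof -
  have "(cmod (u n + v n))\<^sup>2 \<le> 2 * (cmod (u n))\<^sup>2 + 2 * (cmod (v n))\<^sup>2" for n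
  proof -
    have "(cmod (u n + v n))\<^sup>2 \<le> (cmod (u n) + cmod (v n))\<^sup>2" by (intro power_mono norm_triangle_ineq) simp
    also have "\<dots> \<le> 2 * (cmod (u n))\<^sup>2 + 2 * (cmod (v n))\<^sup>2"
      using sum_squares_bound[of "cmod (u n)" "cmod (v n)"] by (simp add: power2_sum)
    finally show ?thesis .
  qed
  thus ?thesis unfolding l2_def
    using summable_on_comparison_test[OF summable_on_add[OF summable_on_cmult_right[OF l2_summable[OF assms(1)], of 2]
      summable_on_cmult_right[OF l2_summable[OF assms(2)], of 2]]] by simp
qed

lemma l2_cmult: "u \<in> l2 \<Longrightarrow> (\<lambda>n. c * u n) \<in> l2"
  by (rule l2_comparison[of u _ "cmod c"]) (auto simp: norm_mult)

lemma l2_diff: "u \<in> l2 \<Longrightarrow> v \<in> l2 \<Longrightarrow> (\<lambda>n. u n - v n) \<in> l2"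
  using l2_add[of u "\<lambda>n. (-1) * v n"] l2_cmult[of v "-1"] by simp

section \<open>Kernels dominated by a summable function of n - m\<close>

lemma exp_decay_summable:
  assumes "0 \<le> \<mu>" "\<mu> < (1::real)"
  shows "(\<lambda>n::int. C * \<mu> ^ nat \<bar>n - c\<bar>) summable_on UNIV"
  using summable_int_translate[of "\<lambda>n. \<mu> ^ nat \<bar>n\<bar>" "- c"] summable_int_geometric[OF assms]
  by (intro summable_on_cmult_right) simp

lemma schur_summable:
  assumes "\<And>n m. cmod (k n m) \<le> \<kappa> (n - m)" "\<kappa> summable_on UNIV" "\<And>m. cmod (u m) \<le> B"
  shows "(\<lambda>m. cmod (k n m * u m)) summable_on (UNIV::int set)"
proof (rule Infinite_Sum.abs_summable_on_comparison_test')
  show "(\<lambda>m. B * \<kappa> (n - m)) summable_on UNIV"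
    using assms(2) summable_int_reflect[of \<kappa> n] by (intro summable_on_cmult_right) simp
  show "cmod (k n m * u m) \<le> B * \<kappa> (n - m)" for m
    using mult_mono[OF assms(1)[of n m] assms(3)[of m]] assms(1)[of n m] norm_ge_zero[of "k n m"]
    by (simp add: norm_mult mult.commute)
qed

text \<open>Cauchy-Schwarz with the dominating kernel split into two square roots, then Fubini in n;
  all rows and columns of that kernel have the same sum.\<close>

lemma schur_test:
  assumes k: "\<And>n m. cmod (k n m) \<le> \<kappa> (n - m)" and \<kappa>: "\<kappa> summable_on UNIV" and u: "u \<in> l2"
  shows "(\<lambda>n::int. \<Sum>\<^sub>\<infinity>m. k n m * u m) \<in> l2"
    and "l2_norm (\<lambda>n. \<Sum>\<^sub>\<infinity>m. k n m * u m) \<le> infsum \<kappa> UNIV * l2_norm u"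
proof -
  define S where "S = infsum \<kappa> UNIV"
  have \<kappa>0: "0 \<le> \<kappa> j" for j using order_trans[OF norm_ge_zero k[of j 0]] by simp
  have S: "0 \<le> S" unfolding S_def by (rule infsum_nonneg) (rule \<kappa>0)
  have \<kappa>n: "(\<lambda>m. \<kappa> (n - m)) summable_on UNIV" "(\<Sum>\<^sub>\<infinity>m. \<kappa> (n - m)) = S" for n
    using \<kappa> summable_int_reflect[of \<kappa> n] infsum_int_reflect[of \<kappa> n] by (auto simp: S_def)
  have \<kappa>m: "(\<lambda>n. \<kappa> (n - m)) summable_on UNIV" "(\<Sum>\<^sub>\<infinity>n. \<kappa> (n - m)) = S" for m
    using \<kappa> summable_int_translate[of \<kappa> "- m"] infsum_int_translate[of \<kappa> "- m"] by (auto simp: S_def)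
  define B where "B = (\<lambda>n. \<Sum>\<^sub>\<infinity>m. \<kappa> (n - m) * (cmod (u m))\<^sup>2)"
  have prod: "(\<lambda>(m, n). \<kappa> (n - m) * (cmod (u m))\<^sup>2) summable_on UNIV \<times> UNIV"
  proof (rule abs_summable_summable, subst Infinite_Sum.abs_summable_on_Sigma_iff, intro conjI ballI)
    show "(\<lambda>y. norm (case (x, y) of (m, n) \<Rightarrow> \<kappa> (n - m) * (cmod (u m))\<^sup>2)) summable_on UNIV" for x
      using summable_on_cmult_left[OF \<kappa>m(1)[of x], of "(cmod (u x))\<^sup>2"] \<kappa>0 by (simp add: abs_mult)
    have "(\<Sum>\<^sub>\<infinity>y. norm (case (x, y) of (m, n) \<Rightarrow> \<kappa> (n - m) * (cmod (u m))\<^sup>2)) = S * (cmod (u x))\<^sup>2" for x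
      using \<kappa>0 \<kappa>m(2)[of x] by (simp add: abs_mult infsum_cmult_left')
    thus "(\<lambda>x. norm (\<Sum>\<^sub>\<infinity>y\<in>UNIV. norm (case (x, y) of (m, n) \<Rightarrow> \<kappa> (n - m) * (cmod (u m))\<^sup>2))) summable_on UNIV"
      using summable_on_cmult_right[OF l2_summable[OF u], of S] S by (simp add: abs_mult)
  qed
  hence prod': "(\<lambda>(n, m). \<kappa> (n - m) * (cmod (u m))\<^sup>2) summable_on UNIV \<times> UNIV"
    by (subst summable_on_swap) (simp add: case_prod_unfold)
  have Bsum: "B summable_on UNIV"
    using summable_on_Sigma_banach[OF prod'] by (simp add: B_def)
  have "infsum B UNIV = (\<Sum>\<^sub>\<infinity>m. \<Sum>\<^sub>\<infinity>n. \<kappa> (n - m) * (cmod (u m))\<^sup>2)"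
    unfolding B_def by (rule infsum_swap_banach[OF prod'])
  also have "\<dots> = S * (l2_norm u)\<^sup>2"
    by (simp add: infsum_cmult_left' \<kappa>m infsum_cmult_right' l2_norm_sq)
  finally have Binf: "infsum B UNIV = S * (l2_norm u)\<^sup>2" .
  have inner: "(\<lambda>m. \<kappa> (n - m) * (cmod (u m))\<^sup>2) summable_on UNIV" for n
    using summable_on_SigmaD1[OF prod', of n] \<kappa>0 by simp
  have B0: "0 \<le> B n" for n unfolding B_def by (rule infsum_nonneg) (simp add: \<kappa>0)
  have key: "(cmod (\<Sum>\<^sub>\<infinity>m. k n m * u m))\<^sup>2 \<le> S * B n" for n
  proof -
    have sm: "(\<lambda>m. cmod (k n m * u m)) summable_on UNIV"
      by (rule schur_summable[OF k \<kappa> l2_component[OF u]])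
    have "cmod (\<Sum>\<^sub>\<infinity>m. k n m * u m) \<le> (\<Sum>\<^sub>\<infinity>m. cmod (k n m * u m))"
      by (rule norm_infsum_bound[OF sm])
    also have "\<dots> \<le> sqrt (S * B n)"
    proof (rule infsum_le_finite_sums[OF sm])
      fix F :: "int set" assume F: "finite F" "F \<subseteq> UNIV"
      have "(\<Sum>m\<in>F. cmod (k n m * u m)) \<le> (\<Sum>m\<in>F. sqrt (\<kappa> (n - m)) * (sqrt (\<kappa> (n - m)) * cmod (u m)))"
        using \<kappa>0 k by (intro sum_mono) (simp add: norm_mult mult.assoc[symmetric] mult_right_mono)
      also have "\<dots> \<le> sqrt ((\<Sum>m\<in>F. (sqrt (\<kappa> (n - m)))\<^sup>2) * (\<Sum>m\<in>F. (sqrt (\<kappa> (n - m)) * cmod (u m))\<^sup>2))"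
        using Cauchy_Schwarz_ineq_sum[of "\<lambda>m. sqrt (\<kappa> (n - m))" "\<lambda>m. sqrt (\<kappa> (n - m)) * cmod (u m)" F]
        by (rule real_le_rsqrt)
      also have "\<dots> = sqrt ((\<Sum>m\<in>F. \<kappa> (n - m)) * (\<Sum>m\<in>F. \<kappa> (n - m) * (cmod (u m))\<^sup>2))"
        using \<kappa>0 by (simp add: power_mult_distrib)
      also have "\<dots> \<le> sqrt (S * B n)"
      proof (intro real_sqrt_le_mono mult_mono S)
        show "(\<Sum>m\<in>F. \<kappa> (n - m)) \<le> S"
          using finite_sum_le_infsum[OF \<kappa>n(1)[of n] F] \<kappa>0 by (simp add: \<kappa>n)
        show "(\<Sum>m\<in>F. \<kappa> (n - m) * (cmod (u m))\<^sup>2) \<le> B n"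
          unfolding B_def by (rule finite_sum_le_infsum[OF inner F]) (simp add: \<kappa>0)
      qed (simp add: sum_nonneg \<kappa>0)
      finally show "(\<Sum>m\<in>F. cmod (k n m * u m)) \<le> sqrt (S * B n)" .
    qed
    finally have "(cmod (\<Sum>\<^sub>\<infinity>m. k n m * u m))\<^sup>2 \<le> (sqrt (S * B n))\<^sup>2" by (intro power_mono) auto
    thus ?thesis using S B0 by simp
  qed
  have SB: "(\<lambda>n. S * B n) summable_on UNIV" by (rule summable_on_cmult_right[OF Bsum])
  have v: "(\<lambda>n. (cmod (\<Sum>\<^sub>\<infinity>m. k n m * u m))\<^sup>2) summable_on UNIV"
    by (rule summable_on_comparison_test[OF SB key]) simp_all
  thus "(\<lambda>n. \<Sum>\<^sub>\<infinity>m. k n m * u m) \<in> l2" by (simp add: l2_def)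
  have "(l2_norm (\<lambda>n. \<Sum>\<^sub>\<infinity>m. k n m * u m))\<^sup>2 \<le> (\<Sum>\<^sub>\<infinity>n. S * B n)"
    unfolding l2_norm_sq by (rule infsum_mono[OF v SB key])
  also have "\<dots> = (S * l2_norm u)\<^sup>2" by (simp add: infsum_cmult_right' Binf power2_eq_square)
  finally show "l2_norm (\<lambda>n. \<Sum>\<^sub>\<infinity>m. k n m * u m) \<le> infsum \<kappa> UNIV * l2_norm u"
    unfolding S_def[symmetric] by (rule power2_le_imp_le) (simp add: S l2_norm_nonneg)
qed

lemma symop_kernel: "symop a u n = (\<Sum>\<^sub>\<infinity>m. a (m - n) * u m)"
  unfolding symop_def using infsum_int_translate[of "\<lambda>m. a (m - n) * u m" n] by (simp add: add.commute)

lemma symop_l2: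
  assumes "wsummable (\<lambda>_. 1) a" "u \<in> l2"
  shows "symop a u \<in> l2" "l2_norm (symop a u) \<le> wnorm (\<lambda>_. 1) a * l2_norm u"
proof -
  have s: "(\<lambda>j. cmod (a (- j))) summable_on UNIV"
    using assms(1) summable_int_reflect[of "\<lambda>j. cmod (a j)" 0] by (simp add: wsummable_def)
  have b: "cmod (a (m - n)) \<le> cmod (a (- (n - m)))" for n m by simp
  have i: "(\<Sum>\<^sub>\<infinity>j. cmod (a (- j))) = wnorm (\<lambda>_. 1) a"
    using infsum_int_reflect[of "\<lambda>j. cmod (a j)" 0] by (simp add: wnorm_def)
  have e: "symop a u = (\<lambda>n. \<Sum>\<^sub>\<infinity>m. a (m - n) * u m)" by (rule ext) (rule symop_kernel)
  show "symop a u \<in> l2" "l2_norm (symop a u) \<le> wnorm (\<lambda>_. 1) a * l2_norm u"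
    using schur_test[OF b s assms(2)] by (simp_all add: e i)
qed

context center
begin

lemma L_l2: "u \<in> l2 \<Longrightarrow> L \<theta> u \<in> l2"
proof -
  assume u: "u \<in> l2"
  have "wsummable (\<lambda>_. 1) \<alpha>" by (rule wsummable_mono[OF wsummable_\<alpha>]) (auto simp: wt_ge1)
  hence "symop \<alpha> u \<in> l2" using u by (rule symop_l2)
  moreover have "(\<lambda>n. w (ziter T n \<theta>) * u n) \<in> l2"
    by (rule l2_comparison[OF u, of _ \<tau>]) (simp add: norm_mult mult_right_mono p.w_bound)
  ultimately show ?thesis unfolding L_def[abs_def] by (rule l2_add)
qed

lemma l2_wt: "u \<in> l2 \<Longrightarrow> cmod (u n) \<le> l2_norm u * \<omega> n"
  using l2_component[of u n] mult_left_mono[OF wt_ge1[of n] l2_norm_nonneg[of u]] by simp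

definition l2_invertible :: "'a \<Rightarrow> bool" where
  "l2_invertible \<theta> \<longleftrightarrow> (\<exists>R. bounded_l2_op R \<and> (\<forall>u\<in>l2. R (L \<theta> u) = u \<and> L \<theta> (R u) = u))"

text \<open>A decaying solution with source at one index, available at all base points, supplies
  every column of the inverse by translation. The Schur test makes the resulting operator bounded;
  it is a right inverse by construction and a left inverse because there are no bounded homogeneous
  solutions.\<close>

lemma invertible_of_green:
  assumes \<mu>: "0 < \<mu>" "\<mu> < 1" and \<Gamma>: "\<And>\<theta> n. cmod (\<Gamma> \<theta> n) \<le> K * \<mu> ^ nat \<bar>n\<bar>" "\<And>\<theta> n. L \<theta> (\<Gamma> \<theta>) n = deltaf (- 1) n"
    and inj: "\<And>u B. (\<And>n. cmod (u n) \<le> B) \<Longrightarrow> (\<And>n. L \<theta> u n = 0) \<Longrightarrow> u = (\<lambda>n. 0)"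
  shows "l2_invertible \<theta>"
proof -
  \<comment> \<open>Column m: the solution at the (m + 1)-st orbit point has its source at -1, which
    translation by m + 1 moves to m.\<close>
  define k where "k = (\<lambda>n m. \<Gamma> (ziter T (m + 1) \<theta>) (n - m - 1))"
  define \<kappa>' where "\<kappa>' = (\<lambda>j::int. K * \<mu> ^ nat \<bar>j - 1\<bar>)"
  have k: "cmod (k n m) \<le> \<kappa>' (n - m)" for n m unfolding k_def \<kappa>'_def by (rule \<Gamma>)
  have \<kappa>': "\<kappa>' summable_on UNIV" unfolding \<kappa>'_def by (rule exp_decay_summable) (use \<mu> in auto)
  have \<kappa>0: "0 \<le> \<kappa>' j" for j using order_trans[OF norm_ge_zero k[of j 0]] by simp
  define R where "R = (\<lambda>u n. \<Sum>\<^sub>\<infinity>m. k n m * u m)"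
  have sm: "(\<lambda>m. k n m * u m) summable_on UNIV" if "u \<in> l2" for u n
    by (rule abs_summable_summable[OF schur_summable[OF k \<kappa>' l2_component[OF that]]])
  have R: "bounded_l2_op R"
    unfolding bounded_l2_op_def
  proof (intro conjI ballI allI)
    show "R u \<in> l2" if "u \<in> l2" for u unfolding R_def by (rule schur_test[OF k \<kappa>' that])
    show "R (\<lambda>n. u n + v n) = (\<lambda>n. R u n + R v n)" if "u \<in> l2" "v \<in> l2" for u v
      unfolding R_def distrib_left by (rule ext) (rule infsum_add[OF sm[OF that(1)] sm[OF that(2)]])
    show "R (\<lambda>n. c * u n) = (\<lambda>n. c * R u n)" if "u \<in> l2" for c u
    proof
      fix n
      have "(\<Sum>\<^sub>\<infinity>m. k n m * (c * u m)) = (\<Sum>\<^sub>\<infinity>m. c * (k n m * u m))" by (simp add: mult_ac)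
      thus "R (\<lambda>n. c * u n) n = c * R u n" by (simp add: R_def infsum_cmult_right')
    qed
    show "\<exists>C. \<forall>u\<in>l2. l2_norm (R u) \<le> C * l2_norm u"
      unfolding R_def using schur_test(2)[OF k \<kappa>'] by blast
  qed
  have LR: "L \<theta> (R u) = u" if u: "u \<in> l2" for u
  proof
    fix n
    define B where "B = l2_norm u"
    have B: "\<And>m. cmod (u m) \<le> B" "0 \<le> B" using l2_component[OF u] l2_norm_nonneg by (auto simp: B_def)
    have a1: "(\<lambda>j. cmod (\<alpha> j)) summable_on UNIV"
      using wsummable_mono[OF wsummable_\<alpha>, of "\<lambda>_. 1"] wt_ge1 by (simp add: wsummable_def)
    have \<kappa>n: "(\<lambda>m. \<kappa>' (n - m)) summable_on UNIV" "(\<Sum>\<^sub>\<infinity>m. \<kappa>' (n - m)) = infsum \<kappa>' UNIV" for n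
      using \<kappa>' summable_int_reflect[of \<kappa>' n] infsum_int_reflect[of \<kappa>' n] by auto
    \<comment> \<open>Absolute summability over pairs, needed to exchange the sum of the symbol with
      the sum of the kernel.\<close>
    have dom: "(\<lambda>(j, m). cmod (\<alpha> j) * (\<kappa>' (n + j - m) * B)) summable_on UNIV \<times> UNIV"
    proof (rule abs_summable_summable, subst Infinite_Sum.abs_summable_on_Sigma_iff, intro conjI ballI)
      show "(\<lambda>y. norm (case (x, y) of (j, m) \<Rightarrow> cmod (\<alpha> j) * (\<kappa>' (n + j - m) * B))) summable_on UNIV" for x
        using summable_on_cmult_right[OF summable_on_cmult_left[OF \<kappa>n(1)[of "n + x"], of B], of "cmod (\<alpha> x)"] \<kappa>0 B
        by (simp add: abs_mult)
      have "(\<Sum>\<^sub>\<infinity>y. norm (case (x, y) of (j, m) \<Rightarrow> cmod (\<alpha> j) * (\<kappa>' (n + j - m) * B))) = cmod (\<alpha> x) * (infsum \<kappa>' UNIV * B)" for x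
        using \<kappa>0 B \<kappa>n(2)[of "n + x"] by (simp add: abs_mult infsum_cmult_right' infsum_cmult_left')
      thus "(\<lambda>x. norm (\<Sum>\<^sub>\<infinity>y\<in>UNIV. norm (case (x, y) of (j, m) \<Rightarrow> cmod (\<alpha> j) * (\<kappa>' (n + j - m) * B)))) summable_on UNIV"
        using summable_on_cmult_left[OF a1, of "norm (infsum \<kappa>' UNIV * B)"] by (simp add: abs_mult)
    qed
    have pair: "(\<lambda>(j, m). \<alpha> j * (k (n + j) m * u m)) summable_on UNIV \<times> UNIV"
    proof (rule abs_summable_summable, rule Infinite_Sum.abs_summable_on_comparison_test'[OF dom])
      fix x :: "int \<times> int"
      have "cmod (k (n + fst x) (snd x)) * cmod (u (snd x)) \<le> \<kappa>' (n + fst x - snd x) * B"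
        by (rule mult_mono[OF k B(1) \<kappa>0]) simp
      hence "cmod (\<alpha> (fst x)) * (cmod (k (n + fst x) (snd x)) * cmod (u (snd x))) \<le> cmod (\<alpha> (fst x)) * (\<kappa>' (n + fst x - snd x) * B)"
        by (rule mult_left_mono) simp
      thus "norm (case x of (j, m) \<Rightarrow> \<alpha> j * (k (n + j) m * u m)) \<le> (case x of (j, m) \<Rightarrow> cmod (\<alpha> j) * (\<kappa>' (n + j - m) * B))"
        by (simp add: case_prod_unfold norm_mult)
    qed
    have col: "(\<Sum>\<^sub>\<infinity>j. \<alpha> j * k (n + j) m) + w (ziter T n \<theta>) * k n m = deltaf m n" for m
    proof -
      have "L (ziter T (m + 1) \<theta>) (\<Gamma> (ziter T (m + 1) \<theta>)) (n - m - 1) =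
         (\<Sum>\<^sub>\<infinity>j. \<alpha> j * k (n + j) m) + w (ziter T n \<theta>) * k n m"
        unfolding L_def symop_def k_def ziter_add[OF bijT, symmetric] by (simp add: algebra_simps)
      thus ?thesis unfolding \<Gamma>(2) by (auto simp: deltaf_def)
    qed
    have kn: "(\<lambda>m. k n m * u m) summable_on UNIV" by (rule sm[OF u])
    have jn: "(\<lambda>m. (\<Sum>\<^sub>\<infinity>j. \<alpha> j * k (n + j) m) * u m) summable_on UNIV"
    proof -
      have "(\<lambda>(m, j). \<alpha> j * (k (n + j) m * u m)) summable_on UNIV \<times> UNIV"
        using pair by (subst summable_on_swap) (simp add: case_prod_unfold)
      from summable_on_Sigma_banach[OF this] show ?thesis
        by (simp add: infsum_cmult_left'[symmetric] mult.assoc)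
    qed
    have "symop \<alpha> (R u) n = (\<Sum>\<^sub>\<infinity>j. \<Sum>\<^sub>\<infinity>m. \<alpha> j * (k (n + j) m * u m))"
      unfolding symop_def R_def by (simp add: infsum_cmult_right')
    also have "\<dots> = (\<Sum>\<^sub>\<infinity>m. \<Sum>\<^sub>\<infinity>j. \<alpha> j * (k (n + j) m * u m))" by (rule infsum_swap_banach[OF pair])
    also have "\<dots> = (\<Sum>\<^sub>\<infinity>m. (\<Sum>\<^sub>\<infinity>j. \<alpha> j * k (n + j) m) * u m)"
      by (simp add: infsum_cmult_left'[symmetric] mult.assoc)
    finally have "L \<theta> (R u) n = (\<Sum>\<^sub>\<infinity>m. (\<Sum>\<^sub>\<infinity>j. \<alpha> j * k (n + j) m) * u m) + (\<Sum>\<^sub>\<infinity>m. w (ziter T n \<theta>) * (k n m * u m))"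
      unfolding L_def by (simp add: R_def infsum_cmult_right')
    also have "\<dots> = (\<Sum>\<^sub>\<infinity>m. (\<Sum>\<^sub>\<infinity>j. \<alpha> j * k (n + j) m) * u m + w (ziter T n \<theta>) * (k n m * u m))"
      by (rule infsum_add[symmetric, OF jn summable_on_cmult_right[OF kn]])
    also have "\<dots> = (\<Sum>\<^sub>\<infinity>m. deltaf m n * u m)"
      unfolding col[symmetric] by (simp add: distrib_right mult.assoc)
    also have "\<dots> = (\<Sum>\<^sub>\<infinity>m\<in>{n}. deltaf m n * u m)"
      by (rule infsum_cong_neutral) (auto simp: deltaf_def)
    finally show "L \<theta> (R u) n = u n" by (simp add: deltaf_def)
  qed
  have RL: "R (L \<theta> u) = u" if u: "u \<in> l2" for u
  proof -
    have Lu: "L \<theta> u \<in> l2" by (rule L_l2[OF u])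
    have RLu: "R (L \<theta> u) \<in> l2" using R Lu unfolding bounded_l2_op_def by blast
    \<comment> \<open>Both sequences have the same image under L, and their difference is
      bounded.\<close>
    have "(\<lambda>n. R (L \<theta> u) n - u n) = (\<lambda>n. 0)"
    proof (rule inj)
      show "cmod (R (L \<theta> u) n - u n) \<le> l2_norm (\<lambda>n. R (L \<theta> u) n - u n)" for n
        using l2_component[OF l2_diff[OF RLu u], of n] .
      show "L \<theta> (\<lambda>n. R (L \<theta> u) n - u n) n = 0" for n
        unfolding L_diff[OF l2_wt[OF RLu] l2_wt[OF u]] LR[OF Lu] by simp
    qed
    thus ?thesis by (auto simp: fun_eq_iff)
  qed
  show ?thesis unfolding l2_invertible_def using R RL LR by blast
qed

end

section \<open>Uniform hyperbolicity implies invertibility\<close>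

lemma cvec_norm_diff:
  assumes "x \<in> carrier_vec n" "y \<in> carrier_vec n"
  shows "cvec_norm (x - y) \<le> cvec_norm x + cvec_norm y"
proof -
  have "cvec_norm (x - y) = L2_set (\<lambda>i. cmod (x $ i - y $ i)) {..<n}"
    unfolding cvec_norm_def using assms by (intro L2_set_cong) auto
  also have "\<dots> \<le> L2_set (\<lambda>i. cmod (x $ i) + cmod (y $ i)) {..<n}"
    by (rule L2_set_mono) (auto simp: norm_triangle_ineq4)
  also have "\<dots> \<le> cvec_norm x + cvec_norm y"
    using L2_set_triangle_ineq[of "\<lambda>i. cmod (x $ i)" "\<lambda>i. cmod (y $ i)" "{..<n}"] assms by (simp add: cvec_norm_def)
  finally show ?thesis .
qed

context center
begin

lemma Ev_window_bound:
  assumes "x \<in> carrier_vec q" "\<And>i. i < q \<Longrightarrow> cmod (Ev \<theta> x (int i)) \<le> B"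
  shows "cvec_norm x \<le> Kf * real q * B"
proof -
  have "(\<Sum>i<q. cmod (Ev \<theta> x (int i))) \<le> real q * B"
    using sum_bounded_above[of "{..<q}" "\<lambda>i. cmod (Ev \<theta> x (int i))" B] assms(2) by simp
  hence "Kf * (\<Sum>i<q. cmod (Ev \<theta> x (int i))) \<le> Kf * (real q * B)" using Kf by (rule mult_left_mono)
  thus ?thesis using Ev_lower[OF assms(1), of \<theta>] by (simp add: mult.assoc)
qed

lemma ziter_back: "(T ^^ n) (ziter T (- int n) \<theta>) = \<theta>"
  using ziter_add[OF bijT, of "int n" "- int n" \<theta>] by (simp add: ziter_nat)

lemma geometric_zero:
  fixes c :: real
  assumes "\<And>n. c \<le> A * lam ^ n" "0 < lam" "lam < 1" "0 \<le> c"
  shows "c = 0"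
proof -
  have "(\<lambda>n. A * lam ^ n) \<longlonglongrightarrow> A * 0"
    by (intro tendsto_mult tendsto_const LIMSEQ_power_zero) (use assms in simp)
  hence "c \<le> A * 0" by (rule LIMSEQ_le_const) (use assms in auto)
  thus ?thesis using assms(4) by simp
qed

lemma iter_image:
  assumes "\<And>\<theta>. (\<lambda>v. cc \<theta> *\<^sub>v v) ` F \<theta> = F (T \<theta>)" "\<And>\<theta>. F \<theta> \<subseteq> carrier_vec q"
  shows "(\<lambda>v. cocycle_iter q T cc n \<theta> *\<^sub>v v) ` F \<theta> = F ((T ^^ n) \<theta>)"
proof (induction n)
  case 0
  have "cocycle_iter q T cc 0 \<theta> *\<^sub>v v = v" if "v \<in> F \<theta>" for v
    using subsetD[OF assms(2) that] by simp
  thus ?case by force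
next
  case (Suc n)
  have "(\<lambda>v. cocycle_iter q T cc (Suc n) \<theta> *\<^sub>v v) ` F \<theta> =
     (\<lambda>v. cc ((T ^^ n) \<theta>) *\<^sub>v v) ` (\<lambda>v. cocycle_iter q T cc n \<theta> *\<^sub>v v) ` F \<theta>"
    unfolding image_image by (intro image_cong refl iter_Suc_mult subsetD[OF assms(2)])
  thus ?case unfolding Suc assms(1) by simp
qed

text \<open>Compactness of the base turns continuity of the projections into one norm bound, that
  is, into an angle between the two bundles that is bounded away from 0.\<close>

lemma mat_bounded:
  fixes P :: "'a \<Rightarrow> complex mat"
  assumes "compact (UNIV :: 'a set)" "continuous_mat q P"
  shows "\<exists>K\<ge>0. \<forall>\<theta>. \<forall>x\<in>carrier_vec q. cvec_norm (P \<theta> *\<^sub>v x) \<le> K * cvec_norm x"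
proof -
  have "\<exists>B. \<forall>\<theta>. cmod (P \<theta> $$ (i, j)) \<le> B" if "i < q" "j < q" for i j
  proof -
    have "compact (range (\<lambda>\<theta>. P \<theta> $$ (i, j)))"
      by (rule compact_continuous_image) (use assms that in \<open>auto simp: continuous_mat_def\<close>)
    thus ?thesis using compact_imp_bounded bounded_iff by (metis rangeI)
  qed
  then obtain B where B: "\<And>i j \<theta>. i < q \<Longrightarrow> j < q \<Longrightarrow> cmod (P \<theta> $$ (i, j)) \<le> B i j" by metis
  have B0: "0 \<le> B i j" if "i < q" "j < q" for i j using B[OF that] norm_ge_zero order_trans by blast
  show ?thesis
  proof (intro exI[of _ "\<Sum>i<q. \<Sum>j<q. B i j"] conjI allI ballI)
    show "0 \<le> (\<Sum>i<q. \<Sum>j<q. B i j)" by (intro sum_nonneg B0) auto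
    fix \<theta> and x :: "complex vec" assume x: "x \<in> carrier_vec q"
    have P: "P \<theta> \<in> carrier_mat q q" using assms by (simp add: continuous_mat_def)
    have "cvec_norm (P \<theta> *\<^sub>v x) \<le> (\<Sum>i<q. cmod ((P \<theta> *\<^sub>v x) $ i))"
      by (rule cvec_norm_le_sum) (use P x in auto)
    also have "\<dots> \<le> (\<Sum>i<q. \<Sum>j<q. B i j * cvec_norm x)"
    proof (rule sum_mono)
      fix i assume i: "i \<in> {..<q}"
      have "(P \<theta> *\<^sub>v x) $ i = (\<Sum>j<q. P \<theta> $$ (i, j) * x $ j)"
        using P x i by (simp add: scalar_prod_def atLeast0LessThan)
      also have "cmod \<dots> \<le> (\<Sum>j<q. B i j * cvec_norm x)"
        by (rule sum_norm_le) (use i in \<open>auto simp: norm_mult intro!: mult_mono B B0 cvec_norm_component[OF x]\<close>)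
      finally show "cmod ((P \<theta> *\<^sub>v x) $ i) \<le> (\<Sum>j<q. B i j * cvec_norm x)" .
    qed
    also have "\<dots> = (\<Sum>i<q. \<Sum>j<q. B i j) * cvec_norm x" by (simp add: sum_distrib_right)
    finally show "cvec_norm (P \<theta> *\<^sub>v x) \<le> (\<Sum>i<q. \<Sum>j<q. B i j) * cvec_norm x" .
  qed
qed

lemma subspace_carrier:
  "VectorSpace.subspace class_ring F (module_vec TYPE(complex) n) \<Longrightarrow> F \<subseteq> carrier_vec n"
  by (auto simp: VectorSpace.subspace_def submodule_def module_vec_def)

theorem invertible_of_hyperbolic:
  assumes cpt: "compact (UNIV :: 'a set)" and UH: "uniformly_hyperbolic q T cc"
  shows "l2_invertible \<theta>"
proof -
  obtain Es Eu K lam where split: "continuous_splitting q Es Eu"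
    and inv: "\<And>\<theta>. (\<lambda>v. cc \<theta> *\<^sub>v v) ` Es \<theta> = Es (T \<theta>)" "\<And>\<theta>. (\<lambda>v. cc \<theta> *\<^sub>v v) ` Eu \<theta> = Eu (T \<theta>)"
    and K: "0 < K" and lam: "0 < lam" "lam < 1"
    and Es: "\<And>\<theta> n v. v \<in> Es \<theta> \<Longrightarrow> cvec_norm (cocycle_iter q T cc n \<theta> *\<^sub>v v) \<le> K * lam ^ n * cvec_norm v"
    and Eu: "\<And>\<theta> n v. v \<in> Eu \<theta> \<Longrightarrow> cvec_norm v \<le> K * lam ^ n * cvec_norm (cocycle_iter q T cc n \<theta> *\<^sub>v v)"
    using UH unfolding uniformly_hyperbolic_def by (elim exE conjE) blast
  obtain P :: "'a \<Rightarrow> complex mat" where P: "continuous_mat q P" "\<And>\<theta> v. v \<in> Es \<theta> \<Longrightarrow> P \<theta> *\<^sub>v v = v" "\<And>\<theta> v. v \<in> Eu \<theta> \<Longrightarrow> P \<theta> *\<^sub>v v = 0\<^sub>v q"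
    using split unfolding continuous_splitting_def by blast
  have subs: "Es \<theta> \<subseteq> carrier_vec q" "Eu \<theta> \<subseteq> carrier_vec q" for \<theta>
    using split subspace_carrier unfolding continuous_splitting_def by blast+
  have dec: "\<exists>a\<in>Es \<theta>. \<exists>b\<in>Eu \<theta>. x = a + b" if "x \<in> carrier_vec q" for x \<theta>
    using split that unfolding continuous_splitting_def by blast
  obtain KP where KP: "0 \<le> KP" "\<And>\<theta> x. x \<in> carrier_vec q \<Longrightarrow> cvec_norm (P \<theta> *\<^sub>v x) \<le> KP * cvec_norm x"
    using mat_bounded[OF cpt P(1)] by blast
  define Ku where "Ku = real q * (2 * growth_const) * \<omega> 0"
  have Ku: "0 \<le> Ku" using growth_const_nonneg wt_pos[of 0] by (simp add: Ku_def)
  have Ev0: "cmod (Ev \<theta> x 0) \<le> Ku * cvec_norm x" if "x \<in> carrier_vec q" for \<theta> x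
    using Ev_bound[OF that] by (simp add: Ku_def)
  have stable: "cmod (Ev \<theta> x (int n)) \<le> Ku * K * lam ^ n * cvec_norm x" if x: "x \<in> Es \<theta>" for \<theta> x n
  proof -
    have c: "x \<in> carrier_vec q" using x subs by blast
    have "cmod (Ev \<theta> x (int n)) = cmod (Ev ((T ^^ n) \<theta>) (cocycle_iter q T cc n \<theta> *\<^sub>v x) 0)"
      by (simp add: Ev_iter[OF c])
    also have "\<dots> \<le> Ku * cvec_norm (cocycle_iter q T cc n \<theta> *\<^sub>v x)" by (rule Ev0[OF iter_mult_carrier[OF c]])
    also have "\<dots> \<le> Ku * (K * lam ^ n * cvec_norm x)" by (rule mult_left_mono[OF Es[OF x] Ku])
    finally show ?thesis by (simp add: mult_ac)
  qed
  \<comment> \<open>Invariance allows a vector to be pulled back n steps; the pulled-back vector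
    represents the same sequence, shifted.\<close>
  have pull: "\<exists>y\<in>F (ziter T (- int n) \<theta>). x = cocycle_iter q T cc n (ziter T (- int n) \<theta>) *\<^sub>v y \<and>
      (\<forall>k. Ev (ziter T (- int n) \<theta>) y k = Ev \<theta> x (k - int n))"
    if F: "\<And>\<theta>. (\<lambda>v. cc \<theta> *\<^sub>v v) ` F \<theta> = F (T \<theta>)" "\<And>\<theta>. F \<theta> \<subseteq> carrier_vec q" and x: "x \<in> F \<theta>" for F \<theta> x n
  proof -
    let ?t = "ziter T (- int n) \<theta>"
    have "x \<in> (\<lambda>v. cocycle_iter q T cc n ?t *\<^sub>v v) ` F ?t"
      unfolding iter_image[OF F] ziter_back by (rule x)
    then obtain y where y: "y \<in> F ?t" "x = cocycle_iter q T cc n ?t *\<^sub>v y" by blast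
    have yc: "y \<in> carrier_vec q" using y F(2) by blast
    have "Ev ?t y k = Ev \<theta> x (k - int n)" for k
      using Ev_iter[OF yc, of n ?t "k - int n"] y(2) by (simp add: ziter_back)
    thus ?thesis using y by blast
  qed
  have unstable: "cmod (Ev \<theta> x (- int n)) \<le> Ku * K * lam ^ n * cvec_norm x" if x: "x \<in> Eu \<theta>" for \<theta> x n
  proof -
    obtain y where y: "y \<in> Eu (ziter T (- int n) \<theta>)" "x = cocycle_iter q T cc n (ziter T (- int n) \<theta>) *\<^sub>v y"
      "\<And>k. Ev (ziter T (- int n) \<theta>) y k = Ev \<theta> x (k - int n)"
      using pull[OF inv(2) subs(2) x] by blast
    have c: "y \<in> carrier_vec q" using y subs by blast
    have "cmod (Ev \<theta> x (- int n)) = cmod (Ev (ziter T (- int n) \<theta>) y 0)" by (simp add: y(3))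
    also have "\<dots> \<le> Ku * cvec_norm y" by (rule Ev0[OF c])
    also have "\<dots> \<le> Ku * (K * lam ^ n * cvec_norm x)" using mult_left_mono[OF Eu[OF y(1)] Ku] y(2) by simp
    finally show ?thesis by (simp add: mult_ac)
  qed
  \<comment> \<open>A bounded solution can have neither an unstable part, which would grow forwards,
    nor a stable part, which would grow backwards.\<close>
  have inj: "u = (\<lambda>n. 0)" if u: "\<And>n. cmod (u n) \<le> B" "\<And>n. L \<theta> u n = 0" for u B \<theta>
  proof -
    have B0: "0 \<le> B" using u(1)[of 0] norm_ge_zero order_trans by blast
    have "cmod (u n) \<le> B * \<omega> n" for n using u(1)[of n] mult_left_mono[OF wt_ge1[of n] B0] by simp
    hence "in_center \<theta> u" unfolding in_center_def using u(2) by blast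
    then obtain x where x: "x \<in> carrier_vec q" "Ev \<theta> x = u" using Ev_span by blast
    obtain a b where ab: "a \<in> Es \<theta>" "b \<in> Eu \<theta>" "x = a + b" using dec[OF x(1)] by blast
    have c: "a \<in> carrier_vec q" "b \<in> carrier_vec q" using ab subs by blast+
    \<comment> \<open>Forwards u and its stable part are bounded, hence so is the unstable part;
      expansion then forces it to vanish.\<close>
    have b: "cvec_norm b = 0"
    proof (rule geometric_zero[OF _ lam cvec_norm_nonneg])
      fix n
      let ?bn = "cocycle_iter q T cc n \<theta> *\<^sub>v b"
      have "cvec_norm ?bn \<le> Kf * real q * (B + Ku * K * cvec_norm a)"
      proof (rule Ev_window_bound[OF iter_mult_carrier[OF c(2)], of "(T ^^ n) \<theta>"])
        fix i assume "i < q"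
        have "Ev ((T ^^ n) \<theta>) ?bn (int i) = Ev \<theta> b (int (i + n))" by (simp add: Ev_iter[OF c(2)])
        also have "\<dots> = u (int (i + n)) - Ev \<theta> a (int (i + n))"
          unfolding x(2)[symmetric] ab(3) Ev_add[OF c] by simp
        finally have "cmod (Ev ((T ^^ n) \<theta>) ?bn (int i)) \<le> B + cmod (Ev \<theta> a (int (i + n)))"
          using norm_triangle_ineq4[of "u (int (i + n))" "Ev \<theta> a (int (i + n))"] u(1)[of "int (i + n)"] by simp
        also have "cmod (Ev \<theta> a (int (i + n))) \<le> Ku * K * lam ^ (i + n) * cvec_norm a" by (rule stable[OF ab(1)])
        also have "\<dots> \<le> Ku * K * 1 * cvec_norm a"
          using Ku K lam by (intro mult_right_mono mult_left_mono power_le_one cvec_norm_nonneg) auto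
        finally show "cmod (Ev ((T ^^ n) \<theta>) ?bn (int i)) \<le> B + Ku * K * cvec_norm a" by simp
      qed
      hence "K * lam ^ n * cvec_norm ?bn \<le> K * lam ^ n * (Kf * real q * (B + Ku * K * cvec_norm a))"
        using K lam by (intro mult_left_mono) auto
      thus "cvec_norm b \<le> (K * (Kf * real q * (B + Ku * K * cvec_norm a))) * lam ^ n"
        using Eu[OF ab(2), of n] by (simp add: mult_ac)
    qed
    have "Ev \<theta> b n = 0" for n using Ev_bound[OF c(2), of \<theta> n] b by simp
    hence ua: "Ev \<theta> a n = u n" for n using x(2) ab(3) Ev_add[OF c, of \<theta> n] by simp
    have a: "cvec_norm a = 0"
    proof (rule geometric_zero[OF _ lam cvec_norm_nonneg])
      fix n
      obtain y where y: "y \<in> Es (ziter T (- int n) \<theta>)" "a = cocycle_iter q T cc n (ziter T (- int n) \<theta>) *\<^sub>v y"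
        "\<And>k. Ev (ziter T (- int n) \<theta>) y k = Ev \<theta> a (k - int n)"
        using pull[OF inv(1) subs(1) ab(1)] by blast
      have yc: "y \<in> carrier_vec q" using y subs by blast
      have "cvec_norm y \<le> Kf * real q * B"
        by (rule Ev_window_bound[OF yc, of "ziter T (- int n) \<theta>"]) (simp add: y(3) ua u(1))
      hence "K * lam ^ n * cvec_norm y \<le> K * lam ^ n * (Kf * real q * B)"
        using K lam by (intro mult_left_mono) auto
      thus "cvec_norm a \<le> (K * (Kf * real q * B)) * lam ^ n"
        using Es[OF y(1), of n] y(2) by (simp add: mult_ac)
    qed
    have "u n = 0" for n using Ev_bound[OF c(1), of \<theta> n] a ua[of n] by simp
    thus ?thesis by blast
  qed
  define D where "D = 2 * p.\<beta> * rp + 2 * m.\<beta> * rm"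
  have D0: "0 \<le> 2 * p.\<beta> * rp" "0 \<le> 2 * m.\<beta> * rm" using p.\<beta>_nonneg m.\<beta>_nonneg rp_pos rm_pos by auto
  define Kx where "Kx = Kf * real q * (D * rp ^ q)"
  \<comment> \<open>The slowest of three rates: the hyperbolic one, that of \<open>m.H\<close> at
    +infinity and that of \<open>p.H\<close> at -infinity.\<close>
  define \<mu> where "\<mu> = max lam (max rm (1 / rp))"
  have \<mu>: "0 < \<mu>" "\<mu> < 1" "lam \<le> \<mu>" "rm \<le> \<mu>" "1 / rp \<le> \<mu>" using lam rm_pos rm_less rp_gt by (auto simp: \<mu>_def)
  define K\<Gamma> where "K\<Gamma> = D + Ku * K * ((1 + KP) * Kx)"
  text \<open>The stable and unstable parts of the difference of the two Green's functions turn either of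
    them into a solution that decays at both ends.\<close>
  have "\<exists>v. (\<forall>n. L \<theta> v n = deltaf (- 1) n) \<and> (\<forall>n. cmod (v n) \<le> K\<Gamma> * \<mu> ^ nat \<bar>n\<bar>)" for \<theta>
  proof -
    obtain x where x: "x \<in> carrier_vec q" "Ev \<theta> x = (\<lambda>n. p.H 0 \<theta> n - m.H 0 \<theta> n)"
      using Ev_span[OF in_center_H] by blast
    obtain a b where ab: "a \<in> Es \<theta>" "b \<in> Eu \<theta>" "x = a + b" using dec[OF x(1)] by blast
    have c: "a \<in> carrier_vec q" "b \<in> carrier_vec q" using ab subs by blast+
    have xn: "cvec_norm x \<le> Kx"
      unfolding Kx_def
    proof (rule Ev_window_bound[OF x(1), of \<theta>])
      fix i assume i: "i < q"
      have "cmod (p.H 0 \<theta> (int i)) \<le> 2 * p.\<beta> * rp * \<omega> (int i)" "cmod (m.H 0 \<theta> (int i)) \<le> 2 * m.\<beta> * rm * \<omega> (int i)"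
        using Hp_wt[of 0 \<theta> "int i"] Hm_wt[of 0 \<theta> "int i"] by simp_all
      hence "cmod (Ev \<theta> x (int i)) \<le> D * \<omega> (int i)"
        unfolding x(2) using norm_triangle_ineq4[of "p.H 0 \<theta> (int i)" "m.H 0 \<theta> (int i)"] by (simp add: D_def distrib_right)
      also have "\<dots> \<le> D * rp ^ q"
        unfolding wt_nat using i rp_gt D0 by (intro mult_left_mono power_increasing) (auto simp: D_def)
      finally show "cmod (Ev \<theta> x (int i)) \<le> D * rp ^ q" .
    qed
    have Kx0: "0 \<le> Kx" using xn cvec_norm_nonneg order_trans by blast
    have "P \<theta> *\<^sub>v x = a"
    proof -
      have "P \<theta> \<in> carrier_mat q q" using P(1) by (simp add: continuous_mat_def)
      hence "P \<theta> *\<^sub>v x = P \<theta> *\<^sub>v a + P \<theta> *\<^sub>v b" unfolding ab(3) by (rule mult_add_distrib_mat_vec[OF _ c])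
      thus ?thesis using P(2)[OF ab(1)] P(3)[OF ab(2)] c by simp
    qed
    hence an: "cvec_norm a \<le> KP * Kx" using KP(2)[OF x(1), of \<theta>] mult_left_mono[OF xn KP(1)] by simp
    have bn: "cvec_norm b \<le> (1 + KP) * Kx"
    proof -
      have "b = x - a" unfolding ab(3) using c by (intro eq_vecI) auto
      moreover have "cvec_norm (x - a) \<le> cvec_norm x + cvec_norm a" by (rule cvec_norm_diff[OF x(1) c(1)])
      ultimately show ?thesis using xn an by (simp add: distrib_right)
    qed
    have an': "cvec_norm a \<le> (1 + KP) * Kx" using an Kx0 by (simp add: distrib_right)
    \<comment> \<open>One sequence in two forms: \<open>p.H 0\<close> minus the unstable part is
      estimated on the left, \<open>m.H 0\<close> plus the stable part on the right.\<close>
    define v where "v = (\<lambda>n. p.H 0 \<theta> n - Ev \<theta> b n)"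
    have v': "v n = m.H 0 \<theta> n + Ev \<theta> a n" for n
      using fun_cong[OF x(2), of n] Ev_add[OF c, of \<theta> n] by (simp add: v_def ab(3) algebra_simps)
    have "in_center \<theta> (Ev \<theta> b)" by (rule in_center_Ev[OF c(2)])
    then obtain C where C: "\<And>n. cmod (Ev \<theta> b n) \<le> C * \<omega> n" "\<And>n. L \<theta> (Ev \<theta> b) n = 0"
      unfolding in_center_def by blast
    have Lv: "L \<theta> v n = deltaf (- 1) n" for n
      unfolding v_def L_diff[OF Hp_wt C(1)] L_Hp C(2) by simp
    have "cmod (v n) \<le> K\<Gamma> * \<mu> ^ nat \<bar>n\<bar>" for n
    proof (cases n rule: int_cases2)
      case (nonneg k)
      have "cmod (m.H 0 \<theta> n) \<le> 2 * m.\<beta> * rm * rm ^ k" using m.H_bound[of 0 \<theta> n] nonneg by simp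
      also have "\<dots> \<le> D * \<mu> ^ k"
        using D0 \<mu> rm_pos by (intro mult_mono power_mono) (auto simp: D_def)
      finally have 1: "cmod (m.H 0 \<theta> n) \<le> D * \<mu> ^ k" .
      have "cmod (Ev \<theta> a n) \<le> Ku * K * lam ^ k * cvec_norm a" using stable[OF ab(1), of k] nonneg by simp
      also have "\<dots> \<le> Ku * K * \<mu> ^ k * ((1 + KP) * Kx)"
        using Ku K lam \<mu> by (intro mult_mono power_mono an' cvec_norm_nonneg mult_nonneg_nonneg) auto
      finally show ?thesis using 1 nonneg norm_triangle_ineq[of "m.H 0 \<theta> n" "Ev \<theta> a n"]
        by (simp add: v' K\<Gamma>_def algebra_simps)
    next
      case (nonpos k)
      have "cmod (p.H 0 \<theta> n) \<le> 2 * p.\<beta> * rp * (1 / rp) ^ k"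
        using p.H_bound[of 0 \<theta> n] nonpos by (simp add: power_int_minus power_divide divide_inverse power_inverse)
      also have "\<dots> \<le> D * \<mu> ^ k"
        using D0 \<mu> rp_pos by (intro mult_mono power_mono) (auto simp: D_def)
      finally have 1: "cmod (p.H 0 \<theta> n) \<le> D * \<mu> ^ k" .
      have "cmod (Ev \<theta> b n) \<le> Ku * K * lam ^ k * cvec_norm b" using unstable[OF ab(2), of k] nonpos by simp
      also have "\<dots> \<le> Ku * K * \<mu> ^ k * ((1 + KP) * Kx)"
        using Ku K lam \<mu> by (intro mult_mono power_mono bn cvec_norm_nonneg mult_nonneg_nonneg) auto
      finally show ?thesis using 1 nonpos norm_triangle_ineq4[of "p.H 0 \<theta> n" "Ev \<theta> b n"]
        by (simp add: v_def K\<Gamma>_def algebra_simps)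
    qed
    thus ?thesis using Lv by blast
  qed
  then obtain \<Gamma> where \<Gamma>: "\<And>\<theta> n. L \<theta> (\<Gamma> \<theta>) n = deltaf (- 1) n" "\<And>\<theta> n. cmod (\<Gamma> \<theta> n) \<le> K\<Gamma> * \<mu> ^ nat \<bar>n\<bar>" by metis
  show ?thesis by (rule invertible_of_green[OF \<mu>(1,2) \<Gamma>(2,1) inj])
qed

end

section \<open>Exponential decay of the resolvent\<close>

text \<open>Raising both bases to the k-th power keeps the ratio of their excesses over 1 at most
  \<delta>. This makes the effect of a slightly growing weight small, uniformly in k, relative to a
  fixed summable one.\<close>

lemma power_convex_bound:
  fixes \<rho> \<rho>1 \<delta> :: real
  assumes "1 \<le> \<rho>" "\<rho> \<le> \<rho>1" "\<rho> - 1 \<le> \<delta> * (\<rho>1 - 1)" "0 \<le> \<delta>"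
  shows "\<rho> ^ k - 1 \<le> \<delta> * (\<rho>1 ^ k - 1)"
proof (induction k)
  case (Suc k)
  have "1 \<le> \<rho>1 ^ k" using assms by (intro one_le_power) auto
  hence "\<rho> * (\<delta> * (\<rho>1 ^ k - 1)) \<le> \<rho>1 * (\<delta> * (\<rho>1 ^ k - 1))" using assms by (intro mult_right_mono) auto
  moreover have "\<rho> * (\<rho> ^ k - 1) \<le> \<rho> * (\<delta> * (\<rho>1 ^ k - 1))" using Suc assms by (intro mult_left_mono) auto
  moreover have "\<rho> ^ Suc k - 1 = \<rho> * (\<rho> ^ k - 1) + (\<rho> - 1)" by (simp add: algebra_simps)
  ultimately show ?case using assms(3) by (simp add: algebra_simps)
qed simp

lemma l2_norm_add_sq:
  assumes "u \<in> l2" "v \<in> l2"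
  shows "(l2_norm (\<lambda>n. u n + v n))\<^sup>2 \<le> 2 * (l2_norm u)\<^sup>2 + 2 * (l2_norm v)\<^sup>2"
proof -
  have 1: "(cmod (u n + v n))\<^sup>2 \<le> 2 * (cmod (u n))\<^sup>2 + 2 * (cmod (v n))\<^sup>2" for n
  proof -
    have "(cmod (u n + v n))\<^sup>2 \<le> (cmod (u n) + cmod (v n))\<^sup>2" by (intro power_mono norm_triangle_ineq) simp
    also have "\<dots> \<le> 2 * (cmod (u n))\<^sup>2 + 2 * (cmod (v n))\<^sup>2"
      using sum_squares_bound[of "cmod (u n)" "cmod (v n)"] by (simp add: power2_sum)
    finally show ?thesis .
  qed
  have s: "(\<lambda>n. 2 * (cmod (u n))\<^sup>2) summable_on UNIV" "(\<lambda>n. 2 * (cmod (v n))\<^sup>2) summable_on UNIV"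
    by (intro summable_on_cmult_right l2_summable assms)+
  have "(\<Sum>\<^sub>\<infinity>n. (cmod (u n + v n))\<^sup>2) \<le> (\<Sum>\<^sub>\<infinity>n. 2 * (cmod (u n))\<^sup>2 + 2 * (cmod (v n))\<^sup>2)"
    by (rule infsum_mono[OF l2_summable[OF l2_add[OF assms]] summable_on_add[OF s] 1])
  also have "\<dots> = 2 * (l2_norm u)\<^sup>2 + 2 * (l2_norm v)\<^sup>2"
    by (simp add: infsum_add[OF s] infsum_cmult_right' l2_norm_sq)
  finally show ?thesis by (simp add: l2_norm_sq)
qed

lemma l2_exp_decay:
  assumes "\<And>n. cmod (u n) \<le> C * \<mu> ^ nat \<bar>n - c\<bar>" "0 \<le> \<mu>" "\<mu> < 1"
  shows "u \<in> l2" "(l2_norm u)\<^sup>2 \<le> C\<^sup>2 * (\<Sum>\<^sub>\<infinity>n::int. (\<mu>\<^sup>2) ^ nat \<bar>n\<bar>)"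
proof -
  have m: "0 \<le> \<mu>\<^sup>2" "\<mu>\<^sup>2 < 1" using assms by (auto simp: power_less_one_iff abs_square_less_1)
  have b: "(cmod (u n))\<^sup>2 \<le> C\<^sup>2 * (\<mu>\<^sup>2) ^ nat \<bar>n - c\<bar>" for n
    using power_mono[OF assms(1)[of n], of 2] by (simp add: power_mult_distrib flip: power_mult) (simp add: mult.commute)
  have s: "(\<lambda>n. C\<^sup>2 * (\<mu>\<^sup>2) ^ nat \<bar>n - c\<bar>) summable_on UNIV" by (rule exp_decay_summable[OF m])
  have 1: "(\<lambda>n. (cmod (u n))\<^sup>2) summable_on UNIV" by (rule summable_on_comparison_test[OF s b]) simp_all
  thus "u \<in> l2" by (simp add: l2_def)
  have "(l2_norm u)\<^sup>2 \<le> (\<Sum>\<^sub>\<infinity>n. C\<^sup>2 * (\<mu>\<^sup>2) ^ nat \<bar>n - c\<bar>)"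
    unfolding l2_norm_sq by (rule infsum_mono[OF 1 s b])
  also have "\<dots> = C\<^sup>2 * (\<Sum>\<^sub>\<infinity>n::int. (\<mu>\<^sup>2) ^ nat \<bar>n\<bar>)"
    using infsum_int_translate[of "\<lambda>n. (\<mu>\<^sup>2) ^ nat \<bar>n\<bar>" "- c"] by (simp add: infsum_cmult_right')
  finally show "(l2_norm u)\<^sup>2 \<le> C\<^sup>2 * (\<Sum>\<^sub>\<infinity>n::int. (\<mu>\<^sup>2) ^ nat \<bar>n\<bar>)" .
qed

context center
begin

text \<open>Exponential decay of the inverse, expressed without the inverse: a source may grow with
  base \<rho> away from n0 and still influences the entry at n0 only through c. The bound B
  restricts the class of u but does not enter the estimate, which lets the property pass to limits
  of \<theta>.\<close>

definition wstable :: "'a \<Rightarrow> real \<Rightarrow> real \<Rightarrow> bool" where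
  "wstable \<theta> K \<rho> \<longleftrightarrow> (\<forall>u B c n0. (\<forall>n. cmod (u n) \<le> B) \<longrightarrow>
     (\<forall>n. cmod (L \<theta> u n) \<le> c * \<rho> ^ nat \<bar>n - n0\<bar>) \<longrightarrow> cmod (u n0) \<le> K * c)"

lemma wstableD:
  assumes "wstable \<theta> K \<rho>" "\<And>n. cmod (u n) \<le> B" "\<And>n. cmod (L \<theta> u n) \<le> c * \<rho> ^ nat \<bar>n - n0\<bar>"
  shows "cmod (u n0) \<le> K * c"
  using assms unfolding wstable_def by blast

lemma bounded_wt: "(\<And>n. cmod (u n) \<le> B) \<Longrightarrow> cmod (u n) \<le> B * \<omega> n"
  using mult_left_mono[OF wt_ge1[of n], of B] norm_ge_zero[of "u 0"] order_trans[of "cmod (u n)" B "B * \<omega> n"]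
  by (metis mult.right_neutral order_trans)

lemma abs_power_wt:
  assumes "1 \<le> \<rho>" "\<rho> \<le> min rp (1 / rm)"
  shows "\<rho> ^ nat \<bar>n\<bar> \<le> \<omega> n"
proof (cases n rule: int_cases2)
  case (nonneg k) thus ?thesis using assms by (simp add: wt_nat power_mono)
next
  case (nonpos k)
  have "\<rho> ^ k \<le> (1 / rm) ^ k" using assms by (intro power_mono) auto
  thus ?thesis using nonpos by (simp add: wt_neg_nat)
qed

text \<open>Combes--Thomas: conjugation with the weight \<open>(1 / \<rho>\<^sup>2) ^ \<bar>n - n0\<bar>\<close> changes the operator by a
  matrix that is small in the Schur norm when \<open>\<rho>\<close> is close to 1.\<close>

lemma combes_thomas:
  assumes "l2_invertible \<theta>"
  shows "\<exists>K\<ge>0. \<exists>\<rho>>1. \<rho> \<le> min rp (1 / rm) \<and> wstable \<theta> K \<rho>"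
proof -
  obtain R K0 where R: "\<And>u. u \<in> l2 \<Longrightarrow> l2_norm (R u) \<le> K0 * l2_norm u" "\<And>u. u \<in> l2 \<Longrightarrow> R (L \<theta> u) = u"
    using assms unfolding l2_invertible_def bounded_l2_op_def by blast
  define K1 where "K1 = max K0 1"
  have K1: "1 \<le> K1" by (simp add: K1_def)
  have lower: "l2_norm u \<le> K1 * l2_norm (L \<theta> u)" if "u \<in> l2" for u
  proof -
    have "l2_norm u \<le> K0 * l2_norm (L \<theta> u)" using R(1)[OF L_l2[OF that, of \<theta>]] R(2)[OF that] by simp
    also have "\<dots> \<le> K1 * l2_norm (L \<theta> u)" by (intro mult_right_mono l2_norm_nonneg) (simp add: K1_def)
    finally show ?thesis .
  qed
  define \<rho>1 where "\<rho>1 = min rp (1 / rm)"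
  have \<rho>1: "1 < \<rho>1" using rp_gt rm_pos rm_less by (simp add: \<rho>1_def)
  have \<rho>1w: "\<rho>1 ^ nat \<bar>n\<bar> \<le> \<omega> n" for n by (rule abs_power_wt) (use \<rho>1 in \<open>simp_all add: \<rho>1_def\<close>)
  have as: "(\<lambda>j. cmod (\<alpha> j) * \<rho>1 ^ nat \<bar>j\<bar>) summable_on UNIV"
    using wsummable_mono[OF wsummable_\<alpha>, of "\<lambda>j. \<rho>1 ^ nat \<bar>j\<bar>"] \<rho>1 \<rho>1w unfolding wsummable_def by auto
  define A where "A = (\<Sum>\<^sub>\<infinity>j. cmod (\<alpha> j) * \<rho>1 ^ nat \<bar>j\<bar>)"
  have A: "0 \<le> A" unfolding A_def by (rule infsum_nonneg) (use \<rho>1 in simp)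
  have as': "(\<lambda>j. cmod (\<alpha> (- j)) * \<rho>1 ^ nat \<bar>j\<bar>) summable_on UNIV" "(\<Sum>\<^sub>\<infinity>j. cmod (\<alpha> (- j)) * \<rho>1 ^ nat \<bar>j\<bar>) = A"
    using as summable_int_reflect[of "\<lambda>j. cmod (\<alpha> j) * \<rho>1 ^ nat \<bar>j\<bar>" 0] infsum_int_reflect[of "\<lambda>j. cmod (\<alpha> j) * \<rho>1 ^ nat \<bar>j\<bar>" 0]
    by (simp_all add: A_def)
  \<comment> \<open>Keeps the conjugation error, multiplied by the norm bound K1 of the inverse, at
    most 1/2.\<close>
  define \<delta> where "\<delta> = 1 / (2 * (K1 * A + 1))"
  have KA: "0 \<le> K1 * A" using K1 A by simp
  have \<delta>: "0 < \<delta>" "K1 * (\<delta> * A) \<le> 1 / 2" "\<delta> \<le> 1 / 2"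
    using KA by (simp_all add: \<delta>_def field_simps)
  define \<rho>e where "\<rho>e = 1 + \<delta> * (\<rho>1 - 1)"
  \<comment> \<open>The conjugating weight decays with base \<rho>e, the square of \<rho>. One
    factor \<rho> pays for the growth of the source, the other makes the weighted sequences
    square-summable.\<close>
  define \<rho> where "\<rho> = sqrt \<rho>e"
  have dr: "\<delta> * (\<rho>1 - 1) \<le> 1 * (\<rho>1 - 1)" by (rule mult_right_mono) (use \<delta> \<rho>1 in auto)
  have \<rho>e: "1 < \<rho>e" "\<rho>e \<le> \<rho>1"
  proof -
    show "1 < \<rho>e" using \<delta> \<rho>1 by (simp add: \<rho>e_def)
    define y where "y = \<delta> * (\<rho>1 - 1)"
    have "y \<le> \<rho>1 - 1" unfolding y_def using dr unfolding mult_1 .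
    thus "\<rho>e \<le> \<rho>1" unfolding \<rho>e_def y_def[symmetric] by linarith
  qed
  have \<rho>2: "\<rho>\<^sup>2 = \<rho>e" using \<rho>e by (simp add: \<rho>_def)
  have \<rho>: "1 < \<rho>" using \<rho>e by (simp add: \<rho>_def)
  have \<rho>le: "\<rho> \<le> \<rho>1" using \<rho>2 \<rho>e \<rho> mult_left_mono[of 1 \<rho> \<rho>] by (simp add: power2_eq_square)
  have pc: "\<rho>e ^ k - 1 \<le> \<delta> * \<rho>1 ^ k" for k
    using power_convex_bound[of \<rho>e \<rho>1 \<delta> k] \<rho>e \<delta> by (simp add: \<rho>e_def algebra_simps)
  define \<mu> where "\<mu> = 1 / \<rho>"
  have \<mu>: "0 \<le> \<mu>" "\<mu> < 1" "\<mu> * \<rho> = 1" using \<rho> by (auto simp: \<mu>_def)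
  have \<mu>2: "\<mu>\<^sup>2 = 1 / \<rho>e" using \<rho>2 by (simp add: \<mu>_def power_divide)
  define S where "S = (\<Sum>\<^sub>\<infinity>n::int. (\<mu>\<^sup>2) ^ nat \<bar>n\<bar>)"
  have S: "0 \<le> S" unfolding S_def by (rule infsum_nonneg) simp
  have main: "cmod (u n0) \<le> 2 * K1 * sqrt S * c"
    if u: "\<forall>n. cmod (u n) \<le> B" and Lu: "\<forall>n. cmod (L \<theta> u n) \<le> c * \<rho> ^ nat \<bar>n - n0\<bar>" for u B c n0
  proof -
    have c0: "0 \<le> c" using Lu[rule_format, of n0] norm_ge_zero order_trans by (metis abs_zero diff_self mult.right_neutral nat_zero_as_int of_nat_0 power_0 nat_int)
    define e where "e = (\<lambda>n::int. (1 / \<rho>e) ^ nat \<bar>n - n0\<bar>)"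
    have e0: "0 < e n" for n using \<rho>e by (simp add: e_def)
    have e_ratio: "\<bar>1 - e n / e m\<bar> \<le> \<rho>e ^ nat \<bar>n - m\<bar> - 1" for n m
    proof -
      have bound: "e n \<le> \<rho>e ^ nat \<bar>n - m\<bar> * e m" for n m
      proof -
        have "nat \<bar>m - n0\<bar> \<le> nat \<bar>n - m\<bar> + nat \<bar>n - n0\<bar>" by linarith
        hence "\<rho>e ^ nat \<bar>m - n0\<bar> \<le> \<rho>e ^ nat \<bar>n - m\<bar> * \<rho>e ^ nat \<bar>n - n0\<bar>"
          unfolding power_add[symmetric] using \<rho>e by (intro power_increasing) auto
        thus ?thesis using \<rho>e by (simp add: e_def power_divide field_simps)
      qed
      define x where "x = \<rho>e ^ nat \<bar>n - m\<bar>"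
      have x1: "1 \<le> x" unfolding x_def using \<rho>e by (intro one_le_power) auto
      have up: "e n / e m \<le> x" using bound[of n m] e0[of m] by (simp add: x_def field_simps)
      have "e m \<le> x * e n" using bound[of m n] by (simp add: x_def abs_minus_commute)
      hence lo: "1 / x \<le> e n / e m" using e0[of m] x1 by (simp add: field_simps)
      \<comment> \<open>From the square of \<open>x - 1\<close> being nonnegative: the ratio falls
        below 1 by no more than the amount \<open>x - 1\<close> allowed above 1.\<close>
      have "2 - x \<le> 1 / x" using x1 zero_le_power2[of "x - 1"] by (simp add: field_simps power2_eq_square)
      thus ?thesis using up lo by (simp add: x_def[symmetric])
    qed
    define v where "v = (\<lambda>n. of_real (e n) * u n)"
    define g where "g = (\<lambda>n. of_real (e n) * L \<theta> u n)"
    \<comment> \<open>Kernel of the error made by conjugating the symbol with e; only ratios of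
      weights appear.\<close>
    define k where "k = (\<lambda>n m. - (\<alpha> (m - n) * of_real (1 - e n / e m)))"
    define C where "C = (\<lambda>n. - (\<Sum>\<^sub>\<infinity>m. k n m * v m))"
    have en: "e n = \<mu> ^ nat \<bar>n - n0\<bar> * \<mu> ^ nat \<bar>n - n0\<bar>" for n
      by (simp add: e_def \<mu>2[symmetric] power2_eq_square power_mult_distrib)
    have ele: "e n \<le> \<mu> ^ nat \<bar>n - n0\<bar>" for n
      unfolding en using mult_right_mono[of "\<mu> ^ nat \<bar>n - n0\<bar>" 1 "\<mu> ^ nat \<bar>n - n0\<bar>"] \<mu> by (simp add: power_le_one)
    have vb: "cmod (v n) \<le> B * \<mu> ^ nat \<bar>n - n0\<bar>" for n
      unfolding v_def norm_mult using mult_mono[OF ele[of n] u[rule_format, of n]] e0[of n] \<mu> by (simp add: mult.commute)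
    have v2: "v \<in> l2" by (rule l2_exp_decay[OF vb \<mu>(1,2)])
    have gb: "cmod (g n) \<le> c * \<mu> ^ nat \<bar>n - n0\<bar>" for n
    proof -
      have "cmod (g n) \<le> e n * (c * \<rho> ^ nat \<bar>n - n0\<bar>)"
        unfolding g_def norm_mult using e0[of n] Lu by (simp add: mult_left_mono)
      also have "\<dots> = c * \<mu> ^ nat \<bar>n - n0\<bar> * ((\<mu> * \<rho>) ^ nat \<bar>n - n0\<bar>)" by (simp add: en power_mult_distrib)
      finally show ?thesis by (simp add: \<mu>)
    qed
    have g2: "g \<in> l2" and gn: "(l2_norm g)\<^sup>2 \<le> c\<^sup>2 * S"
      using l2_exp_decay[OF gb \<mu>(1,2)] by (auto simp: S_def)
    have kb: "cmod (k n m) \<le> \<delta> * (cmod (\<alpha> (- (n - m))) * \<rho>1 ^ nat \<bar>n - m\<bar>)" for n m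
    proof -
      have "cmod (k n m) = cmod (\<alpha> (m - n)) * \<bar>1 - e n / e m\<bar>"
        by (simp only: k_def norm_minus_cancel norm_mult norm_of_real)
      also have "\<dots> \<le> cmod (\<alpha> (m - n)) * (\<delta> * \<rho>1 ^ nat \<bar>n - m\<bar>)"
        by (intro mult_left_mono order_trans[OF e_ratio pc]) simp
      finally show ?thesis by (simp add: mult_ac)
    qed
    have ksum: "(\<lambda>j. \<delta> * (cmod (\<alpha> (- j)) * \<rho>1 ^ nat \<bar>j\<bar>)) summable_on UNIV"
      by (rule summable_on_cmult_right[OF as'(1)])
    have kinf: "(\<Sum>\<^sub>\<infinity>j. \<delta> * (cmod (\<alpha> (- j)) * \<rho>1 ^ nat \<bar>j\<bar>)) = \<delta> * A"
      by (simp add: infsum_cmult_right' as'(2))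
    have C2: "C \<in> l2" and Cn: "l2_norm C \<le> \<delta> * A * l2_norm v"
    proof -
      have "(\<lambda>n. \<Sum>\<^sub>\<infinity>m. k n m * v m) \<in> l2" "l2_norm (\<lambda>n. \<Sum>\<^sub>\<infinity>m. k n m * v m) \<le> \<delta> * A * l2_norm v"
        using schur_test[OF kb ksum v2] by (simp_all add: kinf)
      thus "C \<in> l2" "l2_norm C \<le> \<delta> * A * l2_norm v"
        using l2_cmult[of "\<lambda>n. \<Sum>\<^sub>\<infinity>m. k n m * v m" "- 1"] by (simp_all add: C_def l2_norm_def)
    qed
    have vw: "\<And>n. cmod (v n) \<le> l2_norm v * \<omega> n" using l2_wt[OF v2] by auto
    have "L \<theta> v n = g n + C n" for n
    proof -
      have sv: "(\<lambda>m. \<alpha> (m - n) * v m) summable_on UNIV"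
        using symop_summable[OF subweight_wt wsummable_\<alpha> vw, of n] summable_int_translate[of "\<lambda>m. \<alpha> (m - n) * v m" n]
        by (simp add: add.commute)
      have sk: "(\<lambda>m. k n m * v m) summable_on UNIV"
        by (rule abs_summable_summable[OF schur_summable[OF kb ksum l2_component[OF v2]]])
      have "of_real (e n) * symop \<alpha> u n = (\<Sum>\<^sub>\<infinity>m. \<alpha> (m - n) * v m + k n m * v m)"
        unfolding symop_kernel infsum_cmult_right'[symmetric]
      proof (rule infsum_cong)
        fix m
        have "complex_of_real (e m) \<noteq> 0" using e0[of m] by simp
        thus "of_real (e n) * (\<alpha> (m - n) * u m) = \<alpha> (m - n) * v m + k n m * v m"
          by (simp add: v_def k_def field_simps)
      qed
      also have "\<dots> = symop \<alpha> v n - C n"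
        unfolding symop_kernel[of \<alpha> v] C_def by (simp add: infsum_add[OF sv sk])
      finally show ?thesis unfolding L_def g_def by (simp add: v_def algebra_simps)
    qed
    hence Lv: "L \<theta> v = (\<lambda>n. g n + C n)" by blast
    \<comment> \<open>The conjugation error contributes at most half of the left-hand side and is
      absorbed there.\<close>
    have "(l2_norm v)\<^sup>2 \<le> (K1 * l2_norm (L \<theta> v))\<^sup>2" by (intro power_mono lower v2 l2_norm_nonneg)
    also have "\<dots> \<le> K1\<^sup>2 * (2 * (l2_norm g)\<^sup>2 + 2 * (l2_norm C)\<^sup>2)"
      unfolding power_mult_distrib Lv by (intro mult_left_mono l2_norm_add_sq g2 C2) simp
    also have "\<dots> = 2 * (K1\<^sup>2 * (l2_norm g)\<^sup>2) + 2 * (K1 * l2_norm C)\<^sup>2"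
      by (simp add: power_mult_distrib algebra_simps)
    also have "\<dots> \<le> 2 * (K1\<^sup>2 * (c\<^sup>2 * S)) + 2 * (1 / 2 * l2_norm v)\<^sup>2"
    proof (intro add_mono mult_left_mono gn power_mono)
      have "K1 * l2_norm C \<le> K1 * (\<delta> * A * l2_norm v)" using K1 by (intro mult_left_mono Cn) auto
      also have "\<dots> \<le> 1 / 2 * l2_norm v" using mult_right_mono[OF \<delta>(2) l2_norm_nonneg[of v]] by (simp add: mult_ac)
      finally show "K1 * l2_norm C \<le> 1 / 2 * l2_norm v" .
    qed (use K1 l2_norm_nonneg in auto)
    finally have "(l2_norm v)\<^sup>2 \<le> 4 * (K1\<^sup>2 * (c\<^sup>2 * S))" by (simp add: power_mult_distrib power2_eq_square)
    also have "\<dots> = (2 * K1 * sqrt S * c)\<^sup>2" using S by (simp add: power_mult_distrib)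
    finally have "l2_norm v \<le> 2 * K1 * sqrt S * c" by (rule power2_le_imp_le) (use K1 S c0 in simp)
    moreover have "cmod (u n0) = cmod (v n0)" by (simp add: v_def e_def)
    ultimately show ?thesis using l2_component[OF v2, of n0] by simp
  qed
  have "wstable \<theta> (2 * K1 * sqrt S) \<rho>" unfolding wstable_def using main by blast
  thus ?thesis using \<rho> \<rho>le K1 S unfolding \<rho>1_def by (intro exI[of _ "2 * K1 * sqrt S"] conjI exI[of _ \<rho>]) auto
qed

section \<open>Passing decay estimates from one orbit to its closure\<close>

lemma wstable_translate:
  assumes "wstable \<theta> K \<rho>"
  shows "wstable (ziter T m \<theta>) K \<rho>"
  unfolding wstable_def
proof (intro allI impI)
  fix u B c n0
  assume u: "\<forall>n. cmod (u n) \<le> B" and Lu: "\<forall>n. cmod (L (ziter T m \<theta>) u n) \<le> c * \<rho> ^ nat \<bar>n - n0\<bar>"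
  define v where "v = (\<lambda>n. u (n - m))"
  have "L \<theta> v n = L (ziter T m \<theta>) u (n - m)" for n
    using L_translate[of m \<theta> v "n - m"] by (simp add: v_def)
  hence "cmod (L \<theta> v n) \<le> c * \<rho> ^ nat \<bar>n - (n0 + m)\<bar>" for n
    using Lu[rule_format, of "n - m"] by (simp add: algebra_simps)
  from wstableD[OF assms _ this, of B] u show "cmod (u n0) \<le> K * c" by (simp add: v_def)
qed

lemma w_orbit_cont: "continuous_on UNIV (\<lambda>\<theta>. w (ziter T n \<theta>))"
  by (rule continuous_on_compose2[OF p.w_cont continuous_on_ziter[OF p.homeo]]) simp

text \<open>Only the finitely many n near n0 ask for closeness of the base points; for all others
  the growth with base \<rho> beats the trivial bound \<open>2 * \<tau>\<close> for the difference
  of the potentials.\<close>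

lemma potential_near:
  assumes "0 \<le> B" "1 < \<rho>" "0 < \<sigma>"
  shows "\<forall>\<^sub>F \<theta>' in nhds \<theta>. \<forall>n. cmod (w (ziter T n \<theta>') - w (ziter T n \<theta>)) * B \<le> \<sigma> * \<rho> ^ nat \<bar>n - n0\<bar>"
proof -
  obtain N where N: "2 * \<tau> * B / \<sigma> < \<rho> ^ N" using real_arch_pow[OF assms(2)] by blast
  have "\<forall>\<^sub>F \<theta>' in nhds \<theta>. cmod (w (ziter T n \<theta>') - w (ziter T n \<theta>)) < \<sigma> / (B + 1)" for n
  proof -
    have "((\<lambda>\<theta>. w (ziter T n \<theta>)) \<longlongrightarrow> w (ziter T n \<theta>)) (nhds \<theta>)"
      using w_orbit_cont[of n] by (simp add: continuous_on_eq_continuous_at tendsto_nhds_iff continuous_at)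
    thus ?thesis using assms by (simp add: tendsto_iff dist_norm)
  qed
  hence "\<forall>\<^sub>F \<theta>' in nhds \<theta>. \<forall>n\<in>{n0 - int N..n0 + int N}. cmod (w (ziter T n \<theta>') - w (ziter T n \<theta>)) < \<sigma> / (B + 1)"
    by (intro eventually_ball_finite) auto
  thus ?thesis
  proof (rule eventually_mono, intro allI)
    fix \<theta>' n
    assume near: "\<forall>n\<in>{n0 - int N..n0 + int N}. cmod (w (ziter T n \<theta>') - w (ziter T n \<theta>)) < \<sigma> / (B + 1)"
    show "cmod (w (ziter T n \<theta>') - w (ziter T n \<theta>)) * B \<le> \<sigma> * \<rho> ^ nat \<bar>n - n0\<bar>"
    proof (cases "nat \<bar>n - n0\<bar> \<le> N")
      case True
      hence "n \<in> {n0 - int N..n0 + int N}" by auto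
      hence "cmod (w (ziter T n \<theta>') - w (ziter T n \<theta>)) * B \<le> \<sigma> / (B + 1) * B"
        using near assms by (intro mult_right_mono) (auto simp: less_imp_le)
      also have "\<dots> \<le> \<sigma> * 1" using assms by (simp add: field_simps)
      also have "\<dots> \<le> \<sigma> * \<rho> ^ nat \<bar>n - n0\<bar>" using assms by (intro mult_left_mono one_le_power) auto
      finally show ?thesis .
    next
      case False
      have "cmod (w (ziter T n \<theta>') - w (ziter T n \<theta>)) \<le> \<tau> + \<tau>"
        using norm_triangle_ineq4[of "w (ziter T n \<theta>')" "w (ziter T n \<theta>)"] p.w_bound[of "ziter T n \<theta>'"] p.w_bound[of "ziter T n \<theta>"] by linarith
      hence "cmod (w (ziter T n \<theta>') - w (ziter T n \<theta>)) * B \<le> 2 * \<tau> * B"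
        using assms by (simp add: mult_right_mono)
      also have "\<dots> \<le> \<sigma> * \<rho> ^ N" using N assms by (simp add: field_simps)
      also have "\<dots> \<le> \<sigma> * \<rho> ^ nat \<bar>n - n0\<bar>" using assms False by (intro mult_left_mono power_increasing) auto
      finally show ?thesis .
    qed
  qed
qed

lemma L_change_point: "L \<theta>' u n = L \<theta> u n + (w (ziter T n \<theta>') - w (ziter T n \<theta>)) * u n"
  by (simp add: L_def algebra_simps)

text \<open>Replacing \<theta> by a nearby orbit point changes the source by at most \<sigma> times
  the admissible growth. How near the point must be depends on B, but \<sigma> is arbitrary and K
  stays the same.\<close>

lemma wstable_closure:
  assumes Orb: "\<And>\<theta>. \<theta> \<in> Orb \<Longrightarrow> wstable \<theta> K \<rho>" "closure Orb = UNIV" and \<rho>: "1 < \<rho>" and K: "0 \<le> K"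
  shows "wstable \<theta> K \<rho>"
  unfolding wstable_def
proof (intro allI impI)
  fix u B c n0
  assume u: "\<forall>n. cmod (u n) \<le> B" and Lu: "\<forall>n. cmod (L \<theta> u n) \<le> c * \<rho> ^ nat \<bar>n - n0\<bar>"
  have B0: "0 \<le> B" using u norm_ge_zero order_trans by blast
  have "cmod (u n0) \<le> K * c + e" if e: "0 < e" for e
  proof -
    define \<sigma> where "\<sigma> = e / (K + 1)"
    have \<sigma>: "0 < \<sigma>" "K * \<sigma> \<le> e" using e K by (auto simp: \<sigma>_def field_simps)
    obtain S where S: "open S" "\<theta> \<in> S" "\<And>\<theta>' n. \<theta>' \<in> S \<Longrightarrow> cmod (w (ziter T n \<theta>') - w (ziter T n \<theta>)) * B \<le> \<sigma> * \<rho> ^ nat \<bar>n - n0\<bar>"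
      using potential_near[OF B0 \<rho> \<sigma>(1), of \<theta> n0] unfolding eventually_nhds by blast
    obtain \<theta>' where \<theta>': "\<theta>' \<in> Orb" "\<theta>' \<in> S"
      using Orb(2) S(1,2) by (metis UNIV_I closure_iff_nhds_not_empty disjoint_iff order_refl)
    have "cmod (L \<theta>' u n) \<le> (c + \<sigma>) * \<rho> ^ nat \<bar>n - n0\<bar>" for n
    proof -
      have "cmod ((w (ziter T n \<theta>') - w (ziter T n \<theta>)) * u n) \<le> cmod (w (ziter T n \<theta>') - w (ziter T n \<theta>)) * B"
        unfolding norm_mult using u by (intro mult_left_mono) auto
      also have "\<dots> \<le> \<sigma> * \<rho> ^ nat \<bar>n - n0\<bar>" by (rule S(3)[OF \<theta>'(2)])
      finally show ?thesis
        using norm_triangle_ineq[of "L \<theta> u n" "(w (ziter T n \<theta>') - w (ziter T n \<theta>)) * u n"] Lu[rule_format, of n]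
        unfolding L_change_point[of \<theta>' u n \<theta>] by (simp add: distrib_right)
    qed
    from wstableD[OF Orb(1)[OF \<theta>'(1)] u[rule_format] this] \<sigma>(2) show ?thesis by (simp add: algebra_simps)
  qed
  thus "cmod (u n0) \<le> K * c" by (rule field_le_epsilon)
qed

text \<open>The column with index \<open>-1\<close> of Green's function on \<open>l2\<close>, as a function of the base point.\<close>

definition greens :: "'a \<Rightarrow> (int \<Rightarrow> complex) \<Rightarrow> bool" where
  "greens \<theta> v \<longleftrightarrow> (\<exists>B. \<forall>n. cmod (v n) \<le> B) \<and> (\<forall>n. L \<theta> v n = deltaf (- 1) n)"

text \<open>Apply \<open>wstable\<close> centred at n: the unit source lies at distance |n + 1|,
  where the admissible profile has already grown to \<open>\<rho> ^ nat |n + 1|\<close>.\<close>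

lemma greens_decay:
  assumes "wstable \<theta> K \<rho>" "greens \<theta> v" "1 < \<rho>"
  shows "cmod (v n) \<le> K * (1 / \<rho>) ^ nat \<bar>n + 1\<bar>"
proof -
  obtain B where B: "\<And>n. cmod (v n) \<le> B" using assms(2) unfolding greens_def by blast
  have "cmod (L \<theta> v m) \<le> (1 / \<rho>) ^ nat \<bar>n + 1\<bar> * \<rho> ^ nat \<bar>m - n\<bar>" for m
  proof (cases "m = - 1")
    case True
    have "nat \<bar>- 1 - n\<bar> = nat \<bar>n + 1\<bar>" by linarith
    hence "(1 / \<rho>) ^ nat \<bar>n + 1\<bar> * \<rho> ^ nat \<bar>m - n\<bar> = 1" using assms(3) True by (simp flip: power_mult_distrib)
    thus ?thesis using assms(2) True by (simp add: greens_def deltaf_def)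
  next
    case False
    thus ?thesis using assms(2,3) by (simp add: greens_def deltaf_def)
  qed
  from wstableD[OF assms(1) B this] show ?thesis .
qed

lemma greens_bound:
  assumes "wstable \<theta> K \<rho>" "greens \<theta> v" "1 < \<rho>" "0 \<le> K"
  shows "cmod (v n) \<le> K"
proof -
  have "K * (1 / \<rho>) ^ nat \<bar>n + 1\<bar> \<le> K * 1" using assms(3,4) by (intro mult_left_mono power_le_one) auto
  thus ?thesis using greens_decay[OF assms(1-3), of n] by simp
qed

text \<open>The difference solves the equation at \<theta>1 with source \<open>v2\<close> times the
  difference of the potentials, up to sign, and \<open>v2\<close> is bounded by K.\<close>

lemma greens_near:
  assumes st: "wstable \<theta>1 K \<rho>" "wstable \<theta>2 K \<rho>" and g: "greens \<theta>1 v1" "greens \<theta>2 v2" and \<rho>: "1 < \<rho>" and K: "0 \<le> K"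
    and near: "\<And>n. cmod (w (ziter T n \<theta>1) - w (ziter T n \<theta>2)) * K \<le> \<sigma> * \<rho> ^ nat \<bar>n - n0\<bar>"
  shows "cmod (v1 n0 - v2 n0) \<le> K * \<sigma>"
proof (rule wstableD[OF st(1), of "\<lambda>n. v1 n - v2 n"])
  have b: "cmod (v1 n) \<le> K" "cmod (v2 n) \<le> K" for n using greens_bound st g \<rho> K by blast+
  show "cmod (v1 n - v2 n) \<le> K + K" for n using norm_triangle_ineq4[of "v1 n" "v2 n"] b[of n] by linarith
  have bw: "\<And>n. cmod (v1 n) \<le> K * \<omega> n" "\<And>n. cmod (v2 n) \<le> K * \<omega> n" using bounded_wt b by auto
  fix n
  have "L \<theta>1 (\<lambda>n. v1 n - v2 n) n = - ((w (ziter T n \<theta>1) - w (ziter T n \<theta>2)) * v2 n)"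
    unfolding L_diff[OF bw] L_change_point[of \<theta>1 v2 n \<theta>2] using g by (simp add: greens_def)
  hence "cmod (L \<theta>1 (\<lambda>n. v1 n - v2 n) n) \<le> cmod (w (ziter T n \<theta>1) - w (ziter T n \<theta>2)) * K"
    using b(2)[of n] by (simp add: norm_mult mult_left_mono)
  thus "cmod (L \<theta>1 (\<lambda>n. v1 n - v2 n) n) \<le> \<sigma> * \<rho> ^ nat \<bar>n - n0\<bar>" using near[of n] by linarith
qed

text \<open>The solutions at orbit points approaching \<theta> are Cauchy in the sup norm weighted
  by \<omega>, in which the symbol acts continuously, so their limit solves the equation at
  \<theta>. Without the weight, closeness of the potentials would be required along entire
  orbits.\<close>

lemma greens_closure:
  assumes st: "\<And>\<theta>. wstable \<theta> K \<rho>" and Orb: "\<And>\<theta>. \<theta> \<in> Orb \<Longrightarrow> \<exists>v. greens \<theta> v" "closure Orb = UNIV"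
    and \<rho>: "1 < \<rho>" "\<rho> \<le> min rp (1 / rm)" and K: "0 \<le> K"
  shows "\<exists>v. greens \<theta> v"
proof -
  obtain s where s: "\<And>j. s j \<in> Orb" "s \<longlonglongrightarrow> \<theta>" using Orb(2) closure_sequential[of \<theta> Orb] by auto
  obtain v where v: "\<And>j. greens (s j) (v j)" using Orb(1)[OF s(1)] by metis
  have vb: "cmod (v j n) \<le> K" for j n by (rule greens_bound[OF st v \<rho>(1) K])
  have cauchy: "\<exists>M. \<forall>i\<ge>M. \<forall>j\<ge>M. \<forall>n. cmod (v i n - v j n) \<le> e * \<omega> n" if e: "0 < e" for e
  proof -
    define \<sigma> where "\<sigma> = e / (K + 1) / 2"
    have ss: "\<sigma> + \<sigma> = e / (K + 1)" unfolding \<sigma>_def by (rule field_sum_of_halves)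
    have \<sigma>: "0 < \<sigma>" "K * (\<sigma> + \<sigma>) \<le> e" unfolding ss using e K by (auto simp: \<sigma>_def field_simps)
    have "\<forall>\<^sub>F j in sequentially. \<forall>n. cmod (w (ziter T n (s j)) - w (ziter T n \<theta>)) * K \<le> \<sigma> * \<rho> ^ nat \<bar>n - 0\<bar>"
      by (rule eventually_compose_filterlim[OF potential_near[OF K \<rho>(1) \<sigma>(1)] s(2)])
    then obtain M where M: "\<And>j n. M \<le> j \<Longrightarrow> cmod (w (ziter T n (s j)) - w (ziter T n \<theta>)) * K \<le> \<sigma> * \<rho> ^ nat \<bar>n\<bar>"
      unfolding eventually_sequentially by auto
    have "cmod (v i n0 - v j n0) \<le> e * \<omega> n0" if ij: "M \<le> i" "M \<le> j" for i j n0
    proof -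
      \<comment> \<open>Closeness is known with growth centred at 0; recentring it at n0 costs a
        factor that \<open>\<omega> n0\<close> covers.\<close>
      have "cmod (w (ziter T n (s i)) - w (ziter T n (s j))) * K \<le> ((\<sigma> + \<sigma>) * \<rho> ^ nat \<bar>n0\<bar>) * \<rho> ^ nat \<bar>n - n0\<bar>" for n
      proof -
        have "cmod (w (ziter T n (s i)) - w (ziter T n (s j))) \<le>
           cmod (w (ziter T n (s i)) - w (ziter T n \<theta>)) + cmod (w (ziter T n (s j)) - w (ziter T n \<theta>))"
          using norm_triangle_ineq4[of "w (ziter T n (s i)) - w (ziter T n \<theta>)" "w (ziter T n (s j)) - w (ziter T n \<theta>)"]
          unfolding diff_diff_eq2 by simp
        hence "cmod (w (ziter T n (s i)) - w (ziter T n (s j))) * K \<le>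
           (cmod (w (ziter T n (s i)) - w (ziter T n \<theta>)) + cmod (w (ziter T n (s j)) - w (ziter T n \<theta>))) * K"
          by (rule mult_right_mono[OF _ K])
        also have "\<dots> \<le> (\<sigma> + \<sigma>) * \<rho> ^ nat \<bar>n\<bar>"
          unfolding distrib_right by (intro add_mono M ij)
        also have "\<dots> \<le> (\<sigma> + \<sigma>) * (\<rho> ^ nat \<bar>n0\<bar> * \<rho> ^ nat \<bar>n - n0\<bar>)"
        proof (rule mult_left_mono)
          have "nat \<bar>n\<bar> \<le> nat \<bar>n0\<bar> + nat \<bar>n - n0\<bar>" by linarith
          thus "\<rho> ^ nat \<bar>n\<bar> \<le> \<rho> ^ nat \<bar>n0\<bar> * \<rho> ^ nat \<bar>n - n0\<bar>"
            unfolding power_add[symmetric] using \<rho> by (intro power_increasing) auto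
        qed (use \<sigma> in simp)
        finally show ?thesis by (simp add: mult.assoc)
      qed
      from greens_near[OF st st v v \<rho>(1) K this]
      have "cmod (v i n0 - v j n0) \<le> (K * (\<sigma> + \<sigma>)) * \<rho> ^ nat \<bar>n0\<bar>" by (simp add: mult.assoc)
      also have "\<dots> \<le> e * \<omega> n0" using \<sigma> \<rho> e by (intro mult_mono abs_power_wt) auto
      finally show ?thesis .
    qed
    thus ?thesis by blast
  qed
  have "Cauchy (\<lambda>j. v j n)" for n
  proof (rule metric_CauchyI)
    fix e :: real assume "0 < e"
    hence "0 < e / (2 * \<omega> n)" using wt_pos[of n] by simp
    from cauchy[OF this] obtain M where "\<forall>i\<ge>M. \<forall>j\<ge>M. cmod (v i n - v j n) \<le> e / (2 * \<omega> n) * \<omega> n" by blast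
    thus "\<exists>M. \<forall>i\<ge>M. \<forall>j\<ge>M. dist (v i n) (v j n) < e"
      using wt_pos[of n] \<open>0 < e\<close> by (intro exI[of _ M]) (fastforce simp: dist_norm)
  qed
  hence "\<exists>l. (\<lambda>j. v j n) \<longlonglongrightarrow> l" for n using Cauchy_convergent[of "\<lambda>j. v j n"] by (simp add: convergent_def)
  then obtain z where z: "\<And>n. (\<lambda>j. v j n) \<longlonglongrightarrow> z n" by metis
  have zb: "cmod (z n) \<le> K" for n
    by (rule LIMSEQ_le_const2[OF tendsto_norm[OF z]]) (use vb in auto)
  have zw: "cmod (z n) \<le> K * \<omega> n" and vw: "cmod (v j n) \<le> K * \<omega> n" for j n
    using bounded_wt zb vb by auto
  have zc: "\<exists>M. \<forall>i\<ge>M. \<forall>n. cmod (v i n - z n) \<le> e * \<omega> n" if e: "0 < e" for e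
  proof -
    obtain M where M: "\<forall>i\<ge>M. \<forall>j\<ge>M. \<forall>n. cmod (v i n - v j n) \<le> e * \<omega> n" using cauchy[OF e] by blast
    have "cmod (v i n - z n) \<le> e * \<omega> n" if "M \<le> i" for i n
      by (rule LIMSEQ_le_const2[OF tendsto_norm[OF tendsto_diff[OF tendsto_const z]]]) (use M that in auto)
    thus ?thesis by blast
  qed
  have "L \<theta> z n = deltaf (- 1) n" for n
  proof -
    have "(\<lambda>j. symop \<alpha> (v j) n) \<longlonglongrightarrow> symop \<alpha> z n"
    proof (rule LIMSEQ_I)
      fix e :: real assume e: "0 < e"
      define A where "A = wnorm \<omega> \<alpha> * \<omega> n + 1"
      have A: "0 < A" using wnorm_nonneg[OF subweight_wt, of \<alpha>] wt_pos[of n] by (simp add: A_def add_nonneg_pos)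
      obtain M where M: "\<forall>i\<ge>M. \<forall>n. cmod (v i n - z n) \<le> e / (2 * A) * \<omega> n" using zc[of "e / (2 * A)"] e A by auto
      have "norm (symop \<alpha> (v i) n - symop \<alpha> z n) < e" if "M \<le> i" for i
      proof -
        have d: "cmod (v i n - z n) \<le> e / (2 * A) * \<omega> n" for n using M that by blast
        have vi: "cmod (v i n) \<le> K * \<omega> n" for n by (rule vw)
        have "norm (symop \<alpha> (v i) n - symop \<alpha> z n) \<le> wnorm \<omega> \<alpha> * (e / (2 * A)) * \<omega> n"
          using symop_bound[OF subweight_wt wsummable_\<alpha> d, of n] symop_diff[OF subweight_wt wsummable_\<alpha> vi zw, of n] by simp
        also have "\<dots> = (A - 1) * (e / (2 * A))" by (simp add: A_def)
        also have "\<dots> \<le> A * (e / (2 * A))" using e A by (intro mult_right_mono) auto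
        also have "\<dots> < e" using e A by simp
        finally show ?thesis .
      qed
      thus "\<exists>M. \<forall>i\<ge>M. norm (symop \<alpha> (v i) n - symop \<alpha> z n) < e" by blast
    qed
    moreover have "(\<lambda>j. w (ziter T n (s j))) \<longlonglongrightarrow> w (ziter T n \<theta>)"
      using w_orbit_cont[of n] s(2) by (auto simp: continuous_on_sequentially o_def)
    ultimately have "(\<lambda>j. L (s j) (v j) n) \<longlonglongrightarrow> L \<theta> z n"
      unfolding L_def by (intro tendsto_intros z)
    moreover have "(\<lambda>j. L (s j) (v j) n) = (\<lambda>j. deltaf (- 1) n)" using v by (simp add: greens_def)
    ultimately show ?thesis by (metis LIMSEQ_unique tendsto_const)
  qed
  thus ?thesis unfolding greens_def using zb by blast
qed

lemma greens_cont:
  assumes st: "\<And>\<theta>. wstable \<theta> K \<rho>" and \<Gamma>: "\<And>\<theta>. greens \<theta> (\<Gamma> \<theta>)" and \<rho>: "1 < \<rho>" and K: "0 \<le> K"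
  shows "continuous_on UNIV (\<lambda>\<theta>. \<Gamma> \<theta> n)"
  unfolding continuous_on_def
proof (rule ballI, rule tendstoI)
  fix \<theta> :: 'a and e :: real assume e: "0 < e"
  define \<sigma> where "\<sigma> = e / (K + 1)"
  have \<sigma>: "0 < \<sigma>" "K * \<sigma> < e" using e K by (auto simp: \<sigma>_def field_simps)
  have "\<forall>\<^sub>F \<theta>' in nhds \<theta>. dist (\<Gamma> \<theta>' n) (\<Gamma> \<theta> n) < e"
  proof (rule eventually_mono[OF potential_near[OF K \<rho> \<sigma>(1), of \<theta> n]])
    fix \<theta>' assume near: "\<forall>m. cmod (w (ziter T m \<theta>') - w (ziter T m \<theta>)) * K \<le> \<sigma> * \<rho> ^ nat \<bar>m - n\<bar>"
    have "cmod (\<Gamma> \<theta>' n - \<Gamma> \<theta> n) \<le> K * \<sigma>"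
      by (rule greens_near[OF st st \<Gamma> \<Gamma> \<rho> K]) (use near in blast)
    thus "dist (\<Gamma> \<theta>' n) (\<Gamma> \<theta> n) < e" using \<sigma>(2) by (simp add: dist_norm)
  qed
  thus "\<forall>\<^sub>F \<theta>' in at \<theta> within UNIV. dist (\<Gamma> \<theta>' n) (\<Gamma> \<theta> n) < e"
    by (simp add: eventually_nhds_conv_at)
qed

text \<open>Invertibility is used at the single point \<theta>0. Decay estimates and solutions
  travel along its orbit by translation, and to all other points by density.\<close>

lemma greens_exists:
  assumes "l2_invertible \<theta>0" and dense: "closure (range (\<lambda>n. ziter T n \<theta>0)) = UNIV"
  shows "\<exists>K \<rho> \<Gamma>. 0 \<le> K \<and> 1 < \<rho> \<and> (\<forall>\<theta>. wstable \<theta> K \<rho>) \<and> (\<forall>\<theta>. greens \<theta> (\<Gamma> \<theta>))"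
proof -
  obtain K \<rho> where K: "0 \<le> K" and \<rho>: "1 < \<rho>" "\<rho> \<le> min rp (1 / rm)" and st0: "wstable \<theta>0 K \<rho>"
    using combes_thomas[OF assms(1)] by blast
  have st: "wstable \<theta> K \<rho>" for \<theta>
    by (rule wstable_closure[OF _ dense \<rho>(1) K]) (use wstable_translate[OF st0] in auto)
  obtain R where R: "\<And>u. u \<in> l2 \<Longrightarrow> R u \<in> l2" "\<And>u. u \<in> l2 \<Longrightarrow> L \<theta>0 (R u) = u"
    using assms(1) unfolding l2_invertible_def bounded_l2_op_def by blast
  have dl: "deltaf m \<in> l2" for m
    by (rule l2_exp_decay(1)[of _ 1 0 m]) (auto simp: deltaf_def)
  have orbit: "\<exists>v. greens \<theta> v" if r: "\<theta> \<in> range (\<lambda>n. ziter T n \<theta>0)" for \<theta>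
  proof -
    obtain m where m: "\<theta> = ziter T m \<theta>0" using r by blast
    \<comment> \<open>Seen from the m-th orbit point, the column with source m - 1 at \<theta>0 has
      its source at -1.\<close>
    let ?v = "\<lambda>n. R (deltaf (m - 1)) (n + m)"
    have "L \<theta> ?v n = deltaf (- 1) n" for n
      unfolding m L_translate R(2)[OF dl] by (auto simp: deltaf_def)
    moreover have "cmod (?v n) \<le> l2_norm (R (deltaf (m - 1)))" for n by (rule l2_component[OF R(1)[OF dl]])
    ultimately have "greens \<theta> ?v" unfolding greens_def by blast
    thus ?thesis by blast
  qed
  have "\<exists>v. greens \<theta> v" for \<theta> by (rule greens_closure[OF st orbit dense \<rho> K])
  then obtain \<Gamma> where "\<And>\<theta>. greens \<theta> (\<Gamma> \<theta>)" by metis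
  thus ?thesis using K \<rho> st by blast
qed

end

section \<open>Invertibility implies uniform hyperbolicity\<close>

lemma subspace_vecI:
  fixes F :: "complex vec set"
  assumes "F \<subseteq> carrier_vec n" "0\<^sub>v n \<in> F" "\<And>x y. x \<in> F \<Longrightarrow> y \<in> F \<Longrightarrow> x + y \<in> F" "\<And>c x. x \<in> F \<Longrightarrow> c \<cdot>\<^sub>v x \<in> F"
  shows "VectorSpace.subspace class_ring F (module_vec TYPE(complex) n)"
proof (rule VectorSpace.subspace.intro)
  show "vectorspace class_ring (module_vec TYPE(complex) n)" by (rule vec_vs)
  show "submodule class_ring F (module_vec TYPE(complex) n)"
    by (rule submodule.intro) (use assms vec_module in \<open>auto simp: module_vec_def\<close>)
qed

context center
begin

text \<open>Boundedness instead of decay: it is evidently linear and invariant under shifts, and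
  exponential decay comes afterwards from the projection built out of Green's functions.\<close>

definition stable_space :: "'a \<Rightarrow> complex vec set" where
  "stable_space \<theta> = {x \<in> carrier_vec q. \<exists>B. \<forall>n\<ge>0. cmod (Ev \<theta> x n) \<le> B}"

definition unstable_space :: "'a \<Rightarrow> complex vec set" where
  "unstable_space \<theta> = {x \<in> carrier_vec q. \<exists>B. \<forall>n\<le>0. cmod (Ev \<theta> x n) \<le> B}"

lemma subspace_bounded_on:
  "VectorSpace.subspace class_ring {x \<in> carrier_vec q. \<exists>B. \<forall>n. Q n \<longrightarrow> cmod (Ev \<theta> x n) \<le> B} (module_vec TYPE(complex) q)"
proof (rule subspace_vecI)
  let ?F = "{x \<in> carrier_vec q. \<exists>B. \<forall>n. Q n \<longrightarrow> cmod (Ev \<theta> x n) \<le> B}"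
  show "?F \<subseteq> carrier_vec q" by blast
  show "0\<^sub>v q \<in> ?F" by (auto intro: exI[of _ 0])
  fix x y assume "x \<in> ?F" "y \<in> ?F"
  then obtain B C where xy: "x \<in> carrier_vec q" "y \<in> carrier_vec q"
    "\<And>n. Q n \<Longrightarrow> cmod (Ev \<theta> x n) \<le> B" "\<And>n. Q n \<Longrightarrow> cmod (Ev \<theta> y n) \<le> C" by blast
  have "cmod (Ev \<theta> (x + y) n) \<le> B + C" if "Q n" for n
    using norm_triangle_ineq[of "Ev \<theta> x n" "Ev \<theta> y n"] xy(3,4)[OF that] by (simp add: Ev_add xy(1,2))
  thus "x + y \<in> ?F" using xy by auto
next
  let ?F = "{x \<in> carrier_vec q. \<exists>B. \<forall>n. Q n \<longrightarrow> cmod (Ev \<theta> x n) \<le> B}"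
  fix c x assume "x \<in> ?F"
  then obtain B where x: "x \<in> carrier_vec q" "\<And>n. Q n \<Longrightarrow> cmod (Ev \<theta> x n) \<le> B" by blast
  have "cmod (Ev \<theta> (c \<cdot>\<^sub>v x) n) \<le> cmod c * B" if "Q n" for n
    using x(2)[OF that] by (simp add: Ev_smult x(1) norm_mult mult_left_mono)
  thus "c \<cdot>\<^sub>v x \<in> ?F" using x by auto
qed

lemma subspace_stable: "VectorSpace.subspace class_ring (stable_space \<theta>) (module_vec TYPE(complex) q)"
  and subspace_unstable: "VectorSpace.subspace class_ring (unstable_space \<theta>) (module_vec TYPE(complex) q)"
  unfolding stable_space_def unstable_space_def by (rule subspace_bounded_on)+

lemma stable_carrier: "stable_space \<theta> \<subseteq> carrier_vec q" and unstable_carrier: "unstable_space \<theta> \<subseteq> carrier_vec q"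
  by (auto simp: stable_space_def unstable_space_def)

lemma stable_diff: "x \<in> stable_space \<theta> \<Longrightarrow> y \<in> stable_space \<theta> \<Longrightarrow> x - y \<in> stable_space \<theta>"
proof -
  assume "x \<in> stable_space \<theta>" "y \<in> stable_space \<theta>"
  then obtain B C where xy: "x \<in> carrier_vec q" "y \<in> carrier_vec q"
    "\<And>n. 0 \<le> n \<Longrightarrow> cmod (Ev \<theta> x n) \<le> B" "\<And>n. 0 \<le> n \<Longrightarrow> cmod (Ev \<theta> y n) \<le> C"
    unfolding stable_space_def by blast
  have "cmod (Ev \<theta> (x - y) n) \<le> B + C" if "0 \<le> n" for n
    using norm_triangle_ineq4[of "Ev \<theta> x n" "Ev \<theta> y n"] xy(3,4)[OF that] by (simp add: Ev_diff xy(1,2))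
  thus "x - y \<in> stable_space \<theta>" using xy by (auto simp: stable_space_def)
qed

lemma unstable_diff: "x \<in> unstable_space \<theta> \<Longrightarrow> y \<in> unstable_space \<theta> \<Longrightarrow> x - y \<in> unstable_space \<theta>"
proof -
  assume "x \<in> unstable_space \<theta>" "y \<in> unstable_space \<theta>"
  then obtain B C where xy: "x \<in> carrier_vec q" "y \<in> carrier_vec q"
    "\<And>n. n \<le> 0 \<Longrightarrow> cmod (Ev \<theta> x n) \<le> B" "\<And>n. n \<le> 0 \<Longrightarrow> cmod (Ev \<theta> y n) \<le> C"
    unfolding unstable_space_def by blast
  have "cmod (Ev \<theta> (x - y) n) \<le> B + C" if "n \<le> 0" for n
    using norm_triangle_ineq4[of "Ev \<theta> x n" "Ev \<theta> y n"] xy(3,4)[OF that] by (simp add: Ev_diff xy(1,2))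
  thus "x - y \<in> unstable_space \<theta>" using xy by (auto simp: unstable_space_def)
qed

lemma stable_cc:
  assumes x: "x \<in> carrier_vec q"
  shows "cc \<theta> *\<^sub>v x \<in> stable_space (T \<theta>) \<longleftrightarrow> x \<in> stable_space \<theta>"
proof
  assume "cc \<theta> *\<^sub>v x \<in> stable_space (T \<theta>)"
  then obtain B where B: "\<And>n. 0 \<le> n \<Longrightarrow> cmod (Ev \<theta> x (n + 1)) \<le> B"
    by (auto simp: stable_space_def Ev_cc[OF x])
  have "cmod (Ev \<theta> x n) \<le> max B (cmod (Ev \<theta> x 0))" if "0 \<le> n" for n
    using B[of "n - 1"] that by (cases "n = 0") auto
  thus "x \<in> stable_space \<theta>" using x by (auto simp: stable_space_def)
next
  assume "x \<in> stable_space \<theta>"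
  then obtain B where B: "\<And>n. 0 \<le> n \<Longrightarrow> cmod (Ev \<theta> x n) \<le> B" by (auto simp: stable_space_def)
  have "cmod (Ev (T \<theta>) (cc \<theta> *\<^sub>v x) n) \<le> B" if "0 \<le> n" for n
    using B[of "n + 1"] that by (simp add: Ev_cc[OF x])
  thus "cc \<theta> *\<^sub>v x \<in> stable_space (T \<theta>)" using cc_mult_carrier[OF x] by (auto simp: stable_space_def)
qed

lemma unstable_cc:
  assumes x: "x \<in> carrier_vec q"
  shows "cc \<theta> *\<^sub>v x \<in> unstable_space (T \<theta>) \<longleftrightarrow> x \<in> unstable_space \<theta>"
proof
  assume "x \<in> unstable_space \<theta>"
  then obtain B where B: "\<And>n. n \<le> 0 \<Longrightarrow> cmod (Ev \<theta> x n) \<le> B" by (auto simp: unstable_space_def)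
  have "cmod (Ev (T \<theta>) (cc \<theta> *\<^sub>v x) n) \<le> max B (cmod (Ev \<theta> x 1))" if "n \<le> 0" for n
    using B[of "n + 1"] that by (cases "n = 0") (auto simp: Ev_cc[OF x])
  thus "cc \<theta> *\<^sub>v x \<in> unstable_space (T \<theta>)" using cc_mult_carrier[OF x] by (auto simp: unstable_space_def)
next
  assume "cc \<theta> *\<^sub>v x \<in> unstable_space (T \<theta>)"
  then obtain B where B: "\<And>n. n \<le> 0 \<Longrightarrow> cmod (Ev \<theta> x (n + 1)) \<le> B"
    by (auto simp: unstable_space_def Ev_cc[OF x])
  have "cmod (Ev \<theta> x n) \<le> B" if "n \<le> 0" for n using B[of "n - 1"] that by simp
  thus "x \<in> unstable_space \<theta>" using x by (auto simp: unstable_space_def)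
qed

lemma image_cc:
  assumes "\<And>\<theta>. F \<theta> \<subseteq> carrier_vec q" "\<And>\<theta> x. x \<in> carrier_vec q \<Longrightarrow> cc \<theta> *\<^sub>v x \<in> F (T \<theta>) \<longleftrightarrow> x \<in> F \<theta>"
  shows "(\<lambda>v. cc \<theta> *\<^sub>v v) ` F \<theta> = F (T \<theta>)"
proof (intro equalityI subsetI)
  fix y assume "y \<in> (\<lambda>v. cc \<theta> *\<^sub>v v) ` F \<theta>"
  thus "y \<in> F (T \<theta>)" using assms by blast
next
  fix y assume y: "y \<in> F (T \<theta>)"
  then obtain x where "x \<in> carrier_vec q" "cc \<theta> *\<^sub>v x = y" using cc_surj assms(1) by blast
  thus "y \<in> (\<lambda>v. cc \<theta> *\<^sub>v v) ` F \<theta>" using assms(2) y by blast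
qed

text \<open>A displacement of at most c in the exponent costs \<open>(1 / \<mu>) ^ c\<close>; with c
  = q this pays for the width of the window.\<close>

lemma pow_shift:
  fixes \<mu> :: real
  assumes "0 < \<mu>" "\<mu> < 1" "a \<le> b + c"
  shows "\<mu> ^ b \<le> (1 / \<mu>) ^ c * \<mu> ^ a"
proof -
  have "\<mu> ^ (b + c) \<le> \<mu> ^ a" using assms by (intro power_decreasing) auto
  hence "(1 / \<mu>) ^ c * \<mu> ^ (b + c) \<le> (1 / \<mu>) ^ c * \<mu> ^ a" using assms by (intro mult_left_mono) auto
  moreover have "(1 / \<mu>) ^ c * \<mu> ^ (b + c) = \<mu> ^ b" using assms by (simp add: power_add power_divide)
  ultimately show ?thesis by simp
qed

theorem hyperbolic_of_invertible:
  assumes "l2_invertible \<theta>0" and dense: "closure (range (\<lambda>n. ziter T n \<theta>0)) = UNIV"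
  shows "uniformly_hyperbolic q T cc"
proof -
  obtain K \<rho> \<Gamma> where K: "0 \<le> K" and \<rho>: "1 < \<rho>" and st: "\<And>\<theta>. wstable \<theta> K \<rho>" and \<Gamma>: "\<And>\<theta>. greens \<theta> (\<Gamma> \<theta>)"
    using greens_exists[OF assms] by blast
  have \<Gamma>dec: "cmod (\<Gamma> \<theta> n) \<le> K * (1 / \<rho>) ^ nat \<bar>n + 1\<bar>" for \<theta> n by (rule greens_decay[OF st \<Gamma> \<rho>])
  have \<Gamma>b: "cmod (\<Gamma> \<theta> n) \<le> K" for \<theta> n by (rule greens_bound[OF st \<Gamma> \<rho> K])
  have \<Gamma>cont: "continuous_on UNIV (\<lambda>\<theta>. \<Gamma> \<theta> n)" for n by (rule greens_cont[OF st \<Gamma> \<rho> K])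
  have inj: "u = (\<lambda>n. 0)" if "\<And>n. cmod (u n) \<le> B" "\<And>n. L \<theta> u n = 0" for u B \<theta>
  proof
    fix n0
    have "cmod (u n0) \<le> K * 0" by (rule wstableD[OF st[of \<theta>] that(1)]) (simp add: that(2))
    thus "u n0 = 0" by simp
  qed
  define \<mu> where "\<mu> = max (1 / \<rho>) (max rm (1 / rp))"
  have \<mu>: "0 < \<mu>" "\<mu> < 1" "1 / \<rho> \<le> \<mu>" "rm \<le> \<mu>" "1 / rp \<le> \<mu>" using \<rho> rm_pos rm_less rp_gt by (auto simp: \<mu>_def)
  define M where "M = (1 / \<mu>) ^ q"
  have M: "1 \<le> M" using \<mu> by (simp add: M_def one_le_power)
  \<comment> \<open>The decaying solution, translated so that its source is at - p - 1 like that of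
    the p-th columns on the two circles.\<close>
  define s where "s = (\<lambda>\<theta> p n. \<Gamma> (ziter T (- int p) \<theta>) (n + int p))"
  have s_cont: "continuous_on UNIV (\<lambda>\<theta>. s \<theta> p n)" for p n
    unfolding s_def by (rule continuous_on_compose2[OF \<Gamma>cont continuous_on_ziter[OF p.homeo]]) simp
  have s_L: "L \<theta> (s \<theta> p) n = deltaf (- int p - 1) n" for \<theta> p n
  proof -
    have "ziter T (int p) (ziter T (- int p) \<theta>) = \<theta>" using ziter_add[OF bijT, of "int p" "- int p" \<theta>] by simp
    hence "L \<theta> (s \<theta> p) n = L (ziter T (- int p) \<theta>) (\<Gamma> (ziter T (- int p) \<theta>)) (n + int p)"
      using L_translate[of "int p" "ziter T (- int p) \<theta>" "\<Gamma> (ziter T (- int p) \<theta>)" n] by (simp add: s_def)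
    thus ?thesis using \<Gamma> by (auto simp: greens_def deltaf_def)
  qed
  have s_wt: "cmod (s \<theta> p n) \<le> K * \<omega> n" for \<theta> p n unfolding s_def using \<Gamma>b by (intro bounded_wt)
  have s_dec: "cmod (s \<theta> p n) \<le> K * M * \<mu> ^ nat \<bar>n\<bar>" if "p < q" for \<theta> p n
  proof -
    have "cmod (s \<theta> p n) \<le> K * (1 / \<rho>) ^ nat \<bar>n + int p + 1\<bar>" unfolding s_def by (rule \<Gamma>dec)
    also have "\<dots> \<le> K * \<mu> ^ nat \<bar>n + int p + 1\<bar>" using K \<rho> \<mu> by (intro mult_left_mono power_mono) auto
    also have "\<dots> \<le> K * (M * \<mu> ^ nat \<bar>n\<bar>)"
    proof (rule mult_left_mono[OF _ K])
      have "nat \<bar>n\<bar> \<le> nat \<bar>n + int p + 1\<bar> + q" using that by linarith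
      thus "\<mu> ^ nat \<bar>n + int p + 1\<bar> \<le> M * \<mu> ^ nat \<bar>n\<bar>" unfolding M_def by (rule pow_shift[OF \<mu>(1,2)])
    qed
    finally show ?thesis by (simp add: mult.assoc)
  qed
  have cent: "in_center \<theta> (\<lambda>n. s \<theta> p n - m.H (int p) \<theta> n)" for \<theta> p
  proof -
    have "cmod (s \<theta> p n - m.H (int p) \<theta> n) \<le> (K + 2 * m.\<beta> * rm powi (int p + 1)) * \<omega> n" for n
      using norm_triangle_ineq4[of "s \<theta> p n" "m.H (int p) \<theta> n"] s_wt[of \<theta> p n] Hm_wt[of "int p" \<theta> n] by (simp add: distrib_right)
    moreover have "L \<theta> (\<lambda>n. s \<theta> p n - m.H (int p) \<theta> n) n = 0" for n
      unfolding L_diff[OF s_wt Hm_wt] s_L L_Hm by simp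
    ultimately show ?thesis unfolding in_center_def by blast
  qed
  have "\<forall>\<theta> p. \<exists>x. x \<in> carrier_vec q \<and> Ev \<theta> x = (\<lambda>n. s \<theta> p n - m.H (int p) \<theta> n)"
    using Ev_span[OF cent] by blast
  then obtain X where X': "\<forall>\<theta> p. X \<theta> p \<in> carrier_vec q \<and> Ev \<theta> (X \<theta> p) = (\<lambda>n. s \<theta> p n - m.H (int p) \<theta> n)"
    by (elim choice[THEN exE, rotated]) (metis (no_types))
  have X: "X \<theta> p \<in> carrier_vec q" "Ev \<theta> (X \<theta> p) = (\<lambda>n. s \<theta> p n - m.H (int p) \<theta> n)" for \<theta> p
    using X' by blast+
  \<comment> \<open>The basis sequence \<open>p.H - m.H\<close> is cut at s: \<open>s - m.H\<close>
    decays at +infinity, \<open>p.H - s\<close> at -infinity. The coordinates of the first parts,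
    taken as columns, form the projection to the stable space along the unstable one.\<close>
  define P where "P = (\<lambda>\<theta>. mat q q (\<lambda>(i, p). X \<theta> p $ i))"
  have Pc: "P \<theta> \<in> carrier_mat q q" for \<theta> by (simp add: P_def)
  have Pxc: "P \<theta> *\<^sub>v x \<in> carrier_vec q" if "x \<in> carrier_vec q" for \<theta> x using mult_mat_vec_carrier[OF Pc that] .
  have P_cont: "continuous_mat q P"
    unfolding continuous_mat_def
  proof (intro conjI allI impI Pc)
    fix i j assume ij: "i < q" "j < q"
    have "continuous_on UNIV (\<lambda>\<theta>. X \<theta> j $ i)"
    proof (rule coordinates_cont[OF X(1) _ ij(1)])
      show "continuous_on UNIV (\<lambda>\<theta>. Ev \<theta> (X \<theta> j) (int k))" for k
        unfolding X(2) by (intro continuous_on_diff s_cont m.H_cont)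
    qed
    thus "continuous_on UNIV (\<lambda>\<theta>. P \<theta> $$ (i, j))" using ij by (simp add: P_def)
  qed
  have EvP: "Ev \<theta> (P \<theta> *\<^sub>v x) n = (\<Sum>p<q. x $ p * (s \<theta> p n - m.H (int p) \<theta> n))" if x: "x \<in> carrier_vec q" for \<theta> x n
  proof -
    have "Ev \<theta> (P \<theta> *\<^sub>v x) n = (\<Sum>i<q. (\<Sum>p<q. X \<theta> p $ i * x $ p) * U i \<theta> n)"
      unfolding Ev_def using x by (intro sum.cong) (auto simp: P_def scalar_prod_def atLeast0LessThan)
    also have "\<dots> = (\<Sum>i<q. \<Sum>p<q. x $ p * (X \<theta> p $ i * U i \<theta> n))"
      by (simp add: sum_distrib_right sum_distrib_left mult_ac)
    also have "\<dots> = (\<Sum>p<q. \<Sum>i<q. x $ p * (X \<theta> p $ i * U i \<theta> n))" by (rule sum.swap)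
    also have "\<dots> = (\<Sum>p<q. x $ p * Ev \<theta> (X \<theta> p) n)" by (simp add: Ev_def sum_distrib_left)
    finally show ?thesis unfolding X(2) .
  qed
  have EvQ: "Ev \<theta> (x - P \<theta> *\<^sub>v x) n = (\<Sum>p<q. x $ p * (p.H (int p) \<theta> n - s \<theta> p n))" if x: "x \<in> carrier_vec q" for \<theta> x n
  proof -
    have "Ev \<theta> (x - P \<theta> *\<^sub>v x) n = (\<Sum>p<q. x $ p * U p \<theta> n - x $ p * (s \<theta> p n - m.H (int p) \<theta> n))"
      unfolding Ev_diff[OF x Pxc[OF x]] EvP[OF x] sum_subtractf by (simp only: Ev_def)
    also have "\<dots> = (\<Sum>p<q. x $ p * (p.H (int p) \<theta> n - s \<theta> p n))"
      by (rule sum.cong) (simp_all add: U_def right_diff_distrib)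
    finally show ?thesis .
  qed
  define D where "D = real q * (K * M + growth_const)"
  have D: "0 \<le> D" using K M growth_const_nonneg by (simp add: D_def)
  have comb: "cmod (\<Sum>p<q. x $ p * f p) \<le> D * \<mu> ^ k * cvec_norm x"
    if x: "x \<in> carrier_vec q" and f: "\<And>p. p < q \<Longrightarrow> cmod (f p) \<le> (K * M + growth_const) * \<mu> ^ k"
    for x :: "complex vec" and f :: "nat \<Rightarrow> complex" and k
  proof -
    have "cmod (\<Sum>p<q. x $ p * f p) \<le> (\<Sum>p<q. cvec_norm x * ((K * M + growth_const) * \<mu> ^ k))"
      by (intro sum_norm_le) (auto simp: norm_mult intro!: mult_mono cvec_norm_component[OF x] f cvec_norm_nonneg)
    thus ?thesis by (simp add: D_def mult_ac)
  qed
  have Pdec: "cmod (Ev \<theta> (P \<theta> *\<^sub>v x) (int n)) \<le> D * \<mu> ^ n * cvec_norm x" if x: "x \<in> carrier_vec q" for \<theta> x n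
    unfolding EvP[OF x]
  proof (rule comb[OF x])
    fix p assume p: "p < q"
    have "growth_const * rm ^ n \<le> growth_const * \<mu> ^ n"
      using growth_const_nonneg rm_pos \<mu> by (intro mult_left_mono power_mono) auto
    thus "cmod (s \<theta> p (int n) - m.H (int p) \<theta> (int n)) \<le> (K * M + growth_const) * \<mu> ^ n"
      using norm_triangle_ineq4[of "s \<theta> p (int n)" "m.H (int p) \<theta> (int n)"] s_dec[OF p, of \<theta> "int n"] Hm_growth[OF p, of \<theta> "int n"]
      by (simp add: distrib_right)
  qed
  have Qdec: "cmod (Ev \<theta> (x - P \<theta> *\<^sub>v x) (- int n)) \<le> D * \<mu> ^ n * cvec_norm x" if x: "x \<in> carrier_vec q" for \<theta> x n
    unfolding EvQ[OF x]
  proof (rule comb[OF x])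
    fix p assume p: "p < q"
    have "growth_const * (1 / rp) ^ n \<le> growth_const * \<mu> ^ n"
      using growth_const_nonneg rp_pos \<mu> by (intro mult_left_mono power_mono) auto
    moreover have "rp powi (- int n) = (1 / rp) ^ n" by (simp add: power_int_minus power_divide inverse_eq_divide)
    ultimately show "cmod (p.H (int p) \<theta> (- int n) - s \<theta> p (- int n)) \<le> (K * M + growth_const) * \<mu> ^ n"
      using norm_triangle_ineq4[of "p.H (int p) \<theta> (- int n)" "s \<theta> p (- int n)"] s_dec[OF p, of \<theta> "- int n"] Hp_growth[OF p, of \<theta> "- int n"]
      by (simp add: distrib_right)
  qed
  have dec1: "D * \<mu> ^ n * cvec_norm x \<le> D * cvec_norm x" for n x
  proof -
    have "D * \<mu> ^ n \<le> D * 1" using D \<mu> by (intro mult_left_mono power_le_one) auto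
    thus ?thesis using mult_right_mono[OF _ cvec_norm_nonneg[of x]] by simp
  qed
  have PS: "P \<theta> *\<^sub>v x \<in> stable_space \<theta>" if x: "x \<in> carrier_vec q" for \<theta> x
  proof -
    have "cmod (Ev \<theta> (P \<theta> *\<^sub>v x) n) \<le> D * cvec_norm x" if "0 \<le> n" for n
      using Pdec[OF x, of \<theta> "nat n"] dec1[of "nat n" x] that by simp
    thus ?thesis using Pxc[OF x] by (auto simp: stable_space_def)
  qed
  have QU: "x - P \<theta> *\<^sub>v x \<in> unstable_space \<theta>" if x: "x \<in> carrier_vec q" for \<theta> x
  proof -
    have "cmod (Ev \<theta> (x - P \<theta> *\<^sub>v x) n) \<le> D * cvec_norm x" if "n \<le> 0" for n
      using Qdec[OF x, of \<theta> "nat (- n)"] dec1[of "nat (- n)" x] that by simp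
    thus ?thesis using Pxc[OF x] x by (auto simp: unstable_space_def)
  qed
  have SU: "x = 0\<^sub>v q" if xs: "x \<in> stable_space \<theta>" and xu: "x \<in> unstable_space \<theta>" for x \<theta>
  proof -
    obtain B C where x: "x \<in> carrier_vec q" "\<And>n. 0 \<le> n \<Longrightarrow> cmod (Ev \<theta> x n) \<le> B" "\<And>n. n \<le> 0 \<Longrightarrow> cmod (Ev \<theta> x n) \<le> C"
      using xs xu unfolding stable_space_def unstable_space_def by blast
    have "cmod (Ev \<theta> x n) \<le> max B C" for n using x(2)[of n] x(3)[of n] by (cases "0 \<le> n") auto
    moreover have "L \<theta> (Ev \<theta> x) n = 0" for n using in_center_Ev[OF x(1)] by (simp add: in_center_def)
    ultimately have "Ev \<theta> x = (\<lambda>n. 0)" by (rule inj)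
    thus ?thesis by (intro Ev_inj[OF x(1), of _ \<theta>]) auto
  qed
  \<comment> \<open>x - P x is unstable by construction and stable as a difference of stable
    vectors, hence 0.\<close>
  have Pid: "P \<theta> *\<^sub>v x = x" if x: "x \<in> stable_space \<theta>" for x \<theta>
  proof -
    have c: "x \<in> carrier_vec q" using x stable_carrier by blast
    have "x - P \<theta> *\<^sub>v x = 0\<^sub>v q" by (rule SU[OF stable_diff[OF x PS[OF c]] QU[OF c]])
    hence "Ev \<theta> x n - Ev \<theta> (P \<theta> *\<^sub>v x) n = 0" for n using Ev_diff[OF c Pxc[OF c], of \<theta> \<theta> n] by simp
    thus ?thesis by (intro Ev_inj[OF Pxc[OF c] c, of \<theta>]) (auto simp: fun_eq_iff)
  qed
  have Pzero: "P \<theta> *\<^sub>v x = 0\<^sub>v q" if x: "x \<in> unstable_space \<theta>" for x \<theta>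
  proof -
    have c: "x \<in> carrier_vec q" using x unstable_carrier by blast
    have "x - (x - P \<theta> *\<^sub>v x) = P \<theta> *\<^sub>v x" using c Pxc[OF c, of \<theta>] by (intro eq_vecI) auto
    hence "P \<theta> *\<^sub>v x \<in> unstable_space \<theta>" using unstable_diff[OF x QU[OF c]] by simp
    thus ?thesis by (rule SU[OF PS[OF c]])
  qed
  have decs: "cmod (Ev \<theta> x (int n)) \<le> D * \<mu> ^ n * cvec_norm x" if x: "x \<in> stable_space \<theta>" for \<theta> x n
    using Pdec[OF subsetD[OF stable_carrier x], of \<theta> n] Pid[OF x] by simp
  have decu: "cmod (Ev \<theta> x (- int n)) \<le> D * \<mu> ^ n * cvec_norm x" if x: "x \<in> unstable_space \<theta>" for \<theta> x n
  proof -
    have c: "x \<in> carrier_vec q" using x unstable_carrier by blast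
    have "x - P \<theta> *\<^sub>v x = x" unfolding Pzero[OF x] using c by (intro eq_vecI) auto
    thus ?thesis using Qdec[OF c, of \<theta> n] by simp
  qed
  have split: "continuous_splitting q stable_space unstable_space"
    unfolding continuous_splitting_def
  proof (intro conjI allI)
    fix \<theta>
    show "VectorSpace.subspace class_ring (stable_space \<theta>) (module_vec TYPE(complex) q)" by (rule subspace_stable)
    show "VectorSpace.subspace class_ring (unstable_space \<theta>) (module_vec TYPE(complex) q)" by (rule subspace_unstable)
    have "0\<^sub>v q \<in> stable_space \<theta>" "0\<^sub>v q \<in> unstable_space \<theta>"
      by (auto simp: stable_space_def unstable_space_def intro: exI[of _ 0])
    thus "stable_space \<theta> \<inter> unstable_space \<theta> = {0\<^sub>v q}" using SU by blast
    show "\<forall>v\<in>carrier_vec q. \<exists>x\<in>stable_space \<theta>. \<exists>y\<in>unstable_space \<theta>. v = x + y"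
    proof
      fix v :: "complex vec" assume v: "v \<in> carrier_vec q"
      have "v = P \<theta> *\<^sub>v v + (v - P \<theta> *\<^sub>v v)" using v Pxc[OF v, of \<theta>] carrier_matD[OF Pc[of \<theta>]] by (intro eq_vecI) auto
      thus "\<exists>x\<in>stable_space \<theta>. \<exists>y\<in>unstable_space \<theta>. v = x + y" using PS[OF v] QU[OF v] by blast
    qed
  next
    show "\<exists>P. continuous_mat q P \<and> (\<forall>\<theta>. (\<forall>v\<in>stable_space \<theta>. P \<theta> *\<^sub>v v = v) \<and> (\<forall>v\<in>unstable_space \<theta>. P \<theta> *\<^sub>v v = 0\<^sub>v q))"
      using P_cont Pid Pzero by blast
  qed
  \<comment> \<open>The second summand covers window indices beyond the origin of the iterated
    vector, which occur for n < q; only the growth bound \<open>Ev_bound\<close> is available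
    there.\<close>
  define N where "N = D + real q * (2 * growth_const) * rp ^ q"
  have N: "D \<le> N" "0 \<le> N" using D growth_const_nonneg rp_pos by (auto simp: N_def)
  define KK where "KK = Kf * real q * (N * M) + 1"
  have KK: "0 < KK" "Kf * real q * (N * M) \<le> KK" using Kf N M by (auto simp: KK_def add_nonneg_pos)
  have contract: "cvec_norm (cocycle_iter q T cc n \<theta> *\<^sub>v v) \<le> KK * \<mu> ^ n * cvec_norm v"
    if v: "v \<in> stable_space \<theta>" for \<theta> n v
  proof -
    have c: "v \<in> carrier_vec q" using v stable_carrier by blast
    have "cvec_norm (cocycle_iter q T cc n \<theta> *\<^sub>v v) \<le> Kf * real q * (N * M * \<mu> ^ n * cvec_norm v)"
    proof (rule Ev_window_bound[OF iter_mult_carrier[OF c], of "(T ^^ n) \<theta>"])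
      fix i assume "i < q"
      have "cmod (Ev ((T ^^ n) \<theta>) (cocycle_iter q T cc n \<theta> *\<^sub>v v) (int i)) = cmod (Ev \<theta> v (int (i + n)))"
        by (simp add: Ev_iter[OF c])
      also have "\<dots> \<le> D * \<mu> ^ (i + n) * cvec_norm v" by (rule decs[OF v])
      also have "\<dots> \<le> N * M * \<mu> ^ n * cvec_norm v"
      proof (intro mult_right_mono mult_mono cvec_norm_nonneg)
        show "D \<le> N * M" using N M mult_left_mono[of 1 M N] by simp
        show "\<mu> ^ (i + n) \<le> \<mu> ^ n" using \<mu> by (intro power_decreasing) auto
      qed (use N M \<mu> in auto)
      finally show "cmod (Ev ((T ^^ n) \<theta>) (cocycle_iter q T cc n \<theta> *\<^sub>v v) (int i)) \<le> N * M * \<mu> ^ n * cvec_norm v" .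
    qed
    also have "\<dots> = Kf * real q * (N * M) * (\<mu> ^ n * cvec_norm v)" by (simp add: mult_ac)
    also have "\<dots> \<le> KK * (\<mu> ^ n * cvec_norm v)"
      by (rule mult_right_mono[OF KK(2)]) (use \<mu> cvec_norm_nonneg in auto)
    finally show ?thesis by (simp add: mult.assoc)
  qed
  have expand: "cvec_norm v \<le> KK * \<mu> ^ n * cvec_norm (cocycle_iter q T cc n \<theta> *\<^sub>v v)"
    if v: "v \<in> unstable_space \<theta>" for \<theta> n v
  proof -
    let ?y = "cocycle_iter q T cc n \<theta> *\<^sub>v v"
    have c: "v \<in> carrier_vec q" using v unstable_carrier by blast
    have yc: "?y \<in> carrier_vec q" by (rule iter_mult_carrier[OF c])
    have "(\<lambda>v. cocycle_iter q T cc n \<theta> *\<^sub>v v) ` unstable_space \<theta> = unstable_space ((T ^^ n) \<theta>)"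
      by (rule iter_image[OF image_cc[OF unstable_carrier unstable_cc] unstable_carrier])
    hence y: "?y \<in> unstable_space ((T ^^ n) \<theta>)" using v by blast
    have "cvec_norm v \<le> Kf * real q * (N * M * \<mu> ^ n * cvec_norm ?y)"
    proof (rule Ev_window_bound[OF c, of \<theta>])
      fix i assume i: "i < q"
      have e: "Ev \<theta> v (int i) = Ev ((T ^^ n) \<theta>) ?y (int i - int n)"
        using Ev_iter[OF c, of n \<theta> "int i - int n"] by simp
      show "cmod (Ev \<theta> v (int i)) \<le> N * M * \<mu> ^ n * cvec_norm ?y"
      proof (cases "i \<le> n")
        case True
        have "cmod (Ev \<theta> v (int i)) \<le> D * \<mu> ^ (n - i) * cvec_norm ?y"
          using decu[OF y, of "n - i"] True by (simp add: e of_nat_diff)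
        also have "\<dots> \<le> N * (M * \<mu> ^ n) * cvec_norm ?y"
        proof (intro mult_right_mono mult_mono cvec_norm_nonneg N)
          show "\<mu> ^ (n - i) \<le> M * \<mu> ^ n" unfolding M_def by (rule pow_shift[OF \<mu>(1,2)]) (use i in linarith)
        qed (use \<mu> in simp)
        finally show ?thesis by (simp add: mult.assoc)
      next
        case False
        have "cmod (Ev \<theta> v (int i)) \<le> real q * (2 * growth_const) * \<omega> (int (i - n)) * cvec_norm ?y"
          using Ev_bound[OF yc, of "(T ^^ n) \<theta>" "int i - int n"] False by (simp add: e of_nat_diff)
        also have "\<dots> \<le> N * (M * \<mu> ^ n) * cvec_norm ?y"
        proof (intro mult_right_mono cvec_norm_nonneg)
          have "\<omega> (int (i - n)) \<le> rp ^ q" unfolding wt_nat using i rp_gt by (intro power_increasing) auto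
          hence "real q * (2 * growth_const) * \<omega> (int (i - n)) \<le> real q * (2 * growth_const) * rp ^ q"
            using growth_const_nonneg by (intro mult_left_mono) auto
          also have "\<dots> \<le> N * 1" using D by (simp add: N_def)
          also have "\<dots> \<le> N * (M * \<mu> ^ n)"
          proof (rule mult_left_mono[OF _ N(2)])
            have "n \<le> 0 + q" using False i by simp
            from pow_shift[OF \<mu>(1,2) this] show "1 \<le> M * \<mu> ^ n" by (simp add: M_def)
          qed
          finally show "real q * (2 * growth_const) * \<omega> (int (i - n)) \<le> N * (M * \<mu> ^ n)" .
        qed
        finally show ?thesis by (simp add: mult.assoc)
      qed
    qed
    also have "\<dots> = Kf * real q * (N * M) * (\<mu> ^ n * cvec_norm ?y)" by (simp add: mult_ac)
    also have "\<dots> \<le> KK * (\<mu> ^ n * cvec_norm ?y)"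
      by (rule mult_right_mono[OF KK(2)]) (use \<mu> cvec_norm_nonneg in auto)
    finally show ?thesis by (simp add: mult.assoc)
  qed
  have inv1: "(\<lambda>v. cc \<theta> *\<^sub>v v) ` stable_space \<theta> = stable_space (T \<theta>)" for \<theta>
    by (rule image_cc[OF stable_carrier stable_cc])
  have inv2: "(\<lambda>v. cc \<theta> *\<^sub>v v) ` unstable_space \<theta> = unstable_space (T \<theta>)" for \<theta>
    by (rule image_cc[OF unstable_carrier unstable_cc])
  have "\<exists>K lam. 0 < K \<and> 0 < lam \<and> lam < 1 \<and>
     (\<forall>\<theta> n. (\<forall>v \<in> stable_space \<theta>. cvec_norm (cocycle_iter q T cc n \<theta> *\<^sub>v v) \<le> K * lam ^ n * cvec_norm v) \<and>
       (\<forall>v \<in> unstable_space \<theta>. cvec_norm v \<le> K * lam ^ n * cvec_norm (cocycle_iter q T cc n \<theta> *\<^sub>v v)))"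
    using contract expand KK(1) \<mu>(1,2) by (intro exI[of _ KK] exI[of _ \<mu>]) auto
  thus ?thesis unfolding uniformly_hyperbolic_def using GL_cc split inv1 inv2 by blast
qed

end

section \<open>The center cocycle and the spectrum\<close>

context green
begin

text \<open>\<open>g_fun\<close> is some continuous preimage of 1. On a compact base it is bounded,
  and \<open>G_unique\<close> leaves only one bounded candidate.\<close>

lemma g_fun_eq_G:
  assumes cpt: "compact (UNIV :: 'a set)"
    and D: "\<And>f B \<theta>. (\<And>\<theta>. cmod (f \<theta>) \<le> B) \<Longrightarrow> D_op V T W \<epsilon> \<zeta> (circ r t) f \<theta> =
       symop a (\<lambda>n. circ r t powi n * f (ziter T n \<theta>)) 0 + w \<theta> * f \<theta>"
  shows "g_fun V T W \<epsilon> \<zeta> (circ r t) \<theta> = G (\<theta>, t)"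
proof -
  let ?D = "D_op V T W \<epsilon> \<zeta> (circ r t)" and ?C = "{f :: 'a \<Rightarrow> complex. continuous_on UNIV f}"
  let ?g = "g_fun V T W \<epsilon> \<zeta> (circ r t)"
  have "?D (\<lambda>\<theta>. G (\<theta>, t)) = (\<lambda>\<theta>. 1)"
  proof
    fix \<theta>
    show "?D (\<lambda>\<theta>. G (\<theta>, t)) \<theta> = 1"
      using G_orbit[of t \<theta> 0] by (subst D[OF G_bound]) simp
  qed
  moreover have "(\<lambda>\<theta>. G (\<theta>, t)) \<in> ?C"
    by (auto intro!: continuous_on_compose2[OF G_cont] continuous_intros)
  ultimately have mem: "(\<lambda>\<theta>. 1) \<in> ?D ` ?C" by (metis imageI)
  have g: "continuous_on UNIV ?g" "?D ?g = (\<lambda>\<theta>. 1)"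
    using inv_into_into[OF mem] f_inv_into_f[OF mem] unfolding g_fun_def by auto
  have "compact (range ?g)" by (rule compact_continuous_image[OF g(1) cpt])
  then obtain B where B: "\<And>\<theta>. cmod (?g \<theta>) \<le> B" using compact_imp_bounded bounded_iff by (metis rangeI)
  show ?thesis
  proof (rule G_unique[OF B])
    show "symop a (\<lambda>n. circ r t powi n * ?g (ziter T n \<theta>)) 0 + w \<theta> * ?g \<theta> = 1" for \<theta>
      using fun_cong[OF g(2), of \<theta>] by (simp add: D[OF B])
  qed
qed

lemma contour_integral_eq_H:
  assumes "\<And>t \<theta>. g_fun V T W \<epsilon> \<zeta> (circ r t) \<theta> = G (\<theta>, t)"
  shows "contour_integral (circlepath 0 r) (\<lambda>z. z powi (k + p) * g_fun V T W \<epsilon> \<zeta> z (ziter T k \<theta>)) =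
    2 * of_real pi * \<i> * H p \<theta> k"
proof -
  have "circ r t * (circ r t powi (k + p) * y) = circ r t powi (k + p + 1) * y" for t y
    using r by (simp add: power_int_add)
  note eq = this
  show ?thesis unfolding contour_integral_circ H_def assms eq ..
qed

end

text \<open>A constant in the symbol is a multiple of the identity and may be counted as potential;
  this is how E - \<zeta> becomes part of w.\<close>

lemma symop_diff_delta:
  assumes "subweight \<omega>" "wsummable \<omega> (\<lambda>n. a n - c * deltaf 0 n)" "\<And>n. cmod (u n) \<le> C * \<omega> n"
  shows "symop a u n = symop (\<lambda>n. a n - c * deltaf 0 n) u n + c * u n"
proof -
  have "((\<lambda>k. (a k - c * deltaf 0 k) * u (n + k)) has_sum symop (\<lambda>n. a n - c * deltaf 0 n) u n) UNIV"
    unfolding symop_def by (rule has_sum_infsum[OF symop_summable[OF assms]])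
  moreover have "((\<lambda>k. c * deltaf 0 k * u (n + k)) has_sum c * u n) UNIV"
    by (rule has_sum_finite_neutralI[of "{0}"]) (auto simp: deltaf_def)
  ultimately have "((\<lambda>k. (a k - c * deltaf 0 k) * u (n + k) + c * deltaf 0 k * u (n + k)) has_sum
      symop (\<lambda>n. a n - c * deltaf 0 n) u n + c * u n) UNIV"
    by (rule has_sum_add)
  hence "((\<lambda>k. a k * u (n + k)) has_sum symop (\<lambda>n. a n - c * deltaf 0 n) u n + c * u n) UNIV"
    by (simp add: algebra_simps)
  thus ?thesis unfolding symop_def by (rule infsumI)
qed

theorem theorem1p2:
  fixes V :: "complex \<Rightarrow> complex" and h \<xi> rm rp E :: real
  assumes compact_Omega: "compact (UNIV :: 'a::metric_space set)"
    and h: "0 < \<xi>" "\<xi> < h"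
    and V_holo: "V holomorphic_on annulus h"
    and V_real: "\<And>z. cmod z = 1 \<Longrightarrow> V z \<in> \<real>"
    and V_nonconst: "\<not> V constant_on sphere 0 1"
    and radii: "exp (- \<xi>) < rm" "rm < 1" "1 < rp" "rp < exp \<xi>"
    and radii_zeros: "\<And>z. rm \<le> cmod z \<Longrightarrow> cmod z \<le> rp \<Longrightarrow> V z = of_real E \<Longrightarrow> cmod z = 1"
  shows "\<exists>\<delta>1>0. \<forall>W :: 'a \<Rightarrow> real. continuous_on UNIV W \<longrightarrow>
           (\<exists>\<epsilon>0>0. \<forall>T. minimal_homeo T \<longrightarrow>
              (\<forall>\<epsilon>::real. \<bar>\<epsilon>\<bar> < \<epsilon>0 \<longrightarrow>
                (\<forall>\<zeta>. cmod (\<zeta> - of_real E) < \<delta>1 \<longrightarrow>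
                  (\<forall>\<theta>. \<zeta> \<in> l2_spectrum (L_op V T W \<epsilon> \<theta>) \<longleftrightarrow>
                     \<not> uniformly_hyperbolic (center_dim V (of_real E)) T
                         (center_cocycle V (of_real E) T W rm rp \<epsilon> \<zeta>)))))"
proof -
  have radii_h: "exp (- h) < rm" "rp < exp h" using radii h by (smt (verit) exp_less_mono)+
  define \<alpha> where "\<alpha> = (\<lambda>n. fourier_coeff V n - of_real E * deltaf 0 n)"
  obtain bm bp \<kappa> \<eta> as where S: "laurent_symbol rm rp \<alpha> bm bp \<kappa> \<eta> as" and len: "length as = center_dim V (of_real E)"
    unfolding \<alpha>_def
    by (rule laurent_symbol_exists[OF V_holo V_nonconst radii_h(1) radii(2,3) radii_h(2) radii_zeros])
  interpret S: laurent_symbol rm rp \<alpha> bm bp \<kappa> \<eta> as by (rule S)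
  define \<beta>p where "\<beta>p = wnorm (\<lambda>n. rp powi n) bp"
  define \<beta>m where "\<beta>m = wnorm (\<lambda>n. rm powi n) bm"
  have \<beta>: "0 \<le> \<beta>p" "0 \<le> \<beta>m"
    unfolding \<beta>p_def \<beta>m_def by (intro wnorm_nonneg subweight_powi S.rp_pos S.rm_pos)+
  have gc: "0 \<le> S.growth_const"
    using \<beta> S.rp_pos by (simp add: S.growth_const_def \<beta>p_def \<beta>m_def)
  obtain Kw \<tau>1 where Kw: "0 \<le> Kw" "0 < \<tau>1" and window: "\<forall>w u C. (\<forall>n. cmod (w n) \<le> \<tau>1) \<longrightarrow> (\<forall>n. cmod (u n) \<le> C * wt rm rp n) \<longrightarrow>
     (\<forall>n. symop \<alpha> u n + w n * u n = 0) \<longrightarrow> (\<forall>n. cmod (u n) \<le> Kw * (\<Sum>i<length as. cmod (u (int i))) * wt rm rp n)"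
    using S.center_window_bound by blast
  obtain Kf \<tau>2 where Kf: "0 \<le> Kf" "0 < \<tau>2" and frame: "\<forall>w x vp vm. (\<forall>n. cmod (w n) \<le> \<tau>2) \<longrightarrow>
     (\<forall>n. cmod (vp n) \<le> S.growth_const * (\<Sum>p<length as. cmod (x p)) * rp powi n) \<longrightarrow>
     (\<forall>n. cmod (vm n) \<le> S.growth_const * (\<Sum>p<length as. cmod (x p)) * rm powi n) \<longrightarrow>
     (\<forall>n. symop \<alpha> vp n + w n * vp n = (\<Sum>p<length as. x p * deltaf (- int p - 1) n)) \<longrightarrow>
     (\<forall>n. symop \<alpha> vm n + w n * vm n = (\<Sum>p<length as. x p * deltaf (- int p - 1) n)) \<longrightarrow>
     (\<Sum>p<length as. cmod (x p)) \<le> Kf * (\<Sum>i<length as. cmod (vp (int i) - vm (int i)))"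
    using S.center_frame_bound[OF gc] by (elim exE conjE) (rule that)
  \<comment> \<open>One threshold for all purposes: \<tau>1 for the window, \<tau>2 for the frame,
    the last term for the fixed points on both circles. Nothing here refers to W or T.\<close>
  define \<tau> where "\<tau> = min (min \<tau>1 \<tau>2) (1 / (2 * (\<beta>p + \<beta>m + 1)))"
  have \<tau>: "0 < \<tau>" "\<tau> \<le> \<tau>1" "\<tau> \<le> \<tau>2" "\<tau> * \<beta>p \<le> 1 / 2" "\<tau> * \<beta>m \<le> 1 / 2"
  proof -
    show "0 < \<tau>" "\<tau> \<le> \<tau>1" "\<tau> \<le> \<tau>2" using Kw Kf \<beta> by (auto simp: \<tau>_def)
    have t: "\<tau> \<le> 1 / (2 * (\<beta>p + \<beta>m + 1))" by (simp add: \<tau>_def)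
    have "\<tau> * \<beta>p \<le> 1 / (2 * (\<beta>p + \<beta>m + 1)) * \<beta>p" by (rule mult_right_mono[OF t \<beta>(1)])
    also have "\<dots> \<le> 1 / 2" using \<beta> by (simp add: field_simps)
    finally show "\<tau> * \<beta>p \<le> 1 / 2" .
    have "\<tau> * \<beta>m \<le> 1 / (2 * (\<beta>p + \<beta>m + 1)) * \<beta>m" by (rule mult_right_mono[OF t \<beta>(2)])
    also have "\<dots> \<le> 1 / 2" using \<beta> by (simp add: field_simps)
    finally show "\<tau> * \<beta>m \<le> 1 / 2" .
  qed
  have main: "\<zeta> \<in> l2_spectrum (L_op V T W \<epsilon> \<theta>) \<longleftrightarrow>
      \<not> uniformly_hyperbolic (center_dim V (of_real E)) T (center_cocycle V (of_real E) T W rm rp \<epsilon> \<zeta>)"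
    if W: "continuous_on UNIV W" and small: "\<And>\<theta>. \<bar>\<epsilon> * W \<theta>\<bar> \<le> \<tau> / 2" and T: "minimal_homeo T" and \<zeta>: "cmod (\<zeta> - of_real E) < \<tau> / 2"
    for W :: "'a \<Rightarrow> real" and T \<epsilon> \<zeta> \<theta>
  proof -
    \<comment> \<open>The symbol stays fixed at energy E; half of \<tau> is reserved for the
      spectral shift and half for \<open>\<epsilon> * W\<close>.\<close>
    define w where "w = (\<lambda>\<theta>. of_real E - \<zeta> + of_real (\<epsilon> * W \<theta>) :: complex)"
    have homeo: "homeomorphism UNIV UNIV T (inv_into UNIV T)" using T by (simp add: minimal_homeo_def)
    have w_cont: "continuous_on UNIV w" unfolding w_def by (intro continuous_intros W)
    have w_bound: "cmod (w \<theta>) \<le> \<tau>" for \<theta>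
    proof -
      have "cmod (w \<theta>) \<le> cmod (of_real E - \<zeta>) + cmod (of_real (\<epsilon> * W \<theta>))" unfolding w_def by (rule norm_triangle_ineq)
      also have "cmod (of_real (\<epsilon> * W \<theta>)) = \<bar>\<epsilon> * W \<theta>\<bar>" by (rule norm_of_real)
      finally show ?thesis using small[of \<theta>] \<zeta> by (simp add: norm_minus_commute)
    qed
    have w_bound': "\<forall>n. cmod (w (ziter T n \<theta>)) \<le> \<tau>1" "\<forall>n. cmod (w (ziter T n \<theta>)) \<le> \<tau>2" for \<theta>
      using w_bound \<tau>(2,3) order_trans by blast+
    interpret gp: green rp \<alpha> bp T w \<tau>
      by unfold_locales
        (use S.rp_pos S.wsummable_powi[OF S.wsummable_\<alpha>] S.wsummable_bp S.inv_p homeo w_cont w_bound \<tau> in \<open>auto simp: \<beta>p_def\<close>)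
    interpret gm: green rm \<alpha> bm T w \<tau>
      by unfold_locales
        (use S.rm_pos S.wsummable_powi[OF S.wsummable_\<alpha>] S.wsummable_bm S.inv_m homeo w_cont w_bound \<tau> in \<open>auto simp: \<beta>m_def\<close>)
    interpret C: center rm rp \<alpha> bm bp \<kappa> \<eta> as T w \<tau> Kw Kf
    proof unfold_locales
      show "0 \<le> Kw" "0 \<le> Kf" by fact+
      show "cmod (u n) \<le> Kw * (\<Sum>i<length as. cmod (u (int i))) * wt rm rp n"
        if "\<And>n. cmod (u n) \<le> C * wt rm rp n" "\<And>n. symop \<alpha> u n + w (ziter T n \<theta>) * u n = 0" for \<theta> u C n
        using window[rule_format, of "\<lambda>n. w (ziter T n \<theta>)" u C n] w_bound' that by blast
      show "(\<Sum>p<length as. cmod (x p)) \<le> Kf * (\<Sum>i<length as. cmod (vp (int i) - vm (int i)))"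
        if "\<And>n. cmod (vp n) \<le> S.growth_const * (\<Sum>p<length as. cmod (x p)) * rp powi n"
          "\<And>n. cmod (vm n) \<le> S.growth_const * (\<Sum>p<length as. cmod (x p)) * rm powi n"
          "\<And>n. symop \<alpha> vp n + w (ziter T n \<theta>) * vp n = (\<Sum>p<length as. x p * deltaf (- int p - 1) n)"
          "\<And>n. symop \<alpha> vm n + w (ziter T n \<theta>) * vm n = (\<Sum>p<length as. x p * deltaf (- int p - 1) n)"
        for \<theta> x vp vm
        by (rule frame[rule_format, of "\<lambda>n. w (ziter T n \<theta>)"]) (use w_bound' that in blast)+
    qed
    have D: "D_op V T W \<epsilon> \<zeta> (circ r t) f \<theta> = symop \<alpha> (\<lambda>n. circ r t powi n * f (ziter T n \<theta>)) 0 + w \<theta> * f \<theta>"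
      if r: "0 < r" "wsummable (\<lambda>n. r powi n) \<alpha>" and f: "\<And>\<theta>. cmod (f \<theta>) \<le> B" for r t f B \<theta>
    proof -
      let ?u = "\<lambda>n. circ r t powi n * f (ziter T n \<theta>)"
      have "cmod (?u n) \<le> B * r powi n" for n
        using mult_right_mono[OF f, of "r powi n"] r(1) by (simp add: norm_mult norm_power_int mult.commute)
      from symop_diff_delta[OF subweight_powi[OF r(1)] r(2)[unfolded \<alpha>_def] this, of 0]
      have "(\<Sum>\<^sub>\<infinity>j. fourier_coeff V j * circ r t powi j * f (ziter T j \<theta>)) = symop \<alpha> ?u 0 + of_real E * f \<theta>"
        by (simp add: symop_def \<alpha>_def mult.assoc)
      thus ?thesis by (simp add: D_op_def w_def algebra_simps)
    qed
    have u_center: "u_center V T W rm rp \<epsilon> \<zeta> \<theta> p k = C.U p \<theta> k" for \<theta> p k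
    proof -
      have "g_fun V T W \<epsilon> \<zeta> (circ rp t) \<theta> = gp.G (\<theta>, t)" for t \<theta>
        by (rule gp.g_fun_eq_G[OF compact_Omega D[OF gp.r gp.wsummable_a]])
      note p = gp.contour_integral_eq_H[OF this]
      have "g_fun V T W \<epsilon> \<zeta> (circ rm t) \<theta> = gm.G (\<theta>, t)" for t \<theta>
        by (rule gm.g_fun_eq_G[OF compact_Omega D[OF gm.r gm.wsummable_a]])
      note m = gm.contour_integral_eq_H[OF this]
      show ?thesis unfolding u_center_def Let_def p m C.U_def by (simp flip: right_diff_distrib)
    qed
    have cc: "center_cocycle V (of_real E) T W rm rp \<epsilon> \<zeta> = C.cc"
      unfolding center_cocycle_def[abs_def] C.cc_def[abs_def] u_center len ..
    have L: "(\<lambda>n. L_op V T W \<epsilon> \<theta> u n - \<zeta> * u n) = C.L \<theta> u" if "u \<in> l2" for u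
    proof
      fix n
      have sum: "(\<Sum>\<^sub>\<infinity>k. fourier_coeff V k * u (n + k)) = symop \<alpha> u n + of_real E * u n"
        using symop_diff_delta[OF S.subweight_wt S.wsummable_\<alpha>[unfolded \<alpha>_def] C.l2_wt[OF that], of n]
        by (simp add: symop_def \<alpha>_def)
      have w: "w (ziter T n \<theta>) = of_real E - \<zeta> + of_real (\<epsilon> * W (ziter T n \<theta>))" by (simp add: w_def)
      show "L_op V T W \<epsilon> \<theta> u n - \<zeta> * u n = C.L \<theta> u n"
        unfolding L_op_def C.L_def sum w by (simp add: algebra_simps)
    qed
    have "\<zeta> \<in> l2_spectrum (L_op V T W \<epsilon> \<theta>) \<longleftrightarrow> \<not> C.l2_invertible \<theta>"
    proof -
      have "(\<forall>u\<in>l2. R (\<lambda>n. L_op V T W \<epsilon> \<theta> u n - \<zeta> * u n) = u \<and> (\<lambda>n. L_op V T W \<epsilon> \<theta> (R u) n - \<zeta> * R u n) = u) \<longleftrightarrow>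
         (\<forall>u\<in>l2. R (C.L \<theta> u) = u \<and> C.L \<theta> (R u) = u)" if "bounded_l2_op R" for R
        using that L unfolding bounded_l2_op_def by (intro ball_cong refl) auto
      thus ?thesis unfolding l2_spectrum_def C.l2_invertible_def by blast
    qed
    \<comment> \<open>The right-hand side does not involve \<theta>: invertibility at one point
      yields hyperbolicity, which returns invertibility at every point.\<close>
    moreover have "C.l2_invertible \<theta> \<longleftrightarrow> uniformly_hyperbolic (length as) T C.cc"
      using C.invertible_of_hyperbolic[OF compact_Omega] C.hyperbolic_of_invertible[of \<theta>] T
      unfolding minimal_homeo_def by blast
    ultimately show ?thesis by (simp add: cc len)
  qed
  show ?thesis
  proof (rule exI[of _ "\<tau> / 2"], rule conjI, use \<tau> in simp, intro allI impI)
    fix W :: "'a \<Rightarrow> real" assume W: "continuous_on UNIV W"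
    have "compact (range W)" by (rule compact_continuous_image[OF W compact_Omega])
    then obtain B where B: "\<And>\<theta>. \<bar>W \<theta>\<bar> \<le> B" using compact_imp_bounded bounded_iff by (metis rangeI real_norm_def)
    have B0: "0 \<le> B" using B[of undefined] by linarith
    show "\<exists>\<epsilon>0>0. \<forall>T. minimal_homeo T \<longrightarrow> (\<forall>\<epsilon>::real. \<bar>\<epsilon>\<bar> < \<epsilon>0 \<longrightarrow> (\<forall>\<zeta>. cmod (\<zeta> - of_real E) < \<tau> / 2 \<longrightarrow>
       (\<forall>\<theta>. \<zeta> \<in> l2_spectrum (L_op V T W \<epsilon> \<theta>) \<longleftrightarrow>
          \<not> uniformly_hyperbolic (center_dim V (of_real E)) T (center_cocycle V (of_real E) T W rm rp \<epsilon> \<zeta>))))"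
    \<comment> \<open>Dividing by \<open>B + 1\<close> keeps the threshold positive also when W
      vanishes.\<close>
    proof (rule exI[of _ "\<tau> / 2 / (B + 1)"], rule conjI, use \<tau> B0 in simp, intro allI impI)
      fix T :: "'a \<Rightarrow> 'a" and \<epsilon> :: real and \<zeta> :: complex and \<theta>
      assume T: "minimal_homeo T" and \<epsilon>: "\<bar>\<epsilon>\<bar> < \<tau> / 2 / (B + 1)" and \<zeta>: "cmod (\<zeta> - of_real E) < \<tau> / 2"
      have "\<bar>\<epsilon> * W \<theta>\<bar> \<le> \<tau> / 2" for \<theta>
      proof -
        have "\<bar>\<epsilon> * W \<theta>\<bar> \<le> \<tau> / 2 / (B + 1) * B"
          unfolding abs_mult using \<epsilon> B B0 \<tau> by (intro mult_mono) auto
        also have "\<dots> \<le> \<tau> / 2" using B0 \<tau> by (simp add: field_simps)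
        finally show ?thesis .
      qed
      thus "\<zeta> \<in> l2_spectrum (L_op V T W \<epsilon> \<theta>) \<longleftrightarrow>
          \<not> uniformly_hyperbolic (center_dim V (of_real E)) T (center_cocycle V (of_real E) T W rm rp \<epsilon> \<zeta>)"
        by (rule main[OF W _ T \<zeta>])
    qed
  qed
qed

end
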